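(* Let $G$ be a finite group. Suppose that $G$ has a non-trivial $3$-maximal subgroup and that any $3$-maximal subgroup of $G$ is an $IC\Phi$-subgroup of $G$. Then either $G$ is nilpotent or $G \cong SL_2(3)$.
   Context: All groups are finite. For a group $G$ and a subgroup $H \le G$, $[H,G]$ denotes the subgroup generated by all commutators $[h,g]$ with $h \in H$, $g \in G$, and $\Phi(H)$ denotes the Frattini subgroup of $H$ (the intersection of all maximal subgroups of $H$, with $\Phi(1)=1$). A subgroup $H$ of $G$ is an $IC\Phi$-subgroup of $G$ if $H \cap [H,G] \le \Phi(H)$. For a positive integer $n$, a subgroup $H$ of $G$ is $n$-maximal in $G$ if there is a chain of subgroups $H = H_0 < H_1 < \dots < H_n = G$, where $H_i$ is maximal in $H_{i+1}$ for all $0 \le i \le n-1$. $SL_2(3)$ is the special linear group of $2\times 2$ matrices of determinant $1$ over the field with $3$ elements. *)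

theory Defs
  imports "HOL-Algebra.Algebra" "HOL-Analysis.Determinants" "HOL-Library.Numeral_Type"
begin

text \<open>A subgroup \<open>H\<close> of \<open>G\<close>, regarded as a group in its own right, is \<open>G\<lparr>carrier := H\<rparr>\<close>.\<close>

text \<open>
  The commutator is written \<open>[h,g] = h g h\<^sup>-\<^sup>1 g\<^sup>-\<^sup>1\<close>, as in the library's \<open>derived\<close>. For subgroups
  \<open>H\<close>, \<open>K\<close> the convention \<open>h\<^sup>-\<^sup>1 g\<^sup>-\<^sup>1 h g\<close> yields the same set of commutators.
\<close>

definition commutator_subgroup ::
    "('a, 'b) monoid_scheme \<Rightarrow> 'a set \<Rightarrow> 'a set \<Rightarrow> 'a set" where
  "commutator_subgroup G H K =
     generate G {h \<otimes>\<^bsub>G\<^esub> g \<otimes>\<^bsub>G\<^esub> inv\<^bsub>G\<^esub> h \<otimes>\<^bsub>G\<^esub> inv\<^bsub>G\<^esub> g | h g. h \<in> H \<and> g \<in> K}"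

definition maximal_subgroup :: "'a set \<Rightarrow> ('a, 'b) monoid_scheme \<Rightarrow> bool" where
  "maximal_subgroup M G \<longleftrightarrow>
     subgroup M G \<and> M \<noteq> carrier G \<and>
     (\<forall>K. subgroup K G \<and> M \<subseteq> K \<longrightarrow> K = M \<or> K = carrier G)"

text \<open>
  Intersecting inside \<open>carrier G\<close> makes the Frattini subgroup of a group without maximal
  subgroups the whole group; for finite groups this is the convention \<open>\<Phi>(1) = 1\<close>.
\<close>

definition frattini :: "('a, 'b) monoid_scheme \<Rightarrow> 'a set" where
  "frattini G = carrier G \<inter> \<Inter> {M. maximal_subgroup M G}"

definition IC_Phi_subgroup :: "'a set \<Rightarrow> ('a, 'b) monoid_scheme \<Rightarrow> bool" where
  "IC_Phi_subgroup H G \<longleftrightarrow>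
     subgroup H G \<and>
     H \<inter> commutator_subgroup G H (carrier G) \<subseteq> frattini (G\<lparr>carrier := H\<rparr>)"

definition n_maximal_subgroup :: "nat \<Rightarrow> 'a set \<Rightarrow> ('a, 'b) monoid_scheme \<Rightarrow> bool" where
  "n_maximal_subgroup n H G \<longleftrightarrow>
     (\<exists>C :: nat \<Rightarrow> 'a set. C 0 = H \<and> C n = carrier G \<and>
        (\<forall>i\<le>n. subgroup (C i) G) \<and>
        (\<forall>i<n. maximal_subgroup (C i) (G\<lparr>carrier := C (Suc i)\<rparr>)))"

text \<open>The indices are shifted: \<open>lower_central G n\<close> is the term \<open>\<gamma>\<^sub>n\<^sub>+\<^sub>1(G)\<close>.\<close>

primrec lower_central :: "('a, 'b) monoid_scheme \<Rightarrow> nat \<Rightarrow> 'a set" where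
  "lower_central G 0 = carrier G"
| "lower_central G (Suc n) = commutator_subgroup G (lower_central G n) (carrier G)"

definition nilpotent_group :: "('a, 'b) monoid_scheme \<Rightarrow> bool" where
  "nilpotent_group G \<longleftrightarrow> group G \<and> (\<exists>n. lower_central G n = {\<one>\<^bsub>G\<^esub>})"

text \<open>The numeral type \<^typ>\<open>3\<close> carries the ring structure of the integers modulo 3.\<close>

definition SL2_3 :: "(3 ^ 2 ^ 2) monoid" where
  "SL2_3 = \<lparr>carrier = {A. det A = 1}, monoid.mult = (**), one = mat 1\<rparr>"

lemma group_SL2_3: "group SL2_3"
proof (rule groupI)
  fix A assume "A \<in> carrier SL2_3"
  then have d: "A$1$1 * A$2$2 - A$1$2 * A$2$1 = 1" by (simp add: SL2_3_def det_2)
  define B :: "3^2^2" where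
    "B = vector [vector [A$2$2, - (A$1$2)], vector [- (A$2$1), A$1$1]]"
  have B: "B$1$1 = A$2$2" "B$1$2 = - (A$1$2)" "B$2$1 = - (A$2$1)" "B$2$2 = A$1$1"
    by (simp_all add: B_def)
  have "det B = 1" using d by (simp add: det_2 B algebra_simps)
  moreover have "B ** A = mat 1" using d
    by (simp add: vec_eq_iff forall_2 matrix_matrix_mult_def sum_2 mat_def B algebra_simps)
  ultimately show "\<exists>B\<in>carrier SL2_3. B \<otimes>\<^bsub>SL2_3\<^esub> A = \<one>\<^bsub>SL2_3\<^esub>"
    by (auto simp: SL2_3_def)
qed (auto simp: SL2_3_def det_mul matrix_mul_assoc)

end

theory Submission
  imports Defs
begin

text \<open>
  A subgroup \<open>H\<close> with \<open>H \<inter> [H,G] \<le> \<Phi>(H)\<close> is nilpotent, because \<open>H' \<le> \<Phi>(H)\<close>. The main tool is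
  a normal nilpotent maximal subgroup \<open>M\<close> of a non-nilpotent group \<open>G\<close>: minimality and
  coprime action produce a \<open>p\<close>-element \<open>x \<in> M\<close> that lies in no IC\<open>\<Phi>\<close>-subgroup of \<open>G\<close> contained
  in \<open>M\<close>. If all maximal subgroups of \<open>G\<close> are IC\<open>\<Phi>\<close> this is absurd, so \<open>G\<close> is nilpotent; if all
  \<open>2\<close>-maximal subgroups are, then \<open>\<langle>x\<rangle> = M\<close> and \<open>\<bar>G\<bar>\<close> is a product of two primes; if all
  \<open>3\<close>-maximal subgroups are, then \<open>\<langle>x\<rangle>\<close> is maximal in \<open>M\<close>, and with a non-trivial \<open>3\<close>-maximal
  subgroup available this forces \<open>M = Q\<^sub>8\<close> and \<open>\<bar>G : M\<bar> = 3\<close>.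

  The existence of a normal maximal subgroup replaces solvability. When all maximal subgroups are
  nilpotent it follows from Schmidt's argument: otherwise distinct maximal subgroups meet in
  \<open>\<Phi>(G)\<close>, and counting their conjugates gives too many elements. When some maximal subgroup has order
  \<open>pq\<close>, a perfect \<open>G\<close> would be simple, and then \<open>[H,G] = G\<close> for every subgroup \<open>H \<noteq> 1\<close>.
\<close>

text \<open>Centrality is measured modulo Phi(M): the obstruction x lies outside \<open>Z\<close>,
  the preimage of Z(G/Phi(M)). Since IC-subgroups below M avoid x, no 3-maximal subgroup fits
  between <x> and M, which bounds the room above <x>. From below, <x> is controlled by its powers:
  if <x> is normal in G and some subgroup <x^(p^i)> other than 1 is IC, then the exponent k in g x
  g^-1 = x^k is 1 modulo p, and x would be in \<open>Z\<close>. This is where the non-trivial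
  3-maximal subgroup enters: it gives |G| at least four prime factors, so that the powers of x in
  question are not trivial. Hence <x> is not normal in G. The prime is found by a power computation:
  Phi(M) = <x^p> turns out to be central, and a conjugate of x can be corrected by an element of <x>
  to some w outside Phi(M) with w^(2p) = 1. All such w have order p^n with n >= 2, which leaves p =
  n = 2. Statements about a quotient G/N are mostly phrased as commutator conditions modulo N inside
  G, which keeps everything in one carrier.\<close>

hide_const (open) Divisibility.prime

section \<open>Word identities, subgroup orders and fixed points of p-groups\<close>

lemma (in group) inv_cancel1: "x \<in> carrier G \<Longrightarrow> y \<in> carrier G \<Longrightarrow> inv x \<otimes> (x \<otimes> y) = y"
  by (simp flip: m_assoc)

lemma (in group) inv_cancel2: "x \<in> carrier G \<Longrightarrow> y \<in> carrier G \<Longrightarrow> x \<otimes> (inv x \<otimes> y) = y"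
  by (simp flip: m_assoc)

text \<open>With the default rules for units and inverses this is the complete rewrite system for
  groups, so that \<open>simp\<close> settles identities between words in carrier elements.\<close>

lemmas (in group) word_simps = m_assoc inv_mult_group inv_cancel1 inv_cancel2

locale fgroup = group +
  assumes fin [simp, intro]: "finite (carrier G)"
begin

lemma finite_sub: "subgroup H G \<Longrightarrow> finite H"
  using rev_finite_subset[OF fin subgroup.subset] .

lemma sub_fgroup:
  assumes "subgroup H G"
  shows "fgroup (G\<lparr>carrier := H\<rparr>)"
proof -
  interpret H: group "G\<lparr>carrier := H\<rparr>" using assms by (rule subgroup_imp_group)
  show ?thesis by unfold_locales (simp add: finite_sub[OF assms])
qed

lemma card_sub_pos: "subgroup H G \<Longrightarrow> card H > 0"
  using fin subgroup.finite_imp_card_positive by blast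

lemma card_sub_dvd:
  assumes "subgroup H G" "subgroup K G" "H \<subseteq> K"
  shows "card H dvd card K"
proof -
  interpret K: fgroup "G\<lparr>carrier := K\<rparr>" using assms sub_fgroup by blast
  have "subgroup H (G\<lparr>carrier := K\<rparr>)" using assms subgroup_incl by blast
  from K.lagrange[OF this] have "card (rcosets\<^bsub>G\<lparr>carrier := K\<rparr>\<^esub> H) * card H = card K"
    by (simp add: order_def)
  then show ?thesis by (metis dvd_triv_right)
qed

lemma card_sub_psubset:
  assumes "subgroup H G" "subgroup K G" "H \<subset> K"
  shows "\<exists>i\<ge>2. card K = i * card H"
proof -
  have "card H dvd card K" using assms card_sub_dvd by auto
  then obtain i where i: "card K = i * card H" by (metis dvd_def mult.commute)
  have "card H < card K" using assms finite_sub psubset_card_mono by blast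
  then have "i \<noteq> 0" "i \<noteq> 1" using i by auto
  then show ?thesis using i by (intro exI[of _ i]) auto
qed

end

text \<open>Orbit sizes divide the group order, so every orbit with more than one point contributes
  a multiple of p. The action is a plain function that only has to behave on E, so conjugation and
  translation can be inserted directly.\<close>

lemma (in group) action_fixed_points_mod:
  fixes act :: "'a \<Rightarrow> 'c \<Rightarrow> 'c"
  assumes p: "prime p" and card: "card (carrier G) = p ^ n" and finE: "finite E"
    and clo: "\<And>g x. g \<in> carrier G \<Longrightarrow> x \<in> E \<Longrightarrow> act g x \<in> E"
    and one: "\<And>x. x \<in> E \<Longrightarrow> act \<one> x = x"
    and mul: "\<And>g h x. g \<in> carrier G \<Longrightarrow> h \<in> carrier G \<Longrightarrow> x \<in> E \<Longrightarrow> act (g \<otimes> h) x = act g (act h x)"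
  shows "p dvd card E \<longleftrightarrow> p dvd card {x \<in> E. \<forall>g\<in>carrier G. act g x = x}"
proof -
  \<comment> \<open>\<open>BijGroup\<close> consists of extensional bijections, hence the
    restriction to E.\<close>
  define \<phi> where "\<phi> g = restrict (act g) E" for g
  have bij: "\<phi> g \<in> Bij E" if g: "g \<in> carrier G" for g
  proof -
    have "bij_betw (act g) E E"
      by (rule bij_betw_byWitness[where f' = "act (inv g)"])
        (use g clo in \<open>auto simp flip: mul simp: one\<close>)
    then show ?thesis by (auto simp: Bij_def \<phi>_def bij_betw_restrict_eq)
  qed
  have "\<phi> (g \<otimes> h) = compose E (\<phi> g) (\<phi> h)" if "g \<in> carrier G" "h \<in> carrier G" for g h
    using that by (auto simp: \<phi>_def compose_def mul clo fun_eq_iff)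
  then have "\<phi> \<in> hom G (BijGroup E)"
    using bij by (auto simp: hom_def BijGroup_def)
  then interpret A: group_action G E \<phi>
    by (intro group_action.intro group_hom.intro group_hom_axioms.intro group_axioms group_BijGroup)
  let ?F = "{x \<in> E. \<forall>g\<in>carrier G. act g x = x}"
  let ?O = "orbits G E \<phi>"
  have "?O = (\<lambda>x. orbit G \<phi> x) ` E" by (auto simp: orbits_def)
  then have finO: "finite ?O" using finE by simp
  have orb_dvd: "card orb dvd p ^ n" if "orb \<in> ?O" for orb
  proof -
    from that obtain x where x: "x \<in> E" "orb = orbit G \<phi> x" by (auto simp: orbits_def)
    from A.orbit_stabilizer_theorem[OF x(1)] x card show ?thesis
      by (metis dvd_triv_left order_def)
  qed
  have orbit_E: "orbit G \<phi> x = {act g x | g. g \<in> carrier G}" if "x \<in> E" for x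
    using that by (auto simp: orbit_def \<phi>_def)
  have one_orbit: "{orb \<in> ?O. card orb = 1} = (\<lambda>x. {x}) ` ?F"
  proof (intro equalityI subsetI)
    fix orb assume "orb \<in> {orb \<in> ?O. card orb = 1}"
    then obtain x where x: "x \<in> E" "orb = orbit G \<phi> x" "card orb = 1" by (auto simp: orbits_def)
    then obtain y where y: "orb = {y}" by (meson card_1_singletonE)
    have "act g x = y" if "g \<in> carrier G" for g
      using that x y orbit_E[OF x(1)] by auto
    then have "x \<in> ?F" "orb = {x}" using x y one[OF x(1)] by fastforce+
    then show "orb \<in> (\<lambda>x. {x}) ` ?F" by blast
  next
    fix orb assume "orb \<in> (\<lambda>x. {x}) ` ?F"
    then obtain x where x: "x \<in> ?F" "orb = {x}" by auto
    have "orbit G \<phi> x = {x}"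
    proof -
      have "x \<in> E" using x by simp
      then show ?thesis unfolding orbit_E[OF \<open>x \<in> E\<close>] using x(1) one[of x]
        by (intro equalityI subsetI) (auto intro!: exI[of _ \<one>])
    qed
    then show "orb \<in> {orb \<in> ?O. card orb = 1}" using x by (auto simp: orbits_def)
  qed
  have "card E = (\<Sum>x\<in>E. 1)" by simp
  also have "\<dots> = (\<Sum>orb\<in>?O. card orb)"
    using A.disjoint_sum[OF finE, of "\<lambda>_. 1::nat"] by simp
  also have "\<dots> = (\<Sum>orb\<in>{orb \<in> ?O. card orb = 1}. card orb) + (\<Sum>orb\<in>{orb \<in> ?O. card orb \<noteq> 1}. card orb)"
    using finO by (subst sum.union_disjoint[symmetric]) (auto intro!: sum.cong)
  also have "(\<Sum>orb\<in>{orb \<in> ?O. card orb = 1}. card orb) = card ?F"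
    unfolding one_orbit by (subst sum.reindex) auto
  finally have E: "card E = card ?F + (\<Sum>orb\<in>{orb \<in> ?O. card orb \<noteq> 1}. card orb)" .
  have "p dvd (\<Sum>orb\<in>{orb \<in> ?O. card orb \<noteq> 1}. card orb)"
  proof (rule dvd_sum, safe)
    fix orb assume "orb \<in> ?O" "card orb \<noteq> 1"
    then show "p dvd card orb" using orb_dvd[of orb] p
      by (metis divides_primepow_nat dvd_power gr0I power_0)
  qed
  then show ?thesis unfolding E by (simp add: dvd_add_left_iff)
qed

subsection \<open>Commutators and normal subgroups\<close>

abbreviation (in group) commu where "commu x y \<equiv> x \<otimes> y \<otimes> inv x \<otimes> inv y"

context group
begin

lemma commutator_set_in_carrier:
  "A \<subseteq> carrier G \<Longrightarrow> {commu h g | h g. h \<in> A \<and> g \<in> carrier G} \<subseteq> carrier G"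
  by (auto simp: subset_iff)

lemma commutator_subgroup_subgroup:
  assumes "A \<subseteq> carrier G" "B \<subseteq> carrier G"
  shows "subgroup (commutator_subgroup G A B) G"
  unfolding commutator_subgroup_def
  by (rule generate_is_subgroup) (use assms in \<open>auto simp: subset_iff\<close>)

lemma commu_in_commutator_subgroup:
  "a \<in> A \<Longrightarrow> g \<in> B \<Longrightarrow> commu a g \<in> commutator_subgroup G A B"
  unfolding commutator_subgroup_def by (rule generate.incl) auto

lemma commutator_subgroup_subsetI:
  assumes "subgroup N G" "\<And>a g. a \<in> A \<Longrightarrow> g \<in> B \<Longrightarrow> commu a g \<in> N"
  shows "commutator_subgroup G A B \<subseteq> N"
  unfolding commutator_subgroup_def using assms by (intro generate_subgroup_incl) auto

lemma commutator_subgroup_mono: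
  assumes "A \<subseteq> A'" "B \<subseteq> B'"
  shows "commutator_subgroup G A B \<subseteq> commutator_subgroup G A' B'"
  unfolding commutator_subgroup_def using assms by (intro mono_generate) auto

lemma commutator_subgroup_consistent:
  assumes "subgroup H G" "A \<subseteq> H" "B \<subseteq> H"
  shows "commutator_subgroup (G\<lparr>carrier := H\<rparr>) A B = commutator_subgroup G A B"
proof -
  have eq: "{h \<otimes>\<^bsub>G\<lparr>carrier := H\<rparr>\<^esub> g \<otimes>\<^bsub>G\<lparr>carrier := H\<rparr>\<^esub> inv\<^bsub>G\<lparr>carrier := H\<rparr>\<^esub> h \<otimes>\<^bsub>G\<lparr>carrier := H\<rparr>\<^esub> inv\<^bsub>G\<lparr>carrier := H\<rparr>\<^esub> g | h g. h \<in> A \<and> g \<in> B}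
     = {commu h g | h g. h \<in> A \<and> g \<in> B}" (is "?L = ?R")
  proof -
    have "inv\<^bsub>G\<lparr>carrier := H\<rparr>\<^esub> x = inv x" if "x \<in> H" for x
      using assms that by simp
    then have "inv\<^bsub>G\<lparr>carrier := H\<rparr>\<^esub> x = inv x" if "x \<in> A \<or> x \<in> B" for x
      using that assms(2,3) by blast
    then show ?thesis by (intro Collect_cong ex_cong1) auto
  qed
  have "?R \<subseteq> H" using assms by (auto intro!: subgroup.m_closed subgroup.m_inv_closed dest: subsetD)
  then show ?thesis unfolding commutator_subgroup_def eq using assms(1) by (rule generate_consistent)
qed

lemma normal_closed: "N \<lhd> G \<Longrightarrow> x \<in> carrier G \<Longrightarrow> n \<in> N \<Longrightarrow> x \<otimes> n \<otimes> inv x \<in> N"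
  by (simp add: normal_inv_iff)

lemma normal_commu:
  assumes N: "N \<lhd> G" and n: "n \<in> N" and g: "g \<in> carrier G"
  shows "commu n g \<in> N" "commu g n \<in> N"
proof -
  have sN: "subgroup N G" using N by (rule normal_imp_subgroup)
  have nG: "n \<in> carrier G" using subgroup.mem_carrier[OF sN n] .
  have "n \<otimes> (g \<otimes> inv n \<otimes> inv g) \<in> N"
    by (rule subgroup.m_closed[OF sN n normal_closed[OF N g subgroup.m_inv_closed[OF sN n]]])
  then show "commu n g \<in> N" using nG g by (simp add: m_assoc)
  show "commu g n \<in> N"
    by (rule subgroup.m_closed[OF sN normal_closed[OF N g n] subgroup.m_inv_closed[OF sN n]])
qed

text \<open>On generators, x [a,g] x^-1 = [a,x]^-1 [a,xg]. A is an arbitrary subset because the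
  lemma is later applied to a single element.\<close>

lemma commutator_subgroup_normal:
  assumes A: "A \<subseteq> carrier G"
  shows "commutator_subgroup G A (carrier G) \<lhd> G"
proof (rule normal_invI)
  let ?C = "commutator_subgroup G A (carrier G)"
  show sub: "subgroup ?C G" using A commutator_subgroup_subgroup by blast
  have AG: "a \<in> A \<Longrightarrow> a \<in> carrier G" for a using A by auto
  have gen: "x \<otimes> commu a g \<otimes> inv x \<in> ?C" if "x \<in> carrier G" "a \<in> A" "g \<in> carrier G" for x a g
  proof -
    have "x \<otimes> commu a g \<otimes> inv x = inv (commu a x) \<otimes> commu a (x \<otimes> g)"
      using that AG by (simp add: word_simps)
    also have "\<dots> \<in> ?C"
      using that(1,3) subgroup.m_closed[OF sub subgroup.m_inv_closed[OF sub
          commu_in_commutator_subgroup[OF that(2,1)]] commu_in_commutator_subgroup[OF that(2)]]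
      by blast
    finally show ?thesis .
  qed
  fix x h assume x: "x \<in> carrier G" and h: "h \<in> ?C"
  let ?S = "{commu h g | h g. h \<in> A \<and> g \<in> carrier G}"
  have SG: "?S \<subseteq> carrier G" using A by (rule commutator_set_in_carrier)
  from h show "x \<otimes> h \<otimes> inv x \<in> ?C" unfolding commutator_subgroup_def
  proof (induction h rule: generate.induct)
    case one
    then show ?case using x by (simp add: generate.one)
  next
    case (incl h)
    then show ?case using gen x unfolding commutator_subgroup_def by blast
  next
    case (inv h)
    have "x \<otimes> h \<otimes> inv x \<in> generate G ?S" using inv gen x unfolding commutator_subgroup_def by blast
    then have "inv (x \<otimes> h \<otimes> inv x) \<in> generate G ?S" using SG by (rule generate_m_inv_closed[rotated])
    moreover have "inv (x \<otimes> h \<otimes> inv x) = x \<otimes> inv h \<otimes> inv x"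
      using x subsetD[OF SG inv] by (simp add: word_simps)
    ultimately show ?case by simp
  next
    case (eng h k)
    have "h \<in> carrier G" "k \<in> carrier G" using eng SG generate_in_carrier by blast+
    then have "x \<otimes> (h \<otimes> k) \<otimes> inv x = (x \<otimes> h \<otimes> inv x) \<otimes> (x \<otimes> k \<otimes> inv x)"
      using x by (simp add: word_simps)
    then show ?case using generate.eng[OF eng(3,4)] by simp
  qed
qed

text \<open>This is the preimage of the centralizer of xN in G/N; closure follows from [x,ab] =
  [x,a] a [x,b] a^-1. With N = 1 it serves as the ordinary centralizer.\<close>

lemma commutes_mod_subgroup:
  assumes N: "N \<lhd> G" and x: "x \<in> carrier G"
  shows "subgroup {g \<in> carrier G. commu x g \<in> N} G" (is "subgroup ?Z G")
proof (rule subgroupI)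
  have sN: "subgroup N G" using N by (rule normal_imp_subgroup)
  have ZI: "g \<in> ?Z" if "g \<in> carrier G" "commu x g \<in> N" for g using that by blast
  have "\<one> \<in> ?Z" using x subgroup.one_closed[OF sN] by (intro ZI) auto
  then show "?Z \<noteq> {}" by blast
  fix a assume "a \<in> ?Z"
  then have a: "a \<in> carrier G" "commu x a \<in> N" by blast+
  have "inv a \<otimes> inv (commu x a) \<otimes> inv (inv a) \<in> N"
    by (rule normal_closed[OF N inv_closed[OF a(1)] subgroup.m_inv_closed[OF sN a(2)]])
  moreover have "inv a \<otimes> inv (commu x a) \<otimes> inv (inv a) = commu x (inv a)"
    using a(1) x by (simp add: word_simps)
  ultimately show "inv a \<in> ?Z" using a(1) by (intro ZI) auto
  fix b assume "b \<in> ?Z"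
  then have b: "b \<in> carrier G" "commu x b \<in> N" by blast+
  have "commu x a \<otimes> (a \<otimes> commu x b \<otimes> inv a) \<in> N"
    by (rule subgroup.m_closed[OF sN a(2) normal_closed[OF N a(1) b(2)]])
  moreover have "commu x a \<otimes> (a \<otimes> commu x b \<otimes> inv a) = commu x (a \<otimes> b)"
    using a(1) b(1) x by (simp add: word_simps)
  ultimately show "a \<otimes> b \<in> ?Z" using a(1) b(1) by (intro ZI) auto
qed blast

text \<open>The set is the preimage of the centre of G/N.\<close>

lemma central_mod_normal:
  assumes N: "N \<lhd> G"
  shows "{x \<in> carrier G. \<forall>g\<in>carrier G. commu x g \<in> N} \<lhd> G" (is "?Z \<lhd> G")
proof (rule normal_invI)
  have sN: "subgroup N G" using N by (rule normal_imp_subgroup)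
  have ZI: "x \<in> ?Z" if "x \<in> carrier G" "\<And>g. g \<in> carrier G \<Longrightarrow> commu x g \<in> N" for x
    using that by blast
  have ZG: "x \<in> carrier G" if "x \<in> ?Z" for x using that by blast
  have ZD: "commu x g \<in> N" if "x \<in> ?Z" "g \<in> carrier G" for x g using that by blast
  show "subgroup ?Z G"
  proof (rule subgroupI)
    have "\<one> \<in> ?Z" using subgroup.one_closed[OF sN] by (intro ZI) auto
    then show "?Z \<noteq> {}" by blast
    fix a assume a: "a \<in> ?Z"
    note aG = ZG[OF a]
    show "inv a \<in> ?Z"
    proof (rule ZI)
      fix g assume g: "g \<in> carrier G"
      have "commu (inv a) g = inv a \<otimes> inv (commu a g) \<otimes> inv (inv a)"
        using aG g by (simp add: word_simps)
      then show "commu (inv a) g \<in> N"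
        using normal_closed[OF N inv_closed[OF aG] subgroup.m_inv_closed[OF sN ZD[OF a g]]] by simp
    qed (use aG in simp)
    fix b assume b: "b \<in> ?Z"
    note bG = ZG[OF b]
    show "a \<otimes> b \<in> ?Z"
    proof (rule ZI)
      fix g assume g: "g \<in> carrier G"
      have "commu (a \<otimes> b) g = (a \<otimes> commu b g \<otimes> inv a) \<otimes> commu a g"
        using aG bG g by (simp add: word_simps)
      then show "commu (a \<otimes> b) g \<in> N"
        using subgroup.m_closed[OF sN normal_closed[OF N aG ZD[OF b g]] ZD[OF a g]] by simp
    qed (use aG bG in simp)
  qed blast
  fix x h assume x: "x \<in> carrier G" and h: "h \<in> ?Z"
  note hG = ZG[OF h]
  show "x \<otimes> h \<otimes> inv x \<in> ?Z"
  proof (rule ZI)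
    fix g assume g: "g \<in> carrier G"
    have "commu (x \<otimes> h \<otimes> inv x) g = x \<otimes> commu h (inv x \<otimes> g \<otimes> x) \<otimes> inv x"
      using x hG g by (simp add: word_simps)
    then show "commu (x \<otimes> h \<otimes> inv x) g \<in> N"
      using normal_closed[OF N x ZD[OF h, of "inv x \<otimes> g \<otimes> x"]] x g by simp
  qed (use x hG in simp)
qed

text \<open>A conjugate is a commutator times the element itself: g h g^-1 = [h,g]^-1 h.\<close>

lemma normal_commuI:
  assumes K: "subgroup K G" and comm: "\<And>x g. x \<in> K \<Longrightarrow> g \<in> carrier G \<Longrightarrow> commu x g \<in> K"
  shows "K \<lhd> G"
proof (rule normal_invI[OF K])
  fix g h assume g: "g \<in> carrier G" and h: "h \<in> K"
  have hG: "h \<in> carrier G" using subgroup.mem_carrier[OF K h] .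
  have "inv (commu h g) \<otimes> h \<in> K"
    by (rule subgroup.m_closed[OF K subgroup.m_inv_closed[OF K comm[OF h g]] h])
  moreover have "inv (commu h g) \<otimes> h = g \<otimes> h \<otimes> inv g" using g hG by (simp add: word_simps)
  ultimately show "g \<otimes> h \<otimes> inv g \<in> K" by simp
qed

end

subsection \<open>Sylow subgroups\<close>

text \<open>Stated by a vanishing power instead of the order of x, so that it passes unchanged to
  subgroups. The identity is a p-element for every p.\<close>

definition p_elem :: "('a, 'b) monoid_scheme \<Rightarrow> nat \<Rightarrow> 'a \<Rightarrow> bool" where
  "p_elem G p x \<longleftrightarrow> x \<in> carrier G \<and> (\<exists>k. x [^]\<^bsub>G\<^esub> (p ^ k) = \<one>\<^bsub>G\<^esub>)"

text \<open>For a prime p that does not divide the group order this is the trivial subgroup, so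
  Sylow subgroups exist for all primes and no case distinction arises.\<close>

definition sylow_subgroup :: "('a, 'b) monoid_scheme \<Rightarrow> nat \<Rightarrow> 'a set \<Rightarrow> bool" where
  "sylow_subgroup G p S \<longleftrightarrow> subgroup S G \<and> card S = p ^ multiplicity p (card (carrier G))"

context group
begin

lemma p_elem_sub:
  assumes "subgroup H G"
  shows "p_elem (G\<lparr>carrier := H\<rparr>) p x \<longleftrightarrow> x \<in> H \<and> p_elem G p x"
  using subgroup.mem_carrier[OF assms] by (auto simp: p_elem_def nat_pow_consistent[symmetric])

lemma subgroup_sub_iff:
  assumes "subgroup L G"
  shows "subgroup K (G\<lparr>carrier := L\<rparr>) \<longleftrightarrow> subgroup K G \<and> K \<subseteq> L"
  using incl_subgroup[OF assms, of K] subgroup_incl[OF _ assms, of K]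
    subgroup.subset[of K "G\<lparr>carrier := L\<rparr>"] by auto

lemma maximal_subgroup_iff:
  assumes "subgroup L G"
  shows "maximal_subgroup M (G\<lparr>carrier := L\<rparr>) \<longleftrightarrow>
    subgroup M G \<and> M \<subset> L \<and> (\<forall>K. subgroup K G \<and> M \<subseteq> K \<and> K \<subseteq> L \<longrightarrow> K = M \<or> K = L)"
  unfolding maximal_subgroup_def subgroup_sub_iff[OF assms] by auto

lemma normal_sub_iff:
  assumes "subgroup L G"
  shows "N \<lhd> G\<lparr>carrier := L\<rparr> \<longleftrightarrow>
    subgroup N G \<and> N \<subseteq> L \<and> (\<forall>x\<in>L. \<forall>n\<in>N. x \<otimes> n \<otimes> inv x \<in> N)"
  using group.normal_inv_iff[OF subgroup_imp_group[OF assms], of N]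
  by (auto simp: subgroup_sub_iff[OF assms] m_inv_consistent[OF assms])

lemma subgroup_card_1:
  assumes "subgroup H G" "card H = 1"
  shows "H = {\<one>}"
  using assms subgroup.one_closed[OF assms(1)] by (metis card_1_singletonE singletonD)

lemma commu_one_iff:
  assumes "x \<in> carrier G" "y \<in> carrier G"
  shows "commu x y = \<one> \<longleftrightarrow> x \<otimes> y = y \<otimes> x"
proof -
  have "commu x y = (x \<otimes> y) \<otimes> inv (y \<otimes> x)" using assms by (simp add: word_simps)
  then show ?thesis using assms inv_solve_right'[of \<one> "x \<otimes> y" "y \<otimes> x"] by auto
qed

text \<open>The normalizer. Both directions of conjugation are required, which makes it a subgroup
  for any subset H, finite or not.\<close>

definition normalizing :: "'a set \<Rightarrow> 'a set" where
  "normalizing H = {x \<in> carrier G. \<forall>h\<in>H. x \<otimes> h \<otimes> inv x \<in> H \<and> inv x \<otimes> h \<otimes> x \<in> H}"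

lemma subgroup_normalizing:
  assumes H: "H \<subseteq> carrier G"
  shows "subgroup (normalizing H) G"
proof (rule subgroupI)
  show "normalizing H \<subseteq> carrier G" by (auto simp: normalizing_def)
  have "\<one> \<in> normalizing H" using H by (auto simp: normalizing_def)
  then show "normalizing H \<noteq> {}" by blast
  fix a assume a: "a \<in> normalizing H"
  then show "inv a \<in> normalizing H" by (auto simp: normalizing_def)
  fix b assume b: "b \<in> normalizing H"
  have aG: "a \<in> carrier G" and bG: "b \<in> carrier G" using a b by (auto simp: normalizing_def)
  have "a \<otimes> b \<otimes> h \<otimes> inv (a \<otimes> b) \<in> H \<and> inv (a \<otimes> b) \<otimes> h \<otimes> (a \<otimes> b) \<in> H" if h: "h \<in> H" for h
  proof -
    have hG: "h \<in> carrier G" using h H by blast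
    have "b \<otimes> h \<otimes> inv b \<in> H" "inv a \<otimes> h \<otimes> a \<in> H" using a b h by (auto simp: normalizing_def)
    then have "a \<otimes> (b \<otimes> h \<otimes> inv b) \<otimes> inv a \<in> H" "inv b \<otimes> (inv a \<otimes> h \<otimes> a) \<otimes> b \<in> H"
      using a b unfolding normalizing_def by blast+
    moreover have "a \<otimes> (b \<otimes> h \<otimes> inv b) \<otimes> inv a = a \<otimes> b \<otimes> h \<otimes> inv (a \<otimes> b)"
      "inv b \<otimes> (inv a \<otimes> h \<otimes> a) \<otimes> b = inv (a \<otimes> b) \<otimes> h \<otimes> (a \<otimes> b)"
      using aG bG hG by (simp_all add: word_simps)
    ultimately show ?thesis by simp
  qed
  then show "a \<otimes> b \<in> normalizing H" using aG bG by (simp add: normalizing_def)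
qed

lemma sub_normalizing:
  assumes "subgroup H G"
  shows "H \<subseteq> normalizing H"
proof
  fix x assume x: "x \<in> H"
  then show "x \<in> normalizing H" unfolding normalizing_def
    using subgroup.m_closed[OF assms] subgroup.m_inv_closed[OF assms] subgroup.mem_carrier[OF assms] by simp
qed

lemma normalizing_eq_carrier:
  assumes "subgroup H G" "normalizing H = carrier G"
  shows "H \<lhd> G"
  by (rule normal_invI[OF assms(1)]) (use assms(2) in \<open>auto simp: normalizing_def\<close>)

text \<open>Conjugation by x is an injective self-map of the finite set H, hence onto, so one
  direction of conjugation implies the other.\<close>

lemma normalizing_finiteI:
  assumes H: "finite H" "H \<subseteq> carrier G" and x: "x \<in> carrier G"
    and conj: "\<And>h. h \<in> H \<Longrightarrow> x \<otimes> h \<otimes> inv x \<in> H"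
  shows "x \<in> normalizing H"
proof -
  let ?f = "\<lambda>h. x \<otimes> h \<otimes> inv x"
  have HG: "h \<in> carrier G" if "h \<in> H" for h using H(2) that by (rule subsetD)
  have "inj_on ?f H"
  proof (rule inj_onI)
    fix h k assume "h \<in> H" "k \<in> H" "?f h = ?f k"
    with HG[of h] HG[of k] x show "h = k" by simp
  qed
  moreover have "?f ` H \<subseteq> H" by (rule image_subsetI) (rule conj)
  ultimately have im: "?f ` H = H" using endo_inj_surj[OF H(1)] by metis
  have "inv x \<otimes> h \<otimes> x \<in> H" if h: "h \<in> H" for h
  proof -
    have "h \<in> ?f ` H" using im h by metis
    then obtain k where k: "k \<in> H" "h = x \<otimes> k \<otimes> inv x" by (rule imageE)
    have "inv x \<otimes> h \<otimes> x = k" unfolding k(2) using x HG[OF k(1)] by (simp add: word_simps)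
    then show ?thesis using k(1) by metis
  qed
  then show ?thesis unfolding normalizing_def using x conj by blast
qed

lemma conj_subgroup:
  assumes H: "subgroup H G" and x: "x \<in> carrier G"
  shows "subgroup ((\<lambda>h. x \<otimes> h \<otimes> inv x) ` H) G" "card ((\<lambda>h. x \<otimes> h \<otimes> inv x) ` H) = card H"
proof -
  have HG: "h \<in> carrier G" if "h \<in> H" for h using subgroup.mem_carrier[OF H that] .
  show "subgroup ((\<lambda>h. x \<otimes> h \<otimes> inv x) ` H) G"
  proof (rule subgroupI)
    show "(\<lambda>h. x \<otimes> h \<otimes> inv x) ` H \<subseteq> carrier G" using HG x by auto
    show "(\<lambda>h. x \<otimes> h \<otimes> inv x) ` H \<noteq> {}" using subgroup.one_closed[OF H] by blast
    fix a assume "a \<in> (\<lambda>h. x \<otimes> h \<otimes> inv x) ` H"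
    then obtain h where h: "h \<in> H" "a = x \<otimes> h \<otimes> inv x" by blast
    have "inv a = x \<otimes> inv h \<otimes> inv x" using h HG x by (simp add: word_simps)
    then show "inv a \<in> (\<lambda>h. x \<otimes> h \<otimes> inv x) ` H" using subgroup.m_inv_closed[OF H h(1)] by blast
    fix b assume "b \<in> (\<lambda>h. x \<otimes> h \<otimes> inv x) ` H"
    then obtain k where k: "k \<in> H" "b = x \<otimes> k \<otimes> inv x" by blast
    have "a \<otimes> b = x \<otimes> (h \<otimes> k) \<otimes> inv x" using h k HG x by (simp add: word_simps)
    then show "a \<otimes> b \<in> (\<lambda>h. x \<otimes> h \<otimes> inv x) ` H" using subgroup.m_closed[OF H h(1) k(1)] by blast
  qed
  have "inj_on (\<lambda>h. x \<otimes> h \<otimes> inv x) H"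
  proof (rule inj_onI)
    fix h k assume "h \<in> H" "k \<in> H" "x \<otimes> h \<otimes> inv x = x \<otimes> k \<otimes> inv x"
    with HG[of h] HG[of k] x show "h = k" by simp
  qed
  then show "card ((\<lambda>h. x \<otimes> h \<otimes> inv x) ` H) = card H" by (rule card_image)
qed

lemma set_mult_elem:
  "x \<in> N <#> H \<longleftrightarrow> (\<exists>n\<in>N. \<exists>h\<in>H. x = n \<otimes> h)"
  by (auto simp: set_mult_def)

lemma set_mult_contains:
  assumes "subgroup N G" "subgroup H G"
  shows "N \<subseteq> N <#> H" "H \<subseteq> N <#> H"
proof -
  show "N \<subseteq> N <#> H" unfolding set_mult_elem subset_iff
    using subgroup.one_closed[OF assms(2)] subgroup.mem_carrier[OF assms(1)] r_one by metis
  show "H \<subseteq> N <#> H" unfolding set_mult_elem subset_iff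
    using subgroup.one_closed[OF assms(1)] subgroup.mem_carrier[OF assms(2)] l_one by metis
qed

lemma maximal_set_mult:
  assumes M: "maximal_subgroup M G" and N: "N \<lhd> G" and NM: "\<not> N \<subseteq> M"
  shows "N <#> M = carrier G"
proof -
  have sN: "subgroup N G" and sM: "subgroup M G"
    using N M normal_imp_subgroup by (auto simp: maximal_subgroup_def)
  have "subgroup (N <#> M) G" using mult_norm_subgroup[OF N sM] .
  then have "N <#> M = M \<or> N <#> M = carrier G"
    using M set_mult_contains(2)[OF sN sM] by (simp add: maximal_subgroup_def)
  then show ?thesis using NM set_mult_contains(1)[OF sN sM] by blast
qed

end

context fgroup
begin

lemma card_subset_eq_sub: "subgroup K G \<Longrightarrow> H \<subseteq> K \<Longrightarrow> card H = card K \<Longrightarrow> H = K"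
  using card_subset_eq[OF finite_sub] by blast

lemma maximal_above:
  assumes "subgroup H G" "H \<noteq> carrier G"
  shows "\<exists>M. maximal_subgroup M G \<and> H \<subseteq> M"
proof -
  let ?S = "{K. subgroup K G \<and> H \<subseteq> K \<and> K \<noteq> carrier G}"
  have "?S \<subseteq> Pow (carrier G)" using subgroup.subset by auto
  then have "finite ?S" using fin finite_subset by blast
  moreover have "H \<in> ?S" using assms by blast
  ultimately obtain M where M: "M \<in> ?S" "\<And>K. K \<in> ?S \<Longrightarrow> M \<subseteq> K \<Longrightarrow> M = K"
    using finite_has_maximal2[of ?S H] by meson
  have M1: "subgroup M G" "H \<subseteq> M" "M \<noteq> carrier G" using M(1) by simp_all
  have "maximal_subgroup M G" unfolding maximal_subgroup_def
  proof (intro conjI allI impI)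
    fix K assume K: "subgroup K G \<and> M \<subseteq> K"
    show "K = M \<or> K = carrier G"
    proof (cases "K = carrier G")
      case False
      then have "K \<in> ?S" using K M1(2) by blast
      then show ?thesis using M(2)[of K] K by simp
    qed simp
  qed (use M1 in simp_all)
  then show ?thesis using M1(2) by metis
qed

lemma card_carrier_nonzero: "card (carrier G) \<noteq> 0"
  using card_sub_pos[OF subgroup_self] by (rule less_imp_neq[symmetric])

lemma prime_not_unit: "prime p \<Longrightarrow> \<not> is_unit p"
  using not_prime_unit by blast

lemma sylow_exists:
  assumes "prime p"
  shows "\<exists>S. sylow_subgroup G p S"
proof -
  have "order G = p ^ multiplicity p (card (carrier G)) * (card (carrier G) div p ^ multiplicity p (card (carrier G)))"
    unfolding order_def by (rule dvd_mult_div_cancel[OF multiplicity_dvd, symmetric])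
  from sylow_thm[OF assms group_axioms this fin] show ?thesis unfolding sylow_subgroup_def .
qed

lemma sylow_index:
  assumes "prime p" "sylow_subgroup G p S"
  shows "\<not> p dvd card (rcosets S)"
proof
  assume "p dvd card (rcosets S)"
  have S: "subgroup S G" "card S = p ^ multiplicity p (card (carrier G))"
    using assms by (auto simp: sylow_subgroup_def)
  have "card (rcosets S) * card S = card (carrier G)" using lagrange[OF S(1)] by (simp add: order_def)
  then have "p ^ Suc (multiplicity p (card (carrier G))) dvd card (carrier G)"
    using \<open>p dvd card (rcosets S)\<close> S(2) by (metis mult_dvd_mono dvd_refl power_Suc)
  then show False
    using power_dvd_iff_le_multiplicity[OF card_carrier_nonzero prime_not_unit[OF assms(1)]] by (metis Suc_n_not_le_n)
qed

text \<open>Q acts on the right cosets of S by right translation with inverses. Their number is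
  prime to p, so some coset Sx is fixed, which says that x Q x^-1 lies in S.\<close>

lemma sylow_conj:
  assumes p: "prime p" and S: "sylow_subgroup G p S" and Q: "subgroup Q G" "card Q = p ^ n"
  shows "\<exists>x\<in>carrier G. \<forall>q\<in>Q. x \<otimes> q \<otimes> inv x \<in> S"
proof -
  interpret Q: group "G\<lparr>carrier := Q\<rparr>" using Q by (simp add: subgroup_imp_group)
  have sS: "subgroup S G" using S by (simp add: sylow_subgroup_def)
  have QG: "q \<in> carrier G" if "q \<in> Q" for q using subgroup.mem_carrier[OF Q(1) that] .
  have SG: "S \<subseteq> carrier G" using subgroup.subset[OF sS] .
  have rcG: "A \<subseteq> carrier G" if "A \<in> rcosets S" for A
    using that SG by (auto simp: RCOSETS_def r_coset_def)
  have fin_rc: "finite (rcosets S)" using rcosets_finite[of _ S] fin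
    by (simp add: RCOSETS_def)
  have act: "p dvd card (rcosets S) \<longleftrightarrow>
    p dvd card {A \<in> rcosets S. \<forall>g\<in>carrier (G\<lparr>carrier := Q\<rparr>). A #> inv g = A}"
  proof (rule Q.action_fixed_points_mod[OF p _ fin_rc])
    show "card (carrier (G\<lparr>carrier := Q\<rparr>)) = p ^ n" using Q by simp
    show "A #> inv g \<in> rcosets S" if gQ: "g \<in> carrier (G\<lparr>carrier := Q\<rparr>)" and A: "A \<in> rcosets S" for A g
    proof -
      have g: "g \<in> carrier G" using gQ QG by simp
      obtain x where x: "x \<in> carrier G" "A = S #> x" using A by (auto simp: RCOSETS_def)
      have "A #> inv g = S #> (x \<otimes> inv g)" using x g SG by (simp add: coset_mult_assoc)
      then show ?thesis using rcosetsI[OF SG, of "x \<otimes> inv g"] x g by simp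
    qed
    show "A #> inv \<one>\<^bsub>G\<lparr>carrier := Q\<rparr>\<^esub> = A" if A: "A \<in> rcosets S" for A
      using rcG[OF A] by simp
    show "A #> inv (g \<otimes>\<^bsub>G\<lparr>carrier := Q\<rparr>\<^esub> h) = A #> inv h #> inv g"
      if gh: "g \<in> carrier (G\<lparr>carrier := Q\<rparr>)" "h \<in> carrier (G\<lparr>carrier := Q\<rparr>)" and A: "A \<in> rcosets S" for A g h
      using gh QG rcG[OF A] by (simp add: coset_mult_assoc inv_mult_group)
  qed
  \<comment> \<open>Without fixed cosets their number would be 0, a multiple of p, whereas p does
    not divide the index of S.\<close>
  have "{A \<in> rcosets S. \<forall>g\<in>Q. A #> inv g = A} \<noteq> {}"
  proof
    assume "{A \<in> rcosets S. \<forall>g\<in>Q. A #> inv g = A} = {}"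
    then have "p dvd card (rcosets S)" using act[simplified] by (simp only: card.empty dvd_0_right simp_thms)
    then show False using sylow_index[OF p S] by simp
  qed
  then obtain A where A: "A \<in> rcosets S" "\<And>g. g \<in> Q \<Longrightarrow> A #> inv g = A" by blast
  then obtain x where x: "x \<in> carrier G" "A = S #> x" by (auto simp: RCOSETS_def)
  have "x \<otimes> q \<otimes> inv x \<in> S" if q: "q \<in> Q" for q
  proof -
    have "inv q \<in> Q" using subgroup.m_inv_closed[OF Q(1) q] .
    from A(2)[OF this] have "S #> x #> q = S #> x" using x QG[OF q] by simp
    then have "S #> (x \<otimes> q) = S #> x" using coset_mult_assoc[OF SG x(1) QG[OF q]] by simp
    then have "x \<otimes> q \<in> S #> x" using rcos_self[of "x \<otimes> q" S] sS x QG[OF q] by simp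
    then obtain s where s: "s \<in> S" "x \<otimes> q = s \<otimes> x" by (auto simp: r_coset_def)
    then have "x \<otimes> q \<otimes> inv x = s" using x QG[OF q] subsetD[OF SG] by (simp add: word_simps)
    then show ?thesis using s by simp
  qed
  then show ?thesis using x by blast
qed

text \<open>The order of H is then divisible by every prime power exactly dividing |G|. This is the
  standard way below to show that a subgroup is everything: find one Sylow subgroup in it for each
  prime.\<close>

lemma sylow_dvd_eq:
  assumes H: "subgroup H G"
    and dvd: "\<And>p. prime p \<Longrightarrow> \<exists>S. sylow_subgroup G p S \<and> S \<subseteq> H"
  shows "H = carrier G"
proof -
  have "card (carrier G) dvd card H"
  proof (rule multiplicity_le_imp_dvd)
    show "card (carrier G) \<noteq> 0" by (rule card_carrier_nonzero)
    fix p :: nat assume p: "prime p"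
    obtain S where S: "sylow_subgroup G p S" "S \<subseteq> H" using dvd[OF p] by blast
    have "p ^ multiplicity p (card (carrier G)) dvd card H"
      using card_sub_dvd[OF _ H S(2)] S(1) by (auto simp: sylow_subgroup_def)
    then show "multiplicity p (card (carrier G)) \<le> multiplicity p (card H)"
      using power_dvd_iff_le_multiplicity[of "card H" p] prime_not_unit[OF p] card_sub_pos[OF H] by simp
  qed
  then have "card (carrier G) \<le> card H" using card_sub_pos[OF H] by (simp add: dvd_imp_le)
  then show ?thesis using card_seteq[OF fin subgroup.subset[OF H]] by simp
qed

lemma p_elem_generate_card:
  assumes "prime p" "p_elem G p x"
  shows "\<exists>k. card (generate G {x}) = p ^ k"
proof -
  obtain k where x: "x \<in> carrier G" "x [^] (p ^ k) = \<one>" using assms by (auto simp: p_elem_def)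
  then have "ord x dvd p ^ k" using pow_eq_id by simp
  then show ?thesis using generate_pow_card[OF x(1)] assms(1) divides_primepow_nat by metis
qed

lemma generate_singleton:
  assumes "x \<in> carrier G"
  shows "subgroup (generate G {x}) G" "x \<in> generate G {x}"
  using generate_is_subgroup[of "{x}"] assms generate.incl[of x "{x}"] by auto

text \<open>The p-group <x> is conjugate into S, and a normal S absorbs the conjugation.\<close>

lemma p_elem_in_normal_sylow:
  assumes "prime p" "p_elem G p x" "sylow_subgroup G p S" "S \<lhd> G"
  shows "x \<in> S"
proof -
  have x: "x \<in> carrier G" using assms by (simp add: p_elem_def)
  obtain k where "card (generate G {x}) = p ^ k" using p_elem_generate_card[OF assms(1,2)] by blast
  from sylow_conj[OF assms(1,3) generate_singleton(1)[OF x] this]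
  obtain y where y: "y \<in> carrier G" "y \<otimes> x \<otimes> inv y \<in> S" using generate_singleton(2)[OF x] by blast
  have "inv y \<otimes> (y \<otimes> x \<otimes> inv y) \<otimes> inv (inv y) \<in> S"
    using normal_closed[OF assms(4) inv_closed[OF y(1)] y(2)] .
  then show ?thesis using x y by (simp add: word_simps)
qed

lemma in_p_subgroup_p_elem:
  assumes "subgroup S G" "card S = p ^ n" "x \<in> S"
  shows "p_elem G p x"
proof -
  interpret S: fgroup "G\<lparr>carrier := S\<rparr>" using sub_fgroup[OF assms(1)] .
  have "x [^]\<^bsub>G\<lparr>carrier := S\<rparr>\<^esub> (p ^ n) = \<one>" using S.pow_order_eq_1[of x] assms by (simp add: order_def)
  then show ?thesis using subgroup.mem_carrier[OF assms(1,3)] by (auto simp: p_elem_def nat_pow_consistent[symmetric])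
qed

end

subsection \<open>Nilpotent groups\<close>

context fgroup
begin

text \<open>The p-group acts by conjugation on the cosets of N. Their number is a power of p greater
  than 1 and N itself is fixed, so there is a second fixed coset: a non-trivial central element of
  G/N.\<close>

lemma p_group_central_mod:
  assumes p: "prime p" and card: "card (carrier G) = p ^ n" and N: "N \<lhd> G" "N \<noteq> carrier G"
  shows "\<exists>x\<in>carrier G - N. \<forall>g\<in>carrier G. commu x g \<in> N"
proof -
  have sN: "subgroup N G" using N normal_imp_subgroup by blast
  have NG: "N \<subseteq> carrier G" using subgroup.subset[OF sN] .
  have fin_rc: "finite (rcosets N)" using fin by (simp add: RCOSETS_def)
  define act where "act g A = (\<lambda>a. g \<otimes> a \<otimes> inv g) ` A" for g A
  have act_coset: "act g (N #> x) = N #> (g \<otimes> x \<otimes> inv g)" if g: "g \<in> carrier G" and x: "x \<in> carrier G" for g x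
  proof (intro equalityI subsetI)
    fix y assume "y \<in> act g (N #> x)"
    then obtain m where m: "m \<in> N" "y = g \<otimes> (m \<otimes> x) \<otimes> inv g" by (auto simp: act_def r_coset_def)
    have "y = (g \<otimes> m \<otimes> inv g) \<otimes> (g \<otimes> x \<otimes> inv g)"
      unfolding m(2) using g x subsetD[OF NG m(1)] by (simp add: word_simps)
    then show "y \<in> N #> (g \<otimes> x \<otimes> inv g)"
      using normal_closed[OF N(1) g m(1)] by (auto simp: r_coset_def)
  next
    fix y assume "y \<in> N #> (g \<otimes> x \<otimes> inv g)"
    then obtain m where m: "m \<in> N" "y = m \<otimes> (g \<otimes> x \<otimes> inv g)" by (auto simp: r_coset_def)
    have k: "inv g \<otimes> m \<otimes> inv (inv g) \<in> N" using normal_closed[OF N(1) inv_closed[OF g] m(1)] .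
    have "y = g \<otimes> ((inv g \<otimes> m \<otimes> inv (inv g)) \<otimes> x) \<otimes> inv g"
      unfolding m(2) using g x subsetD[OF NG m(1)] by (simp add: word_simps)
    then show "y \<in> act g (N #> x)" using k unfolding act_def r_coset_def by blast
  qed
  have rc: "\<exists>x\<in>carrier G. A = N #> x" if "A \<in> rcosets N" for A
    using that by (auto simp: RCOSETS_def)
  have eq: "p dvd card (rcosets N) \<longleftrightarrow> p dvd card {A \<in> rcosets N. \<forall>g\<in>carrier G. act g A = A}"
  proof (rule action_fixed_points_mod[OF p card fin_rc])
    fix g A assume g: "g \<in> carrier G" and A: "A \<in> rcosets N"
    obtain x where x: "x \<in> carrier G" "A = N #> x" using rc[OF A] by blast
    show "act g A \<in> rcosets N" unfolding x(2) act_coset[OF g x(1)]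
      using g x(1) by (intro rcosetsI[OF NG]) simp
  next
    fix A assume A: "A \<in> rcosets N"
    obtain x where x: "x \<in> carrier G" "A = N #> x" using rc[OF A] by blast
    show "act \<one> A = A" unfolding x(2) act_coset[OF one_closed x(1)] using x(1) by simp
  next
    fix g h A assume g: "g \<in> carrier G" and h: "h \<in> carrier G" and A: "A \<in> rcosets N"
    obtain x where x: "x \<in> carrier G" "A = N #> x" using rc[OF A] by blast
    have hx: "h \<otimes> x \<otimes> inv h \<in> carrier G" using h x by simp
    show "act (g \<otimes> h) A = act g (act h A)"
      unfolding x(2) act_coset[OF h x(1)] act_coset[OF g hx] act_coset[OF m_closed[OF g h] x(1)]
      using g h x(1) by (simp add: word_simps)
  qed
  have "card (rcosets N) * card N = p ^ n" using lagrange[OF sN] card by (simp add: order_def)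
  then have "card (rcosets N) dvd p ^ n" by (metis dvd_triv_left)
  then obtain j where j: "card (rcosets N) = p ^ j" using divides_primepow_nat[OF p] by blast
  have "j \<noteq> 0"
  proof
    assume "j = 0"
    then have "card N = card (carrier G)" using lagrange[OF sN] j by (simp add: order_def)
    then show False using card_subset_eq[OF fin NG] N(2) by simp
  qed
  then have "p dvd card (rcosets N)" using j by simp
  then have dvd: "p dvd card {A \<in> rcosets N. \<forall>g\<in>carrier G. act g A = A}" (is "p dvd card ?F") using eq by simp
  have "N #> \<one> = N" using NG by simp
  then have "N \<in> ?F" using act_coset[OF _ one_closed] rcosetsI[OF NG one_closed] by auto
  then have "card ?F \<noteq> 0" using fin_rc by auto
  \<comment> \<open>The coset N makes the number of fixed points positive, and divisibility by p
    then forces at least two.\<close>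
  then have "card ?F \<ge> 2" using dvd p by (meson dvd_imp_le gr0I le_trans prime_ge_2_nat)
  then have "\<not> ?F \<subseteq> {N}" using card_mono[of "{N}" ?F] by auto
  then obtain A where A: "A \<in> rcosets N" "\<And>g. g \<in> carrier G \<Longrightarrow> act g A = A" "A \<noteq> N" by blast
  obtain x where x: "x \<in> carrier G" "A = N #> x" using rc[OF A(1)] by blast
  have "x \<notin> N" using A(3) x coset_join2[OF x(1) sN] by blast
  moreover have "commu x g \<in> N" if g: "g \<in> carrier G" for g
  proof -
    have "N #> (g \<otimes> x \<otimes> inv g) = N #> x" using A(2)[OF g] act_coset[OF g x(1)] x(2) by simp
    then have "g \<otimes> x \<otimes> inv g \<in> N #> x" using rcos_self[of "g \<otimes> x \<otimes> inv g" N] sN x g by simp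
    then obtain m where m: "m \<in> N" "g \<otimes> x \<otimes> inv g = m \<otimes> x" by (auto simp: r_coset_def)
    have mG: "m \<in> carrier G" using m NG by blast
    have "inv m = x \<otimes> inv (m \<otimes> x)" using mG x by (simp add: word_simps)
    also have "\<dots> = commu x g" using x g by (simp flip: m(2)) (simp add: word_simps)
    finally show ?thesis using subgroup.m_inv_closed[OF sN m(1)] by simp
  qed
  ultimately show ?thesis using x(1) by blast
qed

lemma p_subgroup_central_mod:
  assumes p: "prime p" and P: "subgroup P G" "card P = p ^ n" and N: "N \<lhd> G" "\<not> P \<subseteq> N"
  shows "\<exists>x\<in>P - N. \<forall>g\<in>P. commu x g \<in> N"
proof -
  interpret P: fgroup "G\<lparr>carrier := P\<rparr>" using sub_fgroup[OF P(1)] .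
  have "N \<inter> P \<lhd> G\<lparr>carrier := P\<rparr>" using normal_Int_subgroup[OF P(1) N(1)] .
  moreover have "N \<inter> P \<noteq> carrier (G\<lparr>carrier := P\<rparr>)" using N(2) by auto
  ultimately obtain x where x: "x \<in> P - N \<inter> P"
    "\<And>g. g \<in> P \<Longrightarrow> x \<otimes>\<^bsub>G\<lparr>carrier := P\<rparr>\<^esub> g \<otimes>\<^bsub>G\<lparr>carrier := P\<rparr>\<^esub> inv\<^bsub>G\<lparr>carrier := P\<rparr>\<^esub> x \<otimes>\<^bsub>G\<lparr>carrier := P\<rparr>\<^esub> inv\<^bsub>G\<lparr>carrier := P\<rparr>\<^esub> g \<in> N \<inter> P"
    using P.p_group_central_mod[OF p, of n "N \<inter> P"] P(2) by auto
  have "commu x g \<in> N" if "g \<in> P" for g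
    using x(2)[OF that] m_inv_consistent[OF P(1)] that x(1) by auto
  then show ?thesis using x(1) by blast
qed

lemma lower_central_subset:
  "lower_central G k \<subseteq> carrier G"
proof (cases k)
  case (Suc n)
  have "lower_central G n \<subseteq> carrier G \<Longrightarrow> lower_central G (Suc n) \<subseteq> carrier G" for n
    using subgroup.subset[OF commutator_subgroup_subgroup[of "lower_central G n" "carrier G"]] by simp
  then have "lower_central G n \<subseteq> carrier G" for n by (induction n) auto
  then show ?thesis by blast
qed simp

text \<open>Links the lower central series of the definition to central elements of quotients. A
  normal N that is maximal among those killed by iterated commutators with G must be G, since
  otherwise the preimage of Z(G/N) would be a larger one.\<close>

lemma nilpotentI:
  assumes cen: "\<And>N. N \<lhd> G \<Longrightarrow> N \<noteq> carrier G \<Longrightarrow> \<exists>x\<in>carrier G - N. \<forall>g\<in>carrier G. commu x g \<in> N"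
  shows "nilpotent_group G"
proof -
  \<comment> \<open>The k-th iterate of \<open>c\<close> applied to N is [N,G,...,G]; for N = G it
    is \<open>lower_central G k\<close>.\<close>
  define c where "c A = commutator_subgroup G A (carrier G)" for A
  have c_mono: "(c ^^ k) A \<subseteq> (c ^^ k) B" if "A \<subseteq> B" for k A B
    using that by (induction k) (simp_all add: c_def commutator_subgroup_mono)
  let ?S = "{N. N \<lhd> G \<and> (\<exists>k. (c ^^ k) N \<subseteq> {\<one>})}"
  have "?S \<subseteq> Pow (carrier G)" using subgroup.subset normal_imp_subgroup by blast
  then have finS: "finite ?S" using fin finite_subset by blast
  have "(c ^^ 0) {\<one>} \<subseteq> {\<one>}" by simp
  then have "{\<one>} \<in> ?S" using one_is_normal by blast
  then obtain N where N: "N \<in> ?S" "\<And>K. K \<in> ?S \<Longrightarrow> N \<subseteq> K \<Longrightarrow> N = K"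
    using finite_has_maximal2[OF finS, of "{\<one>}"] by meson
  then obtain k where k: "N \<lhd> G" "(c ^^ k) N \<subseteq> {\<one>}" by blast
  have "N = carrier G"
  proof (rule ccontr)
    assume "N \<noteq> carrier G"
    then obtain x where x: "x \<in> carrier G - N" "\<forall>g\<in>carrier G. commu x g \<in> N" using cen k(1) by blast
    let ?Z = "{x \<in> carrier G. \<forall>g\<in>carrier G. commu x g \<in> N}"
    have Z: "?Z \<lhd> G" using central_mod_normal[OF k(1)] .
    have sN: "subgroup N G" using k(1) normal_imp_subgroup by blast
    have NZ: "N \<subseteq> ?Z"
      using normal_commu(1)[OF k(1)] subgroup.mem_carrier[OF sN] by blast
    have "c ?Z \<subseteq> N" unfolding c_def by (rule commutator_subgroup_subsetI[OF sN]) blast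
    then have "(c ^^ k) (c ?Z) \<subseteq> {\<one>}" using c_mono[of "c ?Z" N k] k(2) by blast
    then have "(c ^^ Suc k) ?Z \<subseteq> {\<one>}" by (simp add: funpow_swap1)
    then have "?Z \<in> ?S" using Z by blast
    then have "N = ?Z" using N(2)[OF _ NZ] by blast
    then show False using x by blast
  qed
  have "(c ^^ k) (carrier G) = lower_central G k" for k
    by (induction k) (simp_all add: c_def)
  then have sub: "lower_central G k \<subseteq> {\<one>}" using k(2) \<open>N = carrier G\<close> by simp
  have "\<one> \<in> lower_central G k"
  proof (cases k)
    case (Suc n)
    then show ?thesis
      using subgroup.one_closed[OF commutator_subgroup_subgroup[OF lower_central_subset subset_refl]] by simp
  qed simp
  then show ?thesis using sub is_group unfolding nilpotent_group_def by blast
qed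

text \<open>Take the last term of the lower central series that is not contained in N: its
  commutators with G are in N. As N is any proper subgroup, this also yields elements outside N that
  normalize N.\<close>

lemma nilpotent_central_mod:
  assumes nil: "nilpotent_group G" and N: "subgroup N G" "N \<noteq> carrier G"
  shows "\<exists>x\<in>carrier G - N. \<forall>g\<in>carrier G. commu x g \<in> N"
proof -
  obtain n where "lower_central G n = {\<one>}" using nil by (auto simp: nilpotent_group_def)
  then have ex: "lower_central G n \<subseteq> N" using subgroup.one_closed[OF N(1)] by simp
  define i where "i = (LEAST n. lower_central G n \<subseteq> N)"
  have i: "lower_central G i \<subseteq> N" unfolding i_def using ex by (rule LeastI)
  have "i \<noteq> 0" using i N subgroup.subset[OF N(1)] by (intro notI) auto
  then obtain j where j: "i = Suc j" using not0_implies_Suc by blast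
  then have "\<not> lower_central G j \<subseteq> N" using not_less_Least[of j "\<lambda>n. lower_central G n \<subseteq> N"] i_def by simp
  then obtain x where x: "x \<in> lower_central G j" "x \<notin> N" by blast
  have "commu x g \<in> N" if "g \<in> carrier G" for g
    using commu_in_commutator_subgroup[OF x(1) that] i j by auto
  then show ?thesis using x lower_central_subset by blast
qed

text \<open>An x outside M whose commutators lie in M normalizes M, because x m x^-1 = [x,m] m; so
  the normalizer is strictly larger than M.\<close>

lemma nilpotent_maximal_normal:
  assumes nil: "nilpotent_group G" and M: "maximal_subgroup M G"
  shows "M \<lhd> G"
proof -
  have sM: "subgroup M G" "M \<noteq> carrier G" using M by (auto simp: maximal_subgroup_def)
  obtain x where x: "x \<in> carrier G" "x \<notin> M" "\<And>g. g \<in> carrier G \<Longrightarrow> commu x g \<in> M"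
    using nilpotent_central_mod[OF nil sM] by blast
  have MG: "M \<subseteq> carrier G" using subgroup.subset[OF sM(1)] .
  have "x \<in> normalizing M"
  proof (rule normalizing_finiteI[OF finite_sub[OF sM(1)] MG x(1)])
    fix m assume m: "m \<in> M"
    have mG: "m \<in> carrier G" using m MG by blast
    have "commu x m \<otimes> m \<in> M" using subgroup.m_closed[OF sM(1) x(3)[OF mG] m] .
    then show "x \<otimes> m \<otimes> inv x \<in> M" using x(1) mG by (simp add: word_simps)
  qed
  then have "normalizing M \<noteq> M" using x(2) by blast
  then have "normalizing M = carrier G"
    using M subgroup_normalizing[OF MG] sub_normalizing[OF sM(1)] by (auto simp: maximal_subgroup_def)
  then show ?thesis using normalizing_eq_carrier sM(1) by blast
qed

lemma sylow_subgroup_sub: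
  assumes p: "prime p" and S: "sylow_subgroup G p S" and K: "subgroup K G" "S \<subseteq> K"
  shows "sylow_subgroup (G\<lparr>carrier := K\<rparr>) p S"
proof -
  have sS: "subgroup S G" "card S = p ^ multiplicity p (card (carrier G))" using S by (auto simp: sylow_subgroup_def)
  have "card S dvd card K" using card_sub_dvd[OF sS(1) K] .
  then have "multiplicity p (card (carrier G)) \<le> multiplicity p (card K)"
    using power_dvd_iff_le_multiplicity[of "card K" p] prime_not_unit[OF p] card_sub_pos[OF K(1)] sS(2) by simp
  moreover have "multiplicity p (card K) \<le> multiplicity p (card (carrier G))"
    using dvd_imp_multiplicity_le[OF card_sub_dvd[OF K(1) subgroup_self subgroup.subset[OF K(1)]]]
      card_carrier_nonzero by blast
  ultimately show ?thesis
    using sS K(2) by (simp add: sylow_subgroup_def subgroup_sub_iff[OF K(1)])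
qed

text \<open>S and its conjugate by g are both Sylow in K, hence conjugate in K. The condition
  concerns a single g, which allows K to be a product such as Phi(M) S that is invariant only under
  certain elements.\<close>

lemma frattini_argument:
  assumes p: "prime p" and S: "sylow_subgroup G p S" and K: "subgroup K G" "S \<subseteq> K"
    and g: "g \<in> carrier G" and conj: "\<And>h. h \<in> S \<Longrightarrow> g \<otimes> h \<otimes> inv g \<in> K"
  shows "\<exists>k\<in>K. k \<otimes> g \<in> normalizing S"
proof -
  interpret K: fgroup "G\<lparr>carrier := K\<rparr>" using sub_fgroup[OF K(1)] .
  have sS: "subgroup S G" "card S = p ^ multiplicity p (card (carrier G))" using S by (auto simp: sylow_subgroup_def)
  have SG: "S \<subseteq> carrier G" using subgroup.subset[OF sS(1)] .
  let ?Q = "(\<lambda>h. g \<otimes> h \<otimes> inv g) ` S"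
  have Q: "subgroup ?Q G" "card ?Q = card S" using conj_subgroup[OF sS(1) g] by blast+
  have "subgroup ?Q (G\<lparr>carrier := K\<rparr>)" using Q conj by (auto simp: subgroup_sub_iff[OF K(1)])
  then obtain x where x: "x \<in> K" "\<And>q. q \<in> ?Q \<Longrightarrow> x \<otimes> q \<otimes> inv x \<in> S"
    using K.sylow_conj[OF p sylow_subgroup_sub[OF p S K], of ?Q "multiplicity p (card (carrier G))"]
      Q(2) sS(2) m_inv_consistent[OF K(1)] by auto
  have xG: "x \<in> carrier G" using subgroup.mem_carrier[OF K(1) x(1)] .
  have "x \<otimes> g \<in> normalizing S"
  proof (rule normalizing_finiteI[OF finite_sub[OF sS(1)] SG])
    show "x \<otimes> g \<in> carrier G" using xG g by simp
    fix h assume h: "h \<in> S"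
    have "x \<otimes> (g \<otimes> h \<otimes> inv g) \<otimes> inv x \<in> S" using x(2) h by blast
    then show "x \<otimes> g \<otimes> h \<otimes> inv (x \<otimes> g) \<in> S" using xG g subsetD[OF SG h] by (simp add: word_simps)
  qed
  then show ?thesis using x(1) by blast
qed

text \<open>A maximal M above the normalizer of S would be normal, and the Frattini argument would
  give G = M N(S) = M.\<close>

lemma maximal_normal_imp_sylow_normal:
  assumes max: "\<And>M. maximal_subgroup M G \<Longrightarrow> M \<lhd> G" and p: "prime p" and S: "sylow_subgroup G p S"
  shows "S \<lhd> G"
proof (rule ccontr)
  assume nn: "\<not> S \<lhd> G"
  have sS: "subgroup S G" using S by (auto simp: sylow_subgroup_def)
  have SG: "S \<subseteq> carrier G" using subgroup.subset[OF sS] .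
  have "normalizing S \<noteq> carrier G" using nn normalizing_eq_carrier[OF sS] by blast
  then obtain M where M: "maximal_subgroup M G" "normalizing S \<subseteq> M"
    using maximal_above[OF subgroup_normalizing[OF SG]] by blast
  have MN: "M \<lhd> G" using max[OF M(1)] .
  have sM: "subgroup M G" "M \<noteq> carrier G" using M by (auto simp: maximal_subgroup_def)
  have SM: "S \<subseteq> M" using M(2) sub_normalizing[OF sS] by blast
  have "carrier G \<subseteq> M"
  proof
    fix g assume g: "g \<in> carrier G"
    have "g \<otimes> h \<otimes> inv g \<in> M" if "h \<in> S" for h using normal_closed[OF MN g] SM that by blast
    then obtain x where x: "x \<in> M" "x \<otimes> g \<in> normalizing S"
      using frattini_argument[OF p S sM(1) SM g] by blast
    have xG: "x \<in> carrier G" using subgroup.mem_carrier[OF sM(1) x(1)] .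
    have "inv x \<otimes> (x \<otimes> g) \<in> M"
      using subgroup.m_closed[OF sM(1) subgroup.m_inv_closed[OF sM(1) x(1)]] M(2) x(2) by blast
    then show "g \<in> M" using xG g by (simp add: word_simps)
  qed
  then show False using sM subgroup.subset by blast
qed

lemma normal_coprime_commute:
  assumes N: "N \<lhd> G" and K: "K \<lhd> G" and co: "coprime (card N) (card K)" and x: "x \<in> N" and y: "y \<in> K"
  shows "x \<otimes> y = y \<otimes> x"
proof -
  have sN: "subgroup N G" and sK: "subgroup K G" using N K normal_imp_subgroup by blast+
  have xG: "x \<in> carrier G" and yG: "y \<in> carrier G"
    using subgroup.mem_carrier[OF sN x] subgroup.mem_carrier[OF sK y] .
  have sNK: "subgroup (N \<inter> K) G" using subgroups_Inter_pair[OF sN sK] .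
  have "card (N \<inter> K) dvd card N" "card (N \<inter> K) dvd card K"
    using card_sub_dvd[OF sNK sN] card_sub_dvd[OF sNK sK] by auto
  then have "card (N \<inter> K) = 1" using co coprime_common_divisor_nat by blast
  then have one: "N \<inter> K = {\<one>}" using subgroup_card_1[OF sNK] by blast
  have "commu x y = \<one>" using normal_commu(1)[OF N x yG] normal_commu(2)[OF K y xG] one by blast
  then show ?thesis using commu_one_iff[OF xG yG] by blast
qed

lemma sylow_normal_imp_commute:
  assumes syl: "\<And>p S. prime p \<Longrightarrow> sylow_subgroup G p S \<Longrightarrow> S \<lhd> G"
    and pr: "prime p" "prime r" "p \<noteq> r" and x: "p_elem G p x" and y: "p_elem G r y"
  shows "x \<otimes> y = y \<otimes> x"
proof -
  obtain S where S: "sylow_subgroup G p S" using sylow_exists[OF pr(1)] by blast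
  obtain T where T: "sylow_subgroup G r T" using sylow_exists[OF pr(2)] by blast
  have SN: "S \<lhd> G" "T \<lhd> G" using syl S T pr by blast+
  have "coprime (card S) (card T)"
    using S T primes_coprime[OF pr] by (auto simp: sylow_subgroup_def)
  then show ?thesis
    using normal_coprime_commute[OF SN _ p_elem_in_normal_sylow[OF pr(1) x S SN(1)] p_elem_in_normal_sylow[OF pr(2) y T SN(2)]]
    by blast
qed

text \<open>A proper normal N misses some Sylow subgroup S. An x in S outside N that is central in S
  modulo N is centralized modulo N by S and, by hypothesis, by the Sylow subgroups for all other
  primes, hence by G.\<close>

lemma commute_imp_nilpotent:
  assumes comm: "\<And>p r x y. prime p \<Longrightarrow> prime r \<Longrightarrow> p \<noteq> r \<Longrightarrow> p_elem G p x \<Longrightarrow> p_elem G r y \<Longrightarrow> x \<otimes> y = y \<otimes> x"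
  shows "nilpotent_group G"
proof (rule nilpotentI)
  fix N assume N: "N \<lhd> G" "N \<noteq> carrier G"
  have sN: "subgroup N G" using N normal_imp_subgroup by blast
  obtain p where p: "prime p" "\<not> (\<exists>S. sylow_subgroup G p S \<and> S \<subseteq> N)"
    using sylow_dvd_eq[OF sN] N(2) by blast
  obtain S where S: "sylow_subgroup G p S" using sylow_exists[OF p(1)] by blast
  then have SN: "\<not> S \<subseteq> N" using p(2) by blast
  have sS: "subgroup S G" "card S = p ^ multiplicity p (card (carrier G))" using S by (auto simp: sylow_subgroup_def)
  obtain x where x: "x \<in> S" "x \<notin> N" "\<And>g. g \<in> S \<Longrightarrow> commu x g \<in> N"
    using p_subgroup_central_mod[OF p(1) sS N(1) SN] by blast
  have xG: "x \<in> carrier G" using subgroup.mem_carrier[OF sS(1) x(1)] .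
  have "{g \<in> carrier G. commu x g \<in> N} = carrier G" (is "?Z = _")
  proof (rule sylow_dvd_eq)
    show "subgroup ?Z G" using commutes_mod_subgroup[OF N(1) xG] .
    fix r :: nat assume r: "prime r"
    show "\<exists>T. sylow_subgroup G r T \<and> T \<subseteq> ?Z"
    proof (cases "r = p")
      case True
      have "S \<subseteq> ?Z" using x(3) subgroup.mem_carrier[OF sS(1)] by blast
      then show ?thesis using S True by blast
    next
      case False
      obtain T where T: "sylow_subgroup G r T" using sylow_exists[OF r] by blast
      then have sT: "subgroup T G" "card T = r ^ multiplicity r (card (carrier G))" by (auto simp: sylow_subgroup_def)
      have "t \<in> ?Z" if t: "t \<in> T" for t
      proof -
        have tG: "t \<in> carrier G" using subgroup.mem_carrier[OF sT(1) t] .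
        have "x \<otimes> t = t \<otimes> x"
          using comm[OF p(1) r False[symmetric] in_p_subgroup_p_elem[OF sS x(1)] in_p_subgroup_p_elem[OF sT t]] .
        then have "commu x t = \<one>" using commu_one_iff[OF xG tG] by blast
        then show ?thesis using tG subgroup.one_closed[OF sN] by simp
      qed
      then show ?thesis using T by blast
    qed
  qed
  then show "\<exists>x\<in>carrier G - N. \<forall>g\<in>carrier G. commu x g \<in> N" using x(2) xG by blast
qed

lemma maximal_normal_imp_nilpotent:
  assumes "\<And>M. maximal_subgroup M G \<Longrightarrow> M \<lhd> G"
  shows "nilpotent_group G"
  using commute_imp_nilpotent sylow_normal_imp_commute maximal_normal_imp_sylow_normal assms by metis

lemma nilpotent_sylow_normal:
  assumes "nilpotent_group G" "prime p" "sylow_subgroup G p S"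
  shows "S \<lhd> G"
  using maximal_normal_imp_sylow_normal[OF nilpotent_maximal_normal[OF assms(1)] assms(2,3)] .

end

subsection \<open>Frattini subgroups and IC\<open>\<Phi>\<close>-subgroups\<close>

context group
begin

text \<open>Bezout: some power product of x^a and x^b equals x.\<close>

lemma pow_coprime_mem:
  assumes Y: "subgroup Y G" and x: "x \<in> carrier G" "x [^] (a::nat) \<in> Y" "x [^] (b::nat) \<in> Y" and co: "coprime a b"
  shows "x \<in> Y"
proof (cases "a = 0")
  \<comment> \<open>Bezout in this form asks for a non-zero a; for a = 0 coprimality gives b =
    1.\<close>
  case True
  then show ?thesis using co x by simp
next
  case False
  have pow: "z [^] (n::nat) \<in> Y" if "z \<in> Y" for z n
    using subgroup.m_closed[OF Y] subgroup.one_closed[OF Y] that by (induction n) auto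
  obtain i j where ij: "a * i = b * j + 1" using bezout_nat[OF False, of b] co by auto
  have "x [^] (a * i) = x [^] (b * j) \<otimes> x" unfolding ij using x by (simp add: nat_pow_mult[symmetric])
  then have "x = inv (x [^] (b * j)) \<otimes> x [^] (a * i)" using x by (simp add: word_simps)
  moreover have "x [^] (a * i) \<in> Y" "x [^] (b * j) \<in> Y"
    using pow[OF x(2), of i] pow[OF x(3), of j] x(1) by (simp_all add: nat_pow_pow)
  ultimately show ?thesis using subgroup.m_closed[OF Y] subgroup.m_inv_closed[OF Y] by metis
qed

lemma subgroup_nat_pow:
  assumes "subgroup Y G" "z \<in> Y"
  shows "z [^] (n::nat) \<in> Y"
  using subgroup.m_closed[OF assms(1)] subgroup.one_closed[OF assms(1)] assms(2) by (induction n) auto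

text \<open>G/M is abelian: for x outside M the centralizer of x modulo M contains both M and x, so
  by maximality it is G.\<close>

lemma normal_maximal_commu:
  assumes M: "maximal_subgroup M G" "M \<lhd> G" and x: "x \<in> carrier G" and g: "g \<in> carrier G"
  shows "commu x g \<in> M"
proof -
  have sM: "subgroup M G" using M(2) normal_imp_subgroup by blast
  show ?thesis
  proof (cases "x \<in> M")
    case True
    then show ?thesis using normal_commu(1)[OF M(2) _ g] by blast
  next
    case False
    let ?Z = "{g \<in> carrier G. commu x g \<in> M}"
    have "M \<subseteq> ?Z" using normal_commu(2)[OF M(2) _ x] subgroup.mem_carrier[OF sM] by blast
    moreover have "commu x x = \<one>" using x commu_one_iff by blast
    then have "x \<in> ?Z" using x subgroup.one_closed[OF sM] by simp
    moreover have "subgroup ?Z G" using commutes_mod_subgroup[OF M(2) x] .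
    ultimately have "?Z = carrier G" using M(1) False unfolding maximal_subgroup_def by blast
    then show ?thesis using g by blast
  qed
qed

lemma conj_in_conj_iff:
  assumes "g \<in> carrier G" "x \<in> carrier G" "H \<subseteq> carrier G"
  shows "x \<in> (\<lambda>h. g \<otimes> h \<otimes> inv g) ` H \<longleftrightarrow> inv g \<otimes> x \<otimes> g \<in> H"
proof
  assume "x \<in> (\<lambda>h. g \<otimes> h \<otimes> inv g) ` H"
  then obtain h where h: "h \<in> H" "x = g \<otimes> h \<otimes> inv g" by blast
  have "inv g \<otimes> x \<otimes> g = h" unfolding h(2) using assms h subsetD[OF assms(3) h(1)] by (simp add: word_simps)
  then show "inv g \<otimes> x \<otimes> g \<in> H" using h(1) by simp
next
  assume a: "inv g \<otimes> x \<otimes> g \<in> H"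
  have "x = g \<otimes> (inv g \<otimes> x \<otimes> g) \<otimes> inv g" using assms by (simp add: word_simps)
  then show "x \<in> (\<lambda>h. g \<otimes> h \<otimes> inv g) ` H" using a by blast
qed

text \<open>Conjugation by g restricts to an automorphism of M and therefore permutes its maximal
  subgroups.\<close>

lemma conj_maximal_in_normal:
  assumes M: "M \<lhd> G" and g: "g \<in> carrier G" and Y: "maximal_subgroup Y (G\<lparr>carrier := M\<rparr>)"
  shows "maximal_subgroup ((\<lambda>h. g \<otimes> h \<otimes> inv g) ` Y) (G\<lparr>carrier := M\<rparr>)"
proof -
  let ?c = "\<lambda>g H. (\<lambda>h. g \<otimes> h \<otimes> inv g) ` H"
  have sM: "subgroup M G" using M normal_imp_subgroup by blast
  have MG: "M \<subseteq> carrier G" using subgroup.subset[OF sM] .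
  have X': "subgroup Y G" "Y \<subset> M" "\<And>K. subgroup K G \<Longrightarrow> Y \<subseteq> K \<Longrightarrow> K \<subseteq> M \<Longrightarrow> K = Y \<or> K = M"
    using Y unfolding maximal_subgroup_iff[OF sM] by blast+
  have cc: "?c h (?c (inv h) K) = K" if "h \<in> carrier G" "K \<subseteq> carrier G" for h K
  proof -
    have "h \<otimes> (inv h \<otimes> k \<otimes> inv (inv h)) \<otimes> inv h = k" if "k \<in> K" for k
      using \<open>h \<in> carrier G\<close> subsetD[OF \<open>K \<subseteq> carrier G\<close> that] by (simp add: word_simps)
    then show ?thesis by (simp add: image_image)
  qed
  have cM: "?c h M = M" if h: "h \<in> carrier G" for h
  proof
    show "?c h M \<subseteq> M" using normal_closed[OF M h] by blast
    have "?c (inv h) M \<subseteq> M" using normal_closed[OF M inv_closed[OF h]] by blast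
    then have "?c h (?c (inv h) M) \<subseteq> ?c h M" by (rule image_mono)
    then show "M \<subseteq> ?c h M" using cc[OF h MG] by simp
  qed
  have XG: "Y \<subseteq> carrier G" using X'(2) MG by blast
  have cX: "?c (inv g) (?c g Y) = Y" using cc[of "inv g" Y] g XG by simp
  show ?thesis unfolding maximal_subgroup_iff[OF sM]
  proof (intro conjI allI impI)
    show "subgroup (?c g Y) G" using conj_subgroup(1)[OF X'(1) g] .
    have "?c g Y \<subseteq> ?c g M" using X'(2) by blast
    moreover have "?c g Y \<noteq> M"
    proof
      assume "?c g Y = M"
      then have "Y = ?c (inv g) M" using cX by simp
      then show False using cM[of "inv g"] g X'(2) by simp
    qed
    ultimately show "?c g Y \<subset> M" using cM[OF g] by blast
    fix K assume K: "subgroup K G \<and> ?c g Y \<subseteq> K \<and> K \<subseteq> M"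
    have KG: "K \<subseteq> carrier G" using K MG by blast
    have "Y \<subseteq> ?c (inv g) K" using image_mono[of "?c g Y" K "\<lambda>h. inv g \<otimes> h \<otimes> inv (inv g)"] K cX by simp
    moreover have "?c (inv g) K \<subseteq> M" using K cM[of "inv g"] g by blast
    moreover have "subgroup (?c (inv g) K) G" using conj_subgroup(1)[of K "inv g"] K g by blast
    ultimately have "?c (inv g) K = Y \<or> ?c (inv g) K = M" using X'(3) by blast
    then show "K = ?c g Y \<or> K = M"
    proof
      assume "?c (inv g) K = Y"
      then show ?thesis using cc[OF g KG] by simp
    next
      assume "?c (inv g) K = M"
      then show ?thesis using cc[OF g KG] cM[OF g] by simp
    qed
  qed
qed

lemma frattini_maximal: "maximal_subgroup M G \<Longrightarrow> frattini G \<subseteq> M"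
  by (auto simp: frattini_def)

lemma subgroup_frattini: "subgroup (frattini G) G"
proof -
  have eq: "frattini G = \<Inter> (insert (carrier G) {M. maximal_subgroup M G})" by (auto simp: frattini_def)
  show ?thesis unfolding eq
    by (rule subgroups_Inter) (auto simp: maximal_subgroup_def subgroup_self)
qed

lemma frattini_sub_subset: "frattini (G\<lparr>carrier := H\<rparr>) \<subseteq> H"
  by (simp add: frattini_def)

lemma subgroup_frattini_sub:
  assumes "subgroup H G"
  shows "subgroup (frattini (G\<lparr>carrier := H\<rparr>)) G"
  using group.subgroup_frattini[OF subgroup_imp_group[OF assms]] subgroup_sub_iff[OF assms] by blast

lemma frattini_normal:
  assumes M: "M \<lhd> G"
  shows "frattini (G\<lparr>carrier := M\<rparr>) \<lhd> G"
proof (rule normal_invI)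
  have sM: "subgroup M G" using M normal_imp_subgroup by blast
  show "subgroup (frattini (G\<lparr>carrier := M\<rparr>)) G" using subgroup_frattini_sub[OF sM] .
  fix g f assume g: "g \<in> carrier G" and f: "f \<in> frattini (G\<lparr>carrier := M\<rparr>)"
  have fM: "f \<in> M" using f frattini_sub_subset by blast
  have fG: "f \<in> carrier G" using subgroup.mem_carrier[OF sM fM] .
  have "g \<otimes> f \<otimes> inv g \<in> Y" if Y: "maximal_subgroup Y (G\<lparr>carrier := M\<rparr>)" for Y
  proof -
    have XG: "Y \<subseteq> carrier G" using Y subgroup.subset[OF sM] unfolding maximal_subgroup_iff[OF sM] by blast
    have "maximal_subgroup ((\<lambda>h. inv g \<otimes> h \<otimes> inv (inv g)) ` Y) (G\<lparr>carrier := M\<rparr>)"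
      using conj_maximal_in_normal[OF M inv_closed[OF g] Y] .
    then have "f \<in> (\<lambda>h. inv g \<otimes> h \<otimes> inv (inv g)) ` Y" using f by (simp add: frattini_def)
    then show ?thesis using conj_in_conj_iff[OF inv_closed[OF g] fG XG] g by simp
  qed
  then show "g \<otimes> f \<otimes> inv g \<in> frattini (G\<lparr>carrier := M\<rparr>)"
    using normal_closed[OF M g fM] by (simp add: frattini_def)
qed

text \<open>[H,L] shrinks with L while Phi(H) depends on H alone, so the property is inherited by
  smaller overgroups. This allows the weaker theorems to be applied inside maximal
  subgroups.\<close>

lemma IC_Phi_subgroup_sub:
  assumes IC: "IC_Phi_subgroup H G" and L: "subgroup L G" and HL: "H \<subseteq> L"
  shows "IC_Phi_subgroup H (G\<lparr>carrier := L\<rparr>)"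
proof -
  have "commutator_subgroup (G\<lparr>carrier := L\<rparr>) H L = commutator_subgroup G H L"
    using commutator_subgroup_consistent[OF L HL] by blast
  moreover have "commutator_subgroup G H L \<subseteq> commutator_subgroup G H (carrier G)"
    using commutator_subgroup_mono[OF subset_refl subgroup.subset[OF L]] .
  ultimately show ?thesis using IC HL unfolding IC_Phi_subgroup_def subgroup_sub_iff[OF L] by auto
qed

end

context fgroup
begin

text \<open>A subgroup of prime order q in G/M pulls back to a subgroup strictly above M, hence to
  G, so G/M itself has order q.\<close>

lemma normal_maximal_index:
  assumes M: "maximal_subgroup M G" "M \<lhd> G"
  shows "\<exists>q. prime q \<and> card (carrier G) = q * card M \<and> (\<forall>x\<in>carrier G. x [^] q \<in> M)"
proof -
  interpret M: normal M G using M(2) .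
  interpret Q: group "G Mod M" using M.factorgroup_is_group .
  have sM: "subgroup M G" "M \<noteq> carrier G" using M by (auto simp: maximal_subgroup_def)
  have MG: "M \<subseteq> carrier G" using subgroup.subset[OF sM(1)] .
  have finQ: "finite (carrier (G Mod M))" using fin by (simp add: carrier_FactGroup)
  have ordQ: "order (G Mod M) * card M = card (carrier G)"
    using lagrange[OF sM(1)] by (simp add: order_def FactGroup_def)
  have "order (G Mod M) \<noteq> 1"
  proof
    assume "order (G Mod M) = 1"
    then have "card M = card (carrier G)" using ordQ by simp
    then show False using card_subset_eq[OF fin MG] sM(2) by metis
  qed
  then obtain q where q: "prime q" "q dvd order (G Mod M)" using prime_factor_nat by metis
  \<comment> \<open>With exponent 1 the Sylow existence theorem is Cauchy's theorem; m may still be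
    divisible by q.\<close>
  then obtain m where "order (G Mod M) = q ^ 1 * m" by (metis dvdE power_one_right)
  from sylow_thm[OF q(1) Q.is_group this finQ]
  obtain A where A: "subgroup A (G Mod M)" "card A = q" by (metis power_one_right)
  have UA: "\<Union>A = {x \<in> carrier G. M #> x \<in> A}" using M.factgroup_subgroup_union_char[OF A(1)] .
  have sUA: "subgroup (\<Union>A) G" using M.factgroup_subgroup_union_subgroup[OF A(1)] .
  have "M \<in> A" using subgroup.one_closed[OF A(1)] by simp
  then have "M \<subseteq> \<Union>A" by (rule Union_upper)
  moreover have "\<Union>A \<noteq> M"
  proof
    assume *: "\<Union>A = M"
    have "B = M" if B: "B \<in> A" for B
    proof -
      have "B \<in> carrier (G Mod M)" using subgroup.mem_carrier[OF A(1) B] .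
      then obtain x where x: "x \<in> carrier G" "B = M #> x" unfolding carrier_FactGroup by blast
      then have "x \<in> \<Union>A" using B unfolding UA by simp
      then have "x \<in> M" unfolding * .
      then show ?thesis unfolding x(2) by (rule coset_join2[OF x(1) sM(1)])
    qed
    then have "A \<subseteq> {M}" by auto
    then have "card A \<le> 1" using card_mono[of "{M}" A] by simp
    then show False using A(2) prime_gt_1_nat[OF q(1)] by simp
  qed
  ultimately have "\<Union>A = carrier G" using M(1) sUA unfolding maximal_subgroup_def by metis
  have "A = carrier (G Mod M)"
  proof
    show "A \<subseteq> carrier (G Mod M)" by (rule subgroup.subset[OF A(1)])
    show "carrier (G Mod M) \<subseteq> A"
    proof
      fix B assume "B \<in> carrier (G Mod M)"
      then obtain x where x: "x \<in> carrier G" "B = M #> x" unfolding carrier_FactGroup by blast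
      have "x \<in> \<Union>A" using x(1) \<open>\<Union>A = carrier G\<close> by metis
      then have "M #> x \<in> A" unfolding UA by simp
      then show "B \<in> A" unfolding x(2) .
    qed
  qed
  then have ord: "order (G Mod M) = q" using A(2) by (simp add: order_def)
  have "x [^] q \<in> M" if x: "x \<in> carrier G" for x
  proof -
    have xq: "x [^] q \<in> carrier G" using x by simp
    have Mx: "M #> x \<in> carrier (G Mod M)" unfolding carrier_FactGroup using x by (rule imageI)
    have "(M #> x) [^]\<^bsub>G Mod M\<^esub> q = M" using Q.pow_order_eq_1[OF Mx] unfolding ord one_FactGroup .
    then have "M #> (x [^] q) = M" unfolding M.FactGroup_pow[OF x] .
    then show ?thesis using rcos_self[OF xq sM(1)] by simp
  qed
  moreover have "card (carrier G) = q * card M" using ordQ ord by simp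
  ultimately show ?thesis using q(1) by blast
qed

lemma frattini_proper:
  assumes "carrier G \<noteq> {\<one>}"
  shows "frattini G \<noteq> carrier G"
proof -
  obtain M where "maximal_subgroup M G" using maximal_above[OF triv_subgroup] assms by blast
  then have "frattini G \<subseteq> M" "subgroup M G" "M \<noteq> carrier G"
    using frattini_maximal by (auto simp: maximal_subgroup_def)
  then show ?thesis using subgroup.subset by blast
qed

lemma frattini_nongenerator:
  assumes A: "subgroup A G" and gen: "\<And>g. g \<in> carrier G \<Longrightarrow> \<exists>f\<in>frattini G. \<exists>a\<in>A. g = f \<otimes> a"
  shows "A = carrier G"
proof (rule ccontr)
  assume "A \<noteq> carrier G"
  then obtain M where M: "maximal_subgroup M G" "A \<subseteq> M" using maximal_above[OF A] by blast
  then have sM: "subgroup M G" "M \<noteq> carrier G" by (auto simp: maximal_subgroup_def)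
  have "carrier G \<subseteq> M"
    using gen subgroup.m_closed[OF sM(1)] frattini_maximal[OF M(1)] M(2) by blast
  then show False using sM subgroup.subset by blast
qed

text \<open>If a maximal Y missed Phi(M), then G = Phi(M) Y, so M = Phi(M) (M \<inter> Y) by
  Dedekind's law, and the non-generator property would put M, and Phi(M) with it, inside Y.\<close>

lemma frattini_normal_subset:
  assumes M: "M \<lhd> G"
  shows "frattini (G\<lparr>carrier := M\<rparr>) \<subseteq> frattini G"
proof -
  let ?F = "frattini (G\<lparr>carrier := M\<rparr>)"
  have sM: "subgroup M G" using M normal_imp_subgroup by blast
  interpret M: fgroup "G\<lparr>carrier := M\<rparr>" using sub_fgroup[OF sM] .
  have FM: "?F \<subseteq> M" by (rule frattini_sub_subset)
  have FN: "?F \<lhd> G" using frattini_normal[OF M] .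
  have "?F \<subseteq> Y" if Y: "maximal_subgroup Y G" for Y
  proof (rule ccontr)
    assume nX: "\<not> ?F \<subseteq> Y"
    have sX: "subgroup Y G" using Y by (simp add: maximal_subgroup_def)
    have prod: "?F <#> Y = carrier G" using maximal_set_mult[OF Y FN nX] .
    have "M \<inter> Y = carrier (G\<lparr>carrier := M\<rparr>)"
    proof (rule M.frattini_nongenerator)
      show "subgroup (M \<inter> Y) (G\<lparr>carrier := M\<rparr>)"
        using subgroups_Inter_pair[OF sM sX] by (simp add: subgroup_sub_iff[OF sM])
      fix g assume "g \<in> carrier (G\<lparr>carrier := M\<rparr>)"
      then have gM: "g \<in> M" by simp
      have gG: "g \<in> carrier G" using subgroup.mem_carrier[OF sM gM] .
      then obtain f x where fx: "f \<in> ?F" "x \<in> Y" "g = f \<otimes> x" using prod set_mult_elem by blast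
      have fM: "f \<in> M" using fx FM by blast
      have "x = inv f \<otimes> g" using fx subgroup.mem_carrier[OF sM fM] subgroup.mem_carrier[OF sX fx(2)]
        by (simp add: word_simps)
      then have "x \<in> M" using subgroup.m_closed[OF sM subgroup.m_inv_closed[OF sM fM] gM] by simp
      then show "\<exists>f\<in>?F. \<exists>a\<in>M \<inter> Y. g = f \<otimes>\<^bsub>G\<lparr>carrier := M\<rparr>\<^esub> a" using fx by auto
    qed
    then show False using FM nX by auto
  qed
  then show ?thesis using FM subgroup.subset[OF sM] unfolding frattini_def[of G] by blast
qed

text \<open>A maximal subgroup Y is normal here, so by Dedekind's law H \<inter> Y is either H or
  maximal in H. Nilpotency pays for letting H be non-normal.\<close>

lemma nilpotent_frattini_mono:
  assumes nil: "nilpotent_group G" and H: "subgroup H G"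
  shows "frattini (G\<lparr>carrier := H\<rparr>) \<subseteq> frattini G"
proof -
  have "frattini (G\<lparr>carrier := H\<rparr>) \<subseteq> Y" if Y: "maximal_subgroup Y G" for Y
  proof (cases "H \<subseteq> Y")
    case True
    then show ?thesis using frattini_sub_subset by blast
  next
    case False
    have XN: "Y \<lhd> G" using nilpotent_maximal_normal[OF nil Y] .
    have sX: "subgroup Y G" using Y by (simp add: maximal_subgroup_def)
    have "maximal_subgroup (H \<inter> Y) (G\<lparr>carrier := H\<rparr>)" unfolding maximal_subgroup_iff[OF H]
    proof (intro conjI allI impI)
      show "subgroup (H \<inter> Y) G" using subgroups_Inter_pair[OF H sX] .
      show "H \<inter> Y \<subset> H" using False by blast
      fix K assume K: "subgroup K G \<and> H \<inter> Y \<subseteq> K \<and> K \<subseteq> H"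
      show "K = H \<inter> Y \<or> K = H"
      proof (cases "K \<subseteq> Y")
        case True
        then show ?thesis using K by blast
      next
        case False
        have sXK: "subgroup (Y <#> K) G" using mult_norm_subgroup[OF XN] K by blast
        have "Y \<subseteq> Y <#> K" "K \<subseteq> Y <#> K" using set_mult_contains[OF sX] K by blast+
        then have XK: "Y <#> K = carrier G" using Y sXK False unfolding maximal_subgroup_def by blast
        have "H \<subseteq> K"
        proof
          fix h assume h: "h \<in> H"
          have hG: "h \<in> carrier G" using subgroup.mem_carrier[OF H h] .
          then obtain x k where xk: "x \<in> Y" "k \<in> K" "h = x \<otimes> k" using XK set_mult_elem by blast
          have kH: "k \<in> H" using xk K by blast
          have "x = h \<otimes> inv k" using xk subgroup.mem_carrier[OF H kH] subgroup.mem_carrier[OF sX xk(1)]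
            by (simp add: word_simps)
          then have "x \<in> H" using subgroup.m_closed[OF H h subgroup.m_inv_closed[OF H kH]] by simp
          then have "x \<in> K" using K xk(1) by blast
          then show "h \<in> K" using xk K subgroup.m_closed by metis
        qed
        then show ?thesis using K by blast
      qed
    qed
    then show ?thesis by (auto simp: frattini_def)
  qed
  moreover have "frattini (G\<lparr>carrier := H\<rparr>) \<subseteq> carrier G"
    using frattini_sub_subset subgroup.subset[OF H] by blast
  ultimately show ?thesis unfolding frattini_def[of G] by blast
qed

text \<open>Each maximal subgroup of H contains Phi(H), hence all commutators of H, and is therefore
  normal in H.\<close>

lemma IC_Phi_nilpotent:
  assumes IC: "IC_Phi_subgroup H G"
  shows "nilpotent_group (G\<lparr>carrier := H\<rparr>)"
proof -
  have H: "subgroup H G" "H \<inter> commutator_subgroup G H (carrier G) \<subseteq> frattini (G\<lparr>carrier := H\<rparr>)"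
    using IC by (auto simp: IC_Phi_subgroup_def)
  interpret H: fgroup "G\<lparr>carrier := H\<rparr>" using sub_fgroup[OF H(1)] .
  show ?thesis
  proof (rule H.maximal_normal_imp_nilpotent)
    fix M assume M: "maximal_subgroup M (G\<lparr>carrier := H\<rparr>)"
    have M': "subgroup M G" "M \<subset> H" using M unfolding maximal_subgroup_iff[OF H(1)] by blast+
    show "M \<lhd> G\<lparr>carrier := H\<rparr>"
    proof (rule H.normal_commuI)
      show "subgroup M (G\<lparr>carrier := H\<rparr>)" using M by (simp add: maximal_subgroup_def)
      fix x g assume x: "x \<in> M" and "g \<in> carrier (G\<lparr>carrier := H\<rparr>)"
      then have g: "g \<in> H" and xH: "x \<in> H" using M' by auto
      have "commu x g \<in> commutator_subgroup G H (carrier G)"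
        using commu_in_commutator_subgroup[OF xH] subgroup.mem_carrier[OF H(1) g] by blast
      moreover have "commu x g \<in> H" using xH g H(1) by (simp add: subgroup.m_closed subgroup.m_inv_closed)
      ultimately have "commu x g \<in> M" using H(2) H.frattini_maximal[OF M] by blast
      then show "H.commu x g \<in> M" using m_inv_consistent[OF H(1)] xH g by simp
    qed
  qed
qed

text \<open>Every maximal subgroup is normal of prime index q. If q = p it contains x^p; otherwise x
  has order prime to q and lies in it already.\<close>

lemma nilpotent_p_elem_pow_frattini:
  assumes nil: "nilpotent_group G" and p: "prime p" and x: "p_elem G p x"
  shows "x [^] p \<in> frattini G"
proof -
  obtain k where xk: "x \<in> carrier G" "x [^] (p ^ k) = \<one>" using x by (auto simp: p_elem_def)
  have "x [^] p \<in> Y" if Y: "maximal_subgroup Y G" for Y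
  proof -
    have sX: "subgroup Y G" using Y by (simp add: maximal_subgroup_def)
    obtain q :: nat where q: "prime q" "\<forall>x\<in>carrier G. x [^] q \<in> Y"
      using normal_maximal_index[OF Y nilpotent_maximal_normal[OF nil Y]] by blast
    show ?thesis
    proof (cases "p = q")
      case True
      then show ?thesis using q xk by blast
    next
      case False
      have "coprime q (p ^ k)" using primes_coprime[OF q(1) p] False by simp
      moreover have "x [^] (p ^ k) \<in> Y" using xk subgroup.one_closed[OF sX] by simp
      ultimately have "x \<in> Y" using pow_coprime_mem[OF sX xk(1)] q(2) xk(1) by blast
      then show ?thesis using subgroup_nat_pow[OF sX] by blast
    qed
  qed
  then show ?thesis using xk(1) by (simp add: frattini_def)
qed

end

subsection \<open>Groups without normal maximal subgroups\<close>

text \<open>For finite groups this amounts to G being perfect. The trivial group satisfies it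
  vacuously, which is why non-triviality is assumed separately where it matters.\<close>

definition no_normal_maximal :: "('a, 'b) monoid_scheme \<Rightarrow> bool" where
  "no_normal_maximal G \<longleftrightarrow> (\<forall>M. maximal_subgroup M G \<longrightarrow> \<not> M \<lhd> G)"

context fgroup
begin

text \<open>A maximal subgroup above K would contain all commutators and hence be normal.\<close>

lemma perfect_commu_subgroup:
  assumes perf: "no_normal_maximal G" and K: "subgroup K G"
    and comm: "\<And>x g. x \<in> carrier G \<Longrightarrow> g \<in> carrier G \<Longrightarrow> commu x g \<in> K"
  shows "K = carrier G"
proof (rule ccontr)
  assume "K \<noteq> carrier G"
  then obtain M where M: "maximal_subgroup M G" "K \<subseteq> M" using maximal_above[OF K] by blast
  have sM: "subgroup M G" using M(1) by (simp add: maximal_subgroup_def)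
  have "M \<lhd> G"
    by (rule normal_commuI[OF sM]) (use comm M(2) subgroup.mem_carrier[OF sM] in blast)
  then show False using perf M(1) by (auto simp: no_normal_maximal_def)
qed

text \<open>With G = KL, the quotient G/K is an image of L whose commutators vanish, so it is
  abelian.\<close>

lemma commu_mod_supplement:
  assumes K: "K \<lhd> G" and L: "subgroup L G"
    and gen: "\<And>g. g \<in> carrier G \<Longrightarrow> \<exists>k\<in>K. \<exists>l\<in>L. g = k \<otimes> l"
    and comm: "\<And>x y. x \<in> L \<Longrightarrow> y \<in> L \<Longrightarrow> commu x y \<in> K"
    and x: "x \<in> carrier G" and g: "g \<in> carrier G"
  shows "commu x g \<in> K"
proof -
  have sK: "subgroup K G" using K normal_imp_subgroup by blast
  have LG: "x \<in> carrier G" if "x \<in> L" for x using subgroup.mem_carrier[OF L that] .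
  have KG: "x \<in> carrier G" if "x \<in> K" for x using subgroup.mem_carrier[OF sK that] .
  have inv_comm: "commu x y \<in> K" if "commu y x \<in> K" "x \<in> carrier G" "y \<in> carrier G" for x y
  proof -
    have "inv (commu y x) \<in> K" using subgroup.m_inv_closed[OF sK that(1)] .
    then show ?thesis using that(2,3) by (simp add: word_simps)
  qed
  have step: "commu x g \<in> K" if x: "x \<in> carrier G" and l: "\<And>l. l \<in> L \<Longrightarrow> commu x l \<in> K" and g: "g \<in> carrier G" for x g
  proof -
    obtain k l where kl: "k \<in> K" "l \<in> L" "g = k \<otimes> l" using gen[OF g] by blast
    let ?Z = "{g \<in> carrier G. commu x g \<in> K}"
    have "k \<in> ?Z" using normal_commu(2)[OF K kl(1) x] KG[OF kl(1)] by blast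
    moreover have "l \<in> ?Z" using l[OF kl(2)] LG[OF kl(2)] by blast
    ultimately have "k \<otimes> l \<in> ?Z" using subgroup.m_closed[OF commutes_mod_subgroup[OF K x]] by blast
    then show ?thesis unfolding kl(3) by blast
  qed
  \<comment> \<open>The second argument is extended from L to G for a fixed l; inverting the
    commutator then swaps the arguments so that the first can be extended too.\<close>
  have "commu x l \<in> K" if l: "l \<in> L" for l
    using inv_comm[OF step[OF LG[OF l] comm[OF l] x] x LG[OF l]] .
  then show ?thesis using step[OF x _ g] by blast
qed

text \<open>If \<open>L\<close> is a supplement of \<open>N\<close>, then \<open>G/N\<close> has the proper factor \<open>L/Y\<close>, which is abelian.\<close>

lemma perfect_supplement:
  assumes perf: "no_normal_maximal G" and N: "N \<lhd> G" and L: "subgroup L G" and NL: "N <#> L = carrier G"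
    and Y: "Y \<lhd> G\<lparr>carrier := L\<rparr>" "Y \<noteq> L" "N \<inter> L \<subseteq> Y"
    and comm: "\<And>x y. x \<in> L \<Longrightarrow> y \<in> L \<Longrightarrow> commu x y \<in> Y"
  shows False
proof -
  have sN: "subgroup N G" using N normal_imp_subgroup by blast
  have sY: "subgroup Y G" "Y \<subseteq> L" "\<And>x y. x \<in> L \<Longrightarrow> y \<in> Y \<Longrightarrow> x \<otimes> y \<otimes> inv x \<in> Y"
    using Y(1) unfolding normal_sub_iff[OF L] by blast+
  have LG: "x \<in> carrier G" if "x \<in> L" for x using subgroup.mem_carrier[OF L that] .
  have NG: "x \<in> carrier G" if "x \<in> N" for x using subgroup.mem_carrier[OF sN that] .
  let ?K = "N <#> Y"
  have sK: "subgroup ?K G" using mult_norm_subgroup[OF N sY(1)] .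
  have inK: "N \<subseteq> ?K" "Y \<subseteq> ?K" using set_mult_contains[OF sN sY(1)] by blast+
  have split: "\<exists>n l. n \<in> N \<and> l \<in> L \<and> g = n \<otimes> l" if "g \<in> carrier G" for g
    using that NL set_mult_elem[of g N L] by blast
  have KN: "?K \<lhd> G"
  proof (rule normal_invI[OF sK])
    fix g k assume g: "g \<in> carrier G" and k: "k \<in> ?K"
    obtain n l where nl: "n \<in> N" "l \<in> L" "g = n \<otimes> l" using split[OF g] by blast
    obtain m y where my: "m \<in> N" "y \<in> Y" "k = m \<otimes> y" using k set_mult_elem[of k N Y] by blast
    have yL: "y \<in> L" using my sY by blast
    have "(l \<otimes> m \<otimes> inv l) \<otimes> (l \<otimes> y \<otimes> inv l) \<in> ?K"
      using subgroup.m_closed[OF sK] normal_closed[OF N LG[OF nl(2)] my(1)] sY(3)[OF nl(2) my(2)] inK by blast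
    then have "n \<otimes> ((l \<otimes> m \<otimes> inv l) \<otimes> (l \<otimes> y \<otimes> inv l)) \<otimes> inv n \<in> ?K"
      using subgroup.m_closed[OF sK] subgroup.m_inv_closed[OF sN nl(1)] nl(1) inK(1) by blast
    then show "g \<otimes> k \<otimes> inv g \<in> ?K"
      unfolding nl(3) my(3) using NG[OF nl(1)] LG[OF nl(2)] NG[OF my(1)] LG[OF yL] by (simp add: word_simps)
  qed
  have "?K = carrier G"
  proof (rule perfect_commu_subgroup[OF perf sK commu_mod_supplement[OF KN L]])
    show "\<exists>k\<in>?K. \<exists>l\<in>L. g = k \<otimes> l" if "g \<in> carrier G" for g
      using split[OF that] inK(1) by blast
    show "commu x y \<in> ?K" if "x \<in> L" "y \<in> L" for x y
      using comm[OF that] inK(2) by blast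
  qed
  \<comment> \<open>Dedekind's law: from G = NY it follows that L = (N \<inter> L) Y, which is Y
    because N \<inter> L lies in Y.\<close>
  have "L \<subseteq> Y"
  proof
    fix l assume l: "l \<in> L"
    then obtain n y where ny: "n \<in> N" "y \<in> Y" "l = n \<otimes> y"
      using \<open>?K = carrier G\<close> LG[OF l] set_mult_elem[of l N Y] by blast
    have yL: "y \<in> L" using ny sY by blast
    have "n = l \<otimes> inv y" using ny(3) NG[OF ny(1)] LG[OF yL] by (simp add: word_simps)
    then have "n \<in> L" using subgroup.m_closed[OF L l subgroup.m_inv_closed[OF L yL]] by simp
    then have "n \<in> Y" using ny(1) Y(3) by blast
    then show "l \<in> Y" unfolding ny(3) using ny(2) subgroup.m_closed[OF sY(1)] by blast
  qed
  then show False using Y(2) sY(2) by blast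
qed

text \<open>Otherwise G/N would be isomorphic to the non-trivial nilpotent group M/(N \<inter> M),
  which has a normal subgroup of prime index.\<close>

lemma perfect_normal_in_nilpotent_maximal:
  assumes perf: "no_normal_maximal G" and N: "N \<lhd> G" "N \<noteq> carrier G"
    and M: "maximal_subgroup M G" and nil: "nilpotent_group (G\<lparr>carrier := M\<rparr>)"
  shows "N \<subseteq> M"
proof (rule ccontr)
  assume "\<not> N \<subseteq> M"
  then have NM: "N <#> M = carrier G" using maximal_set_mult[OF M N(1)] by blast
  have sM: "subgroup M G" using M by (simp add: maximal_subgroup_def)
  have sN: "subgroup N G" using N normal_imp_subgroup by blast
  interpret M: fgroup "G\<lparr>carrier := M\<rparr>" using sub_fgroup[OF sM] .
  have "N \<inter> M \<noteq> M"
  proof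
    assume "N \<inter> M = M"
    then have "M \<subseteq> N" by blast
    then have "N <#> M \<subseteq> N" using subgroup.m_closed[OF sN] unfolding set_mult_elem subset_iff by metis
    then show False using NM N(2) subgroup.subset[OF sN] by blast
  qed
  moreover have "subgroup (N \<inter> M) (G\<lparr>carrier := M\<rparr>)"
    using subgroups_Inter_pair[OF sN sM] by (simp add: subgroup_sub_iff[OF sM])
  ultimately obtain Y where Y: "maximal_subgroup Y (G\<lparr>carrier := M\<rparr>)" "N \<inter> M \<subseteq> Y"
    using M.maximal_above[of "N \<inter> M"] by auto
  have YN: "Y \<lhd> G\<lparr>carrier := M\<rparr>" using M.nilpotent_maximal_normal[OF nil Y(1)] .
  have "commu x y \<in> Y" if "x \<in> M" "y \<in> M" for x y
    using M.normal_maximal_commu[OF Y(1) YN, of x y] that m_inv_consistent[OF sM] by simp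
  then show False
    using perfect_supplement[OF perf N(1) sM NM YN _ Y(2)] Y(1) by (auto simp: maximal_subgroup_def)
qed

lemma conj_maximal:
  assumes "maximal_subgroup M G" "g \<in> carrier G"
  shows "maximal_subgroup ((\<lambda>h. g \<otimes> h \<otimes> inv g) ` M) G"
  using conj_maximal_in_normal[OF normal_self assms(2), of M] assms(1) by simp

text \<open>U is the union of the conjugates of M without F. The pairs (g,m) are counted by their
  value g m g^-1, and each fibre has |M| elements since M meets its other conjugates only inside
  F.\<close>

lemma card_conjugates:
  assumes M: "subgroup M G" and F: "F \<lhd> G" "F \<subseteq> M"
    and TI: "\<And>g. g \<in> carrier G \<Longrightarrow> g \<notin> M \<Longrightarrow> (\<lambda>h. g \<otimes> h \<otimes> inv g) ` M \<inter> M \<subseteq> F"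
  defines "U \<equiv> (\<lambda>(g, m). g \<otimes> m \<otimes> inv g) ` (carrier G \<times> (M - F))"
  shows "card U * card M = card (carrier G) * (card M - card F)"
proof -
  let ?f = "\<lambda>(g, m). g \<otimes> m \<otimes> inv g" and ?A = "carrier G \<times> (M - F)"
  have sF: "subgroup F G" using F normal_imp_subgroup by blast
  have MG: "x \<in> carrier G" if "x \<in> M" for x using subgroup.mem_carrier[OF M that] .
  have finM: "finite M" using finite_sub[OF M] .
  have finA: "finite ?A" using finM by simp
  have fib: "card {a \<in> ?A. ?f a = u} = card M" if u: "u \<in> U" for u
  proof -
    from u obtain a0 where a0: "u = ?f a0" "a0 \<in> ?A" unfolding U_def by (rule imageE)
    obtain g0 m0 where "a0 = (g0, m0)" by (cases a0)
    then have gm: "g0 \<in> carrier G" "m0 \<in> M" "m0 \<notin> F" "u = g0 \<otimes> m0 \<otimes> inv g0"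
      using a0 by simp_all
    \<comment> \<open>Two pairs with the same value differ by an element h of M, so this map
      parametrizes the fibre by M.\<close>
    let ?h = "\<lambda>h. (g0 \<otimes> h, inv h \<otimes> m0 \<otimes> h)"
    have "bij_betw ?h M {a \<in> ?A. ?f a = u}"
    proof (rule bij_betw_imageI)
      show "inj_on ?h M"
      proof (rule inj_onI)
        fix h k assume "h \<in> M" "k \<in> M" "?h h = ?h k"
        then have "g0 \<otimes> h = g0 \<otimes> k" "h \<in> carrier G" "k \<in> carrier G" using MG by (blast, blast, blast)
        then show "h = k" using gm(1) by simp
      qed
      show "?h ` M = {a \<in> ?A. ?f a = u}"
      proof (intro equalityI subsetI)
        fix a assume "a \<in> ?h ` M"
        then obtain h where h: "h \<in> M" "a = (g0 \<otimes> h, inv h \<otimes> m0 \<otimes> h)" by blast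
        have hG: "h \<in> carrier G" using MG[OF h(1)] .
        have "inv h \<otimes> m0 \<otimes> h \<in> M"
          using subgroup.m_closed[OF M subgroup.m_closed[OF M subgroup.m_inv_closed[OF M h(1)] gm(2)] h(1)] .
        moreover have "inv h \<otimes> m0 \<otimes> h \<notin> F"
        proof
          assume "inv h \<otimes> m0 \<otimes> h \<in> F"
          then have "h \<otimes> (inv h \<otimes> m0 \<otimes> h) \<otimes> inv h \<in> F" using normal_closed[OF F(1) hG] by blast
          then show False using gm(3) hG MG[OF gm(2)] by (simp add: word_simps)
        qed
        moreover have "g0 \<otimes> h \<otimes> (inv h \<otimes> m0 \<otimes> h) \<otimes> inv (g0 \<otimes> h) = u"
          unfolding gm(4) using hG gm(1) MG[OF gm(2)] by (simp add: word_simps)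
        moreover have "g0 \<otimes> h \<in> carrier G" using gm(1) hG by simp
        ultimately show "a \<in> {a \<in> ?A. ?f a = u}" unfolding h(2) by simp
      next
        fix a assume "a \<in> {a \<in> ?A. ?f a = u}"
        then have "a \<in> ?A" "?f a = u" by blast+
        moreover obtain g m where "a = (g, m)" by (cases a)
        ultimately have a: "a = (g, m)" "g \<in> carrier G" "m \<in> M" "m \<notin> F" "g \<otimes> m \<otimes> inv g = u" by simp_all
        define h where "h = inv g0 \<otimes> g"
        have hG: "h \<in> carrier G" using gm a by (simp add: h_def)
        have "h \<otimes> m \<otimes> inv h = inv g0 \<otimes> (g \<otimes> m \<otimes> inv g) \<otimes> g0"
          unfolding h_def using gm(1) a(2) MG[OF a(3)] by (simp add: word_simps)
        also have "\<dots> = m0" unfolding a(5) gm(4) using gm(1) MG[OF gm(2)] by (simp add: word_simps)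
        finally have hm: "h \<otimes> m \<otimes> inv h = m0" .
        have hM: "h \<in> M"
        proof (rule ccontr)
          assume "h \<notin> M"
          then have "(\<lambda>k. h \<otimes> k \<otimes> inv h) ` M \<inter> M \<subseteq> F" using TI[OF hG] by blast
          moreover have "m0 \<in> (\<lambda>k. h \<otimes> k \<otimes> inv h) ` M" using hm a(3) by blast
          ultimately show False using gm(2,3) by blast
        qed
        have "g = g0 \<otimes> h" unfolding h_def using gm(1) a(2) by (simp add: word_simps)
        moreover have "m = inv h \<otimes> m0 \<otimes> h" unfolding hm[symmetric] using hG MG[OF a(3)] by (simp add: word_simps)
        ultimately show "a \<in> ?h ` M" using a(1) hM by blast
      qed
    qed
    from bij_betw_same_card[OF this] show ?thesis by (rule sym)
  qed
  have "card ?A = (\<Sum>a\<in>?A. 1)" by simp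
  also have "\<dots> = (\<Sum>u\<in>?f ` ?A. \<Sum>a\<in>{a \<in> ?A. ?f a = u}. 1)"
    by (rule sum.image_gen[OF finA])
  also have "\<dots> = (\<Sum>u\<in>U. card M)" using fib unfolding U_def by simp
  also have "\<dots> = card U * card M" by simp
  finally have "card U * card M = card ?A" by simp
  also have "\<dots> = card (carrier G) * (card M - card F)"
    using finM F(2) finite_sub[OF sF] by (simp add: card_cartesian_product card_Diff_subset)
  finally show ?thesis .
qed

text \<open>Each conjugacy class of maximal subgroups covers at least half of |G| many elements
  outside Phi(G), but never all of them. An uncovered element provides a second class disjoint from
  the first, and together they exceed |G| - |Phi(G)|.\<close>

theorem maximal_nilpotent_imp_normal_maximal:
  assumes nt: "carrier G \<noteq> {\<one>}"
    and nil: "\<And>M. maximal_subgroup M G \<Longrightarrow> nilpotent_group (G\<lparr>carrier := M\<rparr>)"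
  shows "\<not> no_normal_maximal G"
proof
  assume perf: "no_normal_maximal G"
  let ?F = "frattini G"
  have FN: "?F \<lhd> G" using frattini_normal[OF normal_self] by simp
  have sF: "subgroup ?F G" by (rule subgroup_frattini)
  \<comment> \<open>Every maximal subgroup is nilpotent, so a proper normal subgroup is contained in
    all of them.\<close>
  have NF: "N \<subseteq> ?F" if "N \<lhd> G" "N \<noteq> carrier G" for N
    using perfect_normal_in_nilpotent_maximal[OF perf that _ nil] subgroup.subset[OF normal_imp_subgroup[OF that(1)]]
    unfolding frattini_def by blast
  have max: "subgroup M G" "M \<noteq> carrier G" "\<And>K. subgroup K G \<Longrightarrow> M \<subseteq> K \<Longrightarrow> K = M \<or> K = carrier G" "\<not> M \<lhd> G"
    if "maximal_subgroup M G" for M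
    using that perf unfolding maximal_subgroup_def no_normal_maximal_def by blast+
  have self: "normalizing M = M" if M: "maximal_subgroup M G" for M
    using max(3)[OF M subgroup_normalizing[OF subgroup.subset[OF max(1)[OF M]]] sub_normalizing[OF max(1)[OF M]]]
      normalizing_eq_carrier[OF max(1)[OF M]] max(4)[OF M] by blast
  \<comment> \<open>Induction on decreasing order of the intersection: strictly larger intersections
    are already known to lie in F.\<close>
  have int: "M1 \<inter> M2 \<subseteq> ?F" if "maximal_subgroup M1 G" "maximal_subgroup M2 G" "M1 \<noteq> M2" for M1 M2
    using that
  proof (induction "card (carrier G) - card (M1 \<inter> M2)" arbitrary: M1 M2 rule: less_induct)
    case less
    let ?D = "M1 \<inter> M2"
    note m1 = max[OF less.prems(1)] and m2 = max[OF less.prems(2)]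
    have sD: "subgroup ?D G" using subgroups_Inter_pair[OF m1(1) m2(1)] .
    have DG: "?D \<subseteq> carrier G" using subgroup.subset[OF sD] .
    show ?case
    proof (rule ccontr)
      assume nD: "\<not> ?D \<subseteq> ?F"
      have "normalizing ?D \<noteq> carrier G"
      proof
        assume "normalizing ?D = carrier G"
        then have "?D \<lhd> G" using normalizing_eq_carrier[OF sD] by blast
        moreover have "?D \<noteq> carrier G" using m1 subgroup.subset[OF m1(1)] by blast
        ultimately show False using NF nD by blast
      qed
      then obtain M3 where M3: "maximal_subgroup M3 G" "normalizing ?D \<subseteq> M3"
        using maximal_above[OF subgroup_normalizing[OF DG]] by blast
      \<comment> \<open>Normalizers grow in the nilpotent group M, so M3 \<inter> M is strictly
        larger than D. If M3 differed from M, the induction hypothesis would place it, and D, inside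
        F. Used for M1 and M2, this gives M1 = M3 = M2.\<close>
      have eq: "M3 = M" if M: "maximal_subgroup M G" "?D \<subseteq> M" "?D \<noteq> M" for M
      proof (rule ccontr)
        assume ne: "M3 \<noteq> M"
        have sM: "subgroup M G" using max(1)[OF M(1)] .
        interpret M: fgroup "G\<lparr>carrier := M\<rparr>" using sub_fgroup[OF sM] .
        have "subgroup ?D (G\<lparr>carrier := M\<rparr>)" using sD M(2) by (simp add: subgroup_sub_iff[OF sM])
        then obtain x where x: "x \<in> M" "x \<notin> ?D" "\<And>g. g \<in> M \<Longrightarrow> commu x g \<in> ?D"
          using M.nilpotent_central_mod[OF nil[OF M(1)], of ?D] M(3) m_inv_consistent[OF sM] by auto
        have xG: "x \<in> carrier G" using subgroup.mem_carrier[OF sM x(1)] .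
        have "x \<in> normalizing ?D"
        proof (rule normalizing_finiteI[OF finite_sub[OF sD] DG xG])
          fix d assume d: "d \<in> ?D"
          have dG: "d \<in> carrier G" using d DG by blast
          have "commu x d \<otimes> d \<in> ?D" using subgroup.m_closed[OF sD x(3) d] d M(2) by blast
          then show "x \<otimes> d \<otimes> inv x \<in> ?D" using xG dG by (simp add: word_simps)
        qed
        then have "x \<in> M3 \<inter> M" using M3(2) x(1) by blast
        moreover have DM: "?D \<subseteq> M3 \<inter> M" using sub_normalizing[OF sD] M3(2) M(2) by blast
        ultimately have "?D \<subset> M3 \<inter> M" using x(2) by blast
        moreover have fin3: "finite (M3 \<inter> M)" using finite_sub[OF sM] by simp
        ultimately have "card ?D < card (M3 \<inter> M)" by (simp add: psubset_card_mono)
        moreover have "card (M3 \<inter> M) \<le> card (carrier G)"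
          using card_mono[OF fin] subgroup.subset[OF sM] by (meson inf.coboundedI2)
        ultimately have "card (carrier G) - card (M3 \<inter> M) < card (carrier G) - card ?D" by linarith
        then have "M3 \<inter> M \<subseteq> ?F" using less.hyps M3(1) M(1) ne by blast
        then show False using DM nD by blast
      qed
      have "?D \<noteq> M1"
      proof
        assume "?D = M1"
        then have "M1 \<subseteq> M2" by blast
        then show False using m1(3)[OF m2(1)] m2(2) less.prems(3) by blast
      qed
      moreover have "?D \<noteq> M2"
      proof
        assume "?D = M2"
        then have "M2 \<subseteq> M1" by blast
        then show False using m2(3)[OF m1(1)] m1(2) less.prems(3) by blast
      qed
      ultimately show False using eq[OF less.prems(1)] eq[OF less.prems(2)] less.prems(3) by blast
    qed
  qed
  define U where "U M = (\<lambda>(g, m). g \<otimes> m \<otimes> inv g) ` (carrier G \<times> (M - ?F))" for M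
  have UE: thesis if "u \<in> U M"
    "\<And>g m. g \<in> carrier G \<Longrightarrow> m \<in> M \<Longrightarrow> m \<notin> ?F \<Longrightarrow> u = g \<otimes> m \<otimes> inv g \<Longrightarrow> thesis" for u M thesis
  proof -
    from that(1) obtain a where a: "u = (\<lambda>(g, m). g \<otimes> m \<otimes> inv g) a" "a \<in> carrier G \<times> (M - ?F)"
      unfolding U_def by (rule imageE)
    then show thesis by (cases a) (rule that(2)[of "fst a" "snd a"], simp_all)
  qed
  have FM: "?F \<subset> M" if M: "maximal_subgroup M G" for M
    using frattini_maximal[OF M] max(4)[OF M] FN by blast
  have cardU: "card (U M) * card M = card (carrier G) * (card M - card ?F)" if M: "maximal_subgroup M G" for M
    unfolding U_def
  proof (rule card_conjugates[OF max(1)[OF M] FN])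
    show "?F \<subseteq> M" using FM[OF M] by blast
    fix g assume g: "g \<in> carrier G" "g \<notin> M"
    have "(\<lambda>h. g \<otimes> h \<otimes> inv g) ` M \<noteq> M"
    proof
      assume eq: "(\<lambda>h. g \<otimes> h \<otimes> inv g) ` M = M"
      have "g \<in> normalizing M"
        by (rule normalizing_finiteI[OF finite_sub[OF max(1)[OF M]] subgroup.subset[OF max(1)[OF M]] g(1)])
          (use eq in blast)
      then show False using self[OF M] g(2) by blast
    qed
    then show "(\<lambda>h. g \<otimes> h \<otimes> inv g) ` M \<inter> M \<subseteq> ?F" using int[OF conj_maximal[OF M g(1)] M] by blast
  qed
  \<comment> \<open>F is a proper subgroup of M, so |M| - |F| is at least |M|/2.\<close>
  have half: "card (carrier G) \<le> 2 * card (U M)" if M: "maximal_subgroup M G" for M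
  proof -
    obtain i where i: "i \<ge> 2" "card M = i * card ?F"
      using card_sub_psubset[OF sF max(1)[OF M] FM[OF M]] by blast
    have "2 * card ?F \<le> card M" unfolding i(2) using i(1) by simp
    then have "card M \<le> 2 * (card M - card ?F)" by simp
    then have "card (carrier G) * card M \<le> 2 * (card (U M) * card M)"
      unfolding cardU[OF M] using mult_le_mono2 by (metis mult.left_commute)
    then show ?thesis using card_sub_pos[OF max(1)[OF M]] by simp
  qed
  have UG: "U M \<subseteq> carrier G - ?F" if M: "maximal_subgroup M G" for M
  proof
    fix u assume "u \<in> U M"
    then obtain g m where gm: "g \<in> carrier G" "m \<in> M" "m \<notin> ?F" "u = g \<otimes> m \<otimes> inv g" by (rule UE)
    have mG: "m \<in> carrier G" using subgroup.mem_carrier[OF max(1)[OF M] gm(2)] .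
    have "u \<notin> ?F"
    proof
      assume "u \<in> ?F"
      then have "inv g \<otimes> u \<otimes> inv (inv g) \<in> ?F" using normal_closed[OF FN inv_closed[OF gm(1)]] by blast
      then show False using gm mG by (simp add: word_simps)
    qed
    then show "u \<in> carrier G - ?F" using gm mG by simp
  qed
  obtain M where M: "maximal_subgroup M G" using maximal_above[OF triv_subgroup] nt by blast
  have cardGF: "card (carrier G - ?F) = card (carrier G) - card ?F"
    using card_Diff_subset[OF finite_sub[OF sF] subgroup.subset[OF sF]] .
  \<comment> \<open>The count gives |U| = |G| - |G:M| |F|, too small because the index exceeds
    1.\<close>
  have "U M \<noteq> carrier G - ?F"
  proof
    assume eq: "U M = carrier G - ?F"
    obtain i where i: "i \<ge> 2" "card (carrier G) = i * card M"
      using card_sub_psubset[OF max(1)[OF M] subgroup_self] max(2)[OF M] subgroup.subset[OF max(1)[OF M]] by blast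
    have "card (U M) * card M = (i * (card M - card ?F)) * card M"
      unfolding cardU[OF M] i(2) by (simp only: ac_simps)
    then have "card (U M) = i * (card M - card ?F)" using card_sub_pos[OF max(1)[OF M]] by simp
    then have "card (U M) = card (carrier G) - i * card ?F" using i(2) by (simp add: diff_mult_distrib2)
    then have "card (carrier G) - i * card ?F = card (carrier G) - card ?F" using eq cardGF by simp
    moreover have "card ?F < card M" using FM[OF M] finite_sub[OF max(1)[OF M]] by (simp add: psubset_card_mono)
    \<comment> \<open>Needed because subtraction of natural numbers truncates: it makes the two
      differences comparable.\<close>
    then have "i * card ?F < card (carrier G)" unfolding i(2) using i(1) by simp
    moreover have "card ?F < i * card ?F" using card_sub_pos[OF sF] i(1) by simp
    ultimately show False by linarith
  qed
  then obtain x where x: "x \<in> carrier G" "x \<notin> ?F" "x \<notin> U M" using UG[OF M] by blast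
  \<comment> \<open>A non-trivial perfect group is not cyclic, so x lies in some maximal
    subgroup.\<close>
  have "generate G {x} \<noteq> carrier G"
  proof
    assume eq: "generate G {x} = carrier G"
    have "commu a b \<in> {\<one>}" if "a \<in> carrier G" "b \<in> carrier G" for a b
    proof -
      have "a \<in> generate G {x}" "b \<in> generate G {x}" using that eq by simp_all
      then obtain i j :: int where "a = x [^] i" "b = x [^] j"
        unfolding generate_pow[OF x(1)] by blast
      then have "a \<otimes> b = b \<otimes> a" using int_pow_mult[OF x(1), of i j] int_pow_mult[OF x(1), of j i] by (simp add: add.commute)
      then show ?thesis using commu_one_iff[OF that] by simp
    qed
    then have "{\<one>} = carrier G" using perfect_commu_subgroup[OF perf triv_subgroup] by blast
    then show False using nt by simp
  qed
  then obtain M' where M': "maximal_subgroup M' G" "x \<in> M'"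
    using maximal_above[OF generate_singleton(1)[OF x(1)]] generate_singleton(2)[OF x(1)] by blast
  \<comment> \<open>A common element lies outside F and in a conjugate of M and one of M'. Distinct
    ones meet inside F, so they coincide, and then x is conjugate into M, against the choice of
    x.\<close>
  have "U M \<inter> U M' = {}"
  proof (rule ccontr)
    assume "U M \<inter> U M' \<noteq> {}"
    then obtain u where u: "u \<in> U M" "u \<in> U M'" by blast
    obtain g m where gm: "g \<in> carrier G" "m \<in> M" "u = g \<otimes> m \<otimes> inv g" using UE[OF u(1)] by metis
    obtain h k where hk: "h \<in> carrier G" "k \<in> M'" "u = h \<otimes> k \<otimes> inv h" using UE[OF u(2)] by metis
    have "(\<lambda>a. g \<otimes> a \<otimes> inv g) ` M = (\<lambda>a. h \<otimes> a \<otimes> inv h) ` M'"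
    proof (rule ccontr)
      assume "(\<lambda>a. g \<otimes> a \<otimes> inv g) ` M \<noteq> (\<lambda>a. h \<otimes> a \<otimes> inv h) ` M'"
      from int[OF conj_maximal[OF M gm(1)] conj_maximal[OF M'(1) hk(1)] this]
      show False using gm hk u(1) UG[OF M] by blast
    qed
    then have "h \<otimes> x \<otimes> inv h \<in> (\<lambda>a. g \<otimes> a \<otimes> inv g) ` M" using M'(2) by blast
    then obtain a where a: "a \<in> M" "h \<otimes> x \<otimes> inv h = g \<otimes> a \<otimes> inv g" by blast
    have aG: "a \<in> carrier G" using subgroup.mem_carrier[OF max(1)[OF M] a(1)] .
    have "x = inv h \<otimes> (h \<otimes> x \<otimes> inv h) \<otimes> h" using x(1) hk(1) by (simp add: word_simps)
    also have "\<dots> = (inv h \<otimes> g) \<otimes> a \<otimes> inv (inv h \<otimes> g)"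
      unfolding a(2) using hk(1) gm(1) aG by (simp add: word_simps)
    finally have xa: "x = (inv h \<otimes> g) \<otimes> a \<otimes> inv (inv h \<otimes> g)" .
    have "a \<notin> ?F" using x(2) normal_closed[OF FN, of "inv h \<otimes> g" a] hk(1) gm(1) xa by auto
    then have "x \<in> U M" unfolding U_def
      by (intro image_eqI[of _ _ "(inv h \<otimes> g, a)"]) (use xa a(1) hk(1) gm(1) in auto)
    then show False using x(3) by blast
  qed
  moreover have finU: "finite (U M)" "finite (U M')"
    using UG[OF M] UG[OF M'(1)] fin by (meson finite_Diff finite_subset)+
  ultimately have "card (U M) + card (U M') = card (U M \<union> U M')" by (simp add: card_Un_disjoint)
  also have "\<dots> \<le> card (carrier G - ?F)" using UG[OF M] UG[OF M'(1)] fin by (intro card_mono) auto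
  finally have "card (U M) + card (U M') \<le> card (carrier G) - card ?F" unfolding cardGF .
  then show False
    using half[OF M] half[OF M'(1)] card_sub_pos[OF sF] card_mono[OF fin subgroup.subset[OF sF]] by linarith
qed

end

subsection \<open>A normal nilpotent maximal subgroup\<close>

context fgroup
begin

text \<open>The coset \<open>xN\<close> has \<open>r\<close>-power order and is permuted by the \<open>q\<close>-group generated by \<open>s\<close>.\<close>

lemma coprime_fixed_point:
  assumes q: "prime q" "prime r" "q \<noteq> r" and s: "p_elem G q s"
    and N: "subgroup N G" "card N = r ^ n" "\<And>m. m \<in> N \<Longrightarrow> s \<otimes> m \<otimes> inv s \<in> N"
    and x: "x \<in> carrier G" "inv x \<otimes> (s \<otimes> x \<otimes> inv s) \<in> N"
  shows "\<exists>m\<in>N. s \<otimes> (x \<otimes> m) = (x \<otimes> m) \<otimes> s"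
proof -
  have sG: "s \<in> carrier G" using s by (simp add: p_elem_def)
  have NG: "m \<in> carrier G" if "m \<in> N" for m using subgroup.mem_carrier[OF N(1) that] .
  let ?Q = "generate G {s}"
  have sQ: "subgroup ?Q G" "s \<in> ?Q" using generate_singleton[OF sG] by blast+
  have QG: "g \<in> carrier G" if "g \<in> ?Q" for g using subgroup.mem_carrier[OF sQ(1) that] .
  obtain k where k: "card ?Q = q ^ k" using p_elem_generate_card[OF q(1) s] by blast
  let ?E = "(\<lambda>m. x \<otimes> m) ` N"
  have EG: "e \<in> carrier G" if "e \<in> ?E" for e using that x(1) NG by auto
  \<comment> \<open>The assumption on x says exactly that s maps the coset xN to itself.\<close>
  have sE: "s \<otimes> e \<otimes> inv s \<in> ?E" if "e \<in> ?E" for e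
  proof -
    from that obtain m where m: "m \<in> N" "e = x \<otimes> m" by blast
    have "s \<otimes> e \<otimes> inv s = x \<otimes> ((inv x \<otimes> (s \<otimes> x \<otimes> inv s)) \<otimes> (s \<otimes> m \<otimes> inv s))"
      unfolding m(2) using x(1) sG NG[OF m(1)] by (simp add: word_simps)
    then show ?thesis using subgroup.m_closed[OF N(1) x(2) N(3)[OF m(1)]] by blast
  qed
  have pE: "(s [^] (j::nat)) \<otimes> e \<otimes> inv (s [^] j) \<in> ?E" if "e \<in> ?E" for e j
    using that
  proof (induction j arbitrary: e)
    case 0
    then show ?case using EG[OF 0] by simp
  next
    case (Suc j)
    have "s [^] j \<otimes> (s \<otimes> e \<otimes> inv s) \<otimes> inv (s [^] j) \<in> ?E" using Suc.IH[OF sE[OF Suc.prems]] .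
    then show ?case using sG EG[OF Suc.prems] by (simp add: word_simps)
  qed
  have gE: "g \<otimes> e \<otimes> inv g \<in> ?E" if g: "g \<in> ?Q" and e: "e \<in> ?E" for g e
  proof -
    obtain j :: nat where "g = s [^] j" using g unfolding generate_pow_on_finite_carrier[OF fin sG] by blast
    then show ?thesis using pE[OF e] by simp
  qed
  interpret Q: group "G\<lparr>carrier := ?Q\<rparr>" using subgroup_imp_group[OF sQ(1)] .
  have finE: "finite ?E" using finite_sub[OF N(1)] by blast
  have eq: "q dvd card ?E \<longleftrightarrow> q dvd card {e \<in> ?E. \<forall>g\<in>carrier (G\<lparr>carrier := ?Q\<rparr>). g \<otimes> e \<otimes> inv g = e}"
  proof (rule Q.action_fixed_points_mod[OF q(1) _ finE])
    show "card (carrier (G\<lparr>carrier := ?Q\<rparr>)) = q ^ k" using k by simp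
    fix g e assume "g \<in> carrier (G\<lparr>carrier := ?Q\<rparr>)" "e \<in> ?E"
    then show "g \<otimes> e \<otimes> inv g \<in> ?E" using gE by simp
  next
    fix e assume e: "e \<in> ?E"
    show "\<one>\<^bsub>G\<lparr>carrier := ?Q\<rparr>\<^esub> \<otimes> e \<otimes> inv \<one>\<^bsub>G\<lparr>carrier := ?Q\<rparr>\<^esub> = e" using EG[OF e] by simp
  next
    fix g h e assume gh: "g \<in> carrier (G\<lparr>carrier := ?Q\<rparr>)" "h \<in> carrier (G\<lparr>carrier := ?Q\<rparr>)" and e: "e \<in> ?E"
    have "g \<in> carrier G" "h \<in> carrier G" using gh QG by simp_all
    then show "g \<otimes>\<^bsub>G\<lparr>carrier := ?Q\<rparr>\<^esub> h \<otimes> e \<otimes> inv (g \<otimes>\<^bsub>G\<lparr>carrier := ?Q\<rparr>\<^esub> h) = g \<otimes> (h \<otimes> e \<otimes> inv h) \<otimes> inv g"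
      using EG[OF e] by (simp add: word_simps)
  qed
  have "inj_on (\<lambda>m. x \<otimes> m) N"
  proof (rule inj_onI)
    fix a b assume "a \<in> N" "b \<in> N" "x \<otimes> a = x \<otimes> b"
    with NG[of a] NG[of b] x(1) show "a = b" by simp
  qed
  then have "card ?E = r ^ n" using N(2) by (simp add: card_image)
  moreover have "\<not> q dvd r ^ n" using q prime_dvd_power primes_dvd_imp_eq by blast
  ultimately have nd: "\<not> q dvd card {e \<in> ?E. \<forall>g\<in>?Q. g \<otimes> e \<otimes> inv g = e}" using eq by simp
  have "{e \<in> ?E. \<forall>g\<in>?Q. g \<otimes> e \<otimes> inv g = e} \<noteq> {}"
  proof
    assume e: "{e \<in> ?E. \<forall>g\<in>?Q. g \<otimes> e \<otimes> inv g = e} = {}"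
    show False using nd unfolding e by simp
  qed
  then obtain e where e: "e \<in> ?E" "\<And>g. g \<in> ?Q \<Longrightarrow> g \<otimes> e \<otimes> inv g = e" by blast
  obtain m where m: "m \<in> N" "e = x \<otimes> m" using e(1) by blast
  have "s \<otimes> e \<otimes> inv s = e" using e(2)[OF sQ(2)] .
  then have "s \<otimes> e = e \<otimes> s" using sG EG[OF e(1)] by (metis inv_closed inv_solve_right' m_closed)
  then show ?thesis using m by blast
qed

lemma nilpotent_commu_frattini:
  assumes nil: "nilpotent_group G" and x: "x \<in> carrier G" and y: "y \<in> carrier G"
  shows "commu x y \<in> frattini G"
  using normal_maximal_commu[OF _ nilpotent_maximal_normal[OF nil] x y] x y by (auto simp: frattini_def)

text \<open>The Sylow p-subgroup of a nilpotent M consists of all p-elements of M, a set invariant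
  under conjugation by G.\<close>

lemma normal_p_part:
  assumes M: "M \<lhd> G" and nil: "nilpotent_group (G\<lparr>carrier := M\<rparr>)" and p: "prime p"
  shows "\<exists>P n. P \<lhd> G \<and> P \<subseteq> M \<and> card P = p ^ n \<and> sylow_subgroup (G\<lparr>carrier := M\<rparr>) p P \<and>
    (\<forall>x. x \<in> P \<longleftrightarrow> x \<in> M \<and> p_elem G p x)"
proof -
  have sM: "subgroup M G" using M normal_imp_subgroup by blast
  interpret M: fgroup "G\<lparr>carrier := M\<rparr>" using sub_fgroup[OF sM] .
  obtain P where P: "sylow_subgroup (G\<lparr>carrier := M\<rparr>) p P" using M.sylow_exists[OF p] by blast
  have PM: "P \<lhd> G\<lparr>carrier := M\<rparr>" using M.nilpotent_sylow_normal[OF nil p P] .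
  have sP: "subgroup P (G\<lparr>carrier := M\<rparr>)" "card P = p ^ multiplicity p (card M)"
    using P by (auto simp: sylow_subgroup_def)
  have sP': "subgroup P G" "P \<subseteq> M" using sP(1) by (auto simp: subgroup_sub_iff[OF sM])
  have iff: "x \<in> P \<longleftrightarrow> x \<in> M \<and> p_elem G p x" for x
    using M.p_elem_in_normal_sylow[OF p _ P PM, of x] in_p_subgroup_p_elem[OF sP'(1) sP(2), of x]
      p_elem_sub[OF sM] sP'(2) by blast
  have "P \<lhd> G"
  proof (rule normal_invI[OF sP'(1)])
    fix g x assume g: "g \<in> carrier G" and x: "x \<in> P"
    have "g \<otimes> x \<otimes> inv g \<in> (\<lambda>h. g \<otimes> h \<otimes> inv g) ` P" using x by blast
    then have "p_elem G p (g \<otimes> x \<otimes> inv g)"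
      using in_p_subgroup_p_elem[OF conj_subgroup(1)[OF sP'(1) g]] conj_subgroup(2)[OF sP'(1) g] sP(2) by metis
    then show "g \<otimes> x \<otimes> inv g \<in> P" using iff normal_closed[OF M g] x sP'(2) by blast
  qed
  then show ?thesis using sP'(2) sP(2) P iff by blast
qed

end

section \<open>Centrality modulo the Frattini subgroup of M\<close>

locale nilpotent_maximal = fgroup +
  fixes M
  assumes maxM: "maximal_subgroup M G" and normM: "M \<lhd> G" and nilM: "nilpotent_group (G\<lparr>carrier := M\<rparr>)"
begin

abbreviation F where "F \<equiv> frattini (G\<lparr>carrier := M\<rparr>)"

text \<open>The preimage in G of the centre of G/Phi(M).\<close>

definition Z where "Z = {x \<in> carrier G. \<forall>g\<in>carrier G. commu x g \<in> F}"

lemma sM: "subgroup M G" using normM normal_imp_subgroup by blast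

lemma M_carrier: "x \<in> M \<Longrightarrow> x \<in> carrier G" using subgroup.mem_carrier[OF sM] .

sublocale M: fgroup "G\<lparr>carrier := M\<rparr>" using sub_fgroup[OF sM] .

lemma F_normal: "F \<lhd> G" using frattini_normal[OF normM] .

lemma F_sub: "subgroup F G" using F_normal normal_imp_subgroup by blast

lemma F_M: "F \<subseteq> M" using frattini_sub_subset .

lemma F_frattini: "F \<subseteq> frattini G" using frattini_normal_subset[OF normM] .

lemma Z_normal: "Z \<lhd> G" unfolding Z_def using central_mod_normal[OF F_normal] .

lemma Z_sub: "subgroup Z G" using Z_normal normal_imp_subgroup by blast

lemma F_Z: "F \<subseteq> Z"
  unfolding Z_def using normal_commu(1)[OF F_normal] subgroup.mem_carrier[OF F_sub] by blast

lemma M_commu: "x \<in> M \<Longrightarrow> y \<in> M \<Longrightarrow> commu x y \<in> F"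
  using M.nilpotent_commu_frattini[OF nilM, of x y] m_inv_consistent[OF sM] by simp

lemma generated_by_M:
  assumes s: "s \<in> carrier G" "s \<notin> M" and K: "subgroup K G" "M \<subseteq> K" "s \<in> K"
  shows "K = carrier G"
  using maxM K s unfolding maximal_subgroup_def by blast

text \<open>M/Phi(M) is abelian and G is generated by M and s, so for elements of M centrality
  modulo Phi(M) can be tested on s alone.\<close>

lemma Z_I:
  assumes x: "x \<in> M" and s: "s \<in> carrier G" "s \<notin> M" and comm: "commu x s \<in> F"
  shows "x \<in> Z"
proof -
  have "{g \<in> carrier G. commu x g \<in> F} = carrier G" (is "?C = _")
  proof (rule generated_by_M[OF s])
    show "subgroup ?C G" using commutes_mod_subgroup[OF F_normal M_carrier[OF x]] .
    show "M \<subseteq> ?C" using M_commu[OF x] M_carrier by blast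
    show "s \<in> ?C" using s comm by blast
  qed
  then show ?thesis unfolding Z_def using M_carrier[OF x] by blast
qed

text \<open>The q-element s permutes the coset xC, whose size is a power of r, so it fixes some xm.
  Then xm lies in \<open>Z\<close>, and m does so because C is contained in
  \<open>Z\<close>.\<close>

lemma coprime_Z:
  assumes q: "prime q" "prime r" "q \<noteq> r" and s: "p_elem G q s" "s \<notin> M"
    and C: "C \<lhd> G" "card C = r ^ n" "C \<subseteq> Z" "C \<subseteq> M" and x: "x \<in> M" "commu x s \<in> C"
  shows "x \<in> Z"
proof -
  have sC: "subgroup C G" using C normal_imp_subgroup by blast
  have sG: "s \<in> carrier G" using s by (simp add: p_elem_def)
  have xG: "x \<in> carrier G" using M_carrier[OF x(1)] .
  have "inv x \<otimes> inv (commu x s) \<otimes> inv (inv x) \<in> C"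
    using normal_closed[OF C(1) inv_closed[OF xG] subgroup.m_inv_closed[OF sC x(2)]] .
  then have "inv x \<otimes> (s \<otimes> x \<otimes> inv s) \<in> C" using xG sG by (simp add: word_simps)
  then obtain m where m: "m \<in> C" "s \<otimes> (x \<otimes> m) = (x \<otimes> m) \<otimes> s"
    using coprime_fixed_point[OF q s(1) sC C(2) normal_closed[OF C(1) sG] xG] by blast
  have mM: "m \<in> M" using m(1) C(4) by blast
  have xm: "x \<otimes> m \<in> M" using subgroup.m_closed[OF sM x(1) mM] .
  have "commu (x \<otimes> m) s = \<one>" using commu_one_iff[OF M_carrier[OF xm] sG] m(2) by simp
  then have "x \<otimes> m \<in> Z" using Z_I[OF xm sG s(2)] subgroup.one_closed[OF F_sub] by simp
  then have "(x \<otimes> m) \<otimes> inv m \<in> Z"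
    using subgroup.m_closed[OF Z_sub _ subgroup.m_inv_closed[OF Z_sub]] m(1) C(3) by blast
  then show ?thesis using xG M_carrier[OF mM] by (simp add: word_simps)
qed

text \<open>M has smaller q-part than G and cannot contain a Sylow q-subgroup of G.\<close>

lemma outside_elem:
  assumes q: "prime q" "card (carrier G) = q * card M"
  shows "\<exists>s. p_elem G q s \<and> s \<notin> M"
proof -
  obtain S where S: "sylow_subgroup G q S" using sylow_exists[OF q(1)] by blast
  have sS: "subgroup S G" "card S = q ^ multiplicity q (card (carrier G))" using S by (auto simp: sylow_subgroup_def)
  have "\<not> S \<subseteq> M"
  proof
    assume "S \<subseteq> M"
    then have "q ^ multiplicity q (card (carrier G)) dvd card M" using card_sub_dvd[OF sS(1) sM] sS(2) by simp
    then have "q ^ Suc (multiplicity q (card (carrier G))) dvd card (carrier G)"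
      by (subst q(2)) (simp only: power_Suc mult_dvd_mono dvd_refl)
    then show False
      using power_dvd_iff_le_multiplicity[OF card_carrier_nonzero prime_not_unit[OF q(1)]] by (metis Suc_n_not_le_n)
  qed
  then show ?thesis using in_p_subgroup_p_elem[OF sS] by blast
qed

lemma coprime_elem_in_M:
  assumes q: "prime q" "\<forall>x\<in>carrier G. x [^] q \<in> M" and r: "prime r" "r \<noteq> q" and x: "p_elem G r x"
  shows "x \<in> M"
proof -
  obtain k where k: "x \<in> carrier G" "x [^] (r ^ k) = \<one>" using x by (auto simp: p_elem_def)
  have "coprime q (r ^ k)" using primes_coprime[OF q(1) r(1)] r(2) by simp
  then show ?thesis
    using pow_coprime_mem[OF sM k(1), of q "r ^ k"] q(2) k subgroup.one_closed[OF sM] by simp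
qed

text \<open>Let S be a Sylow q-subgroup and Y maximal above N(S). Phi(M) lies in Phi(G), hence in Y,
  and every element of order prime to q normalizes S modulo Phi(M). The Frattini argument in Phi(M)
  S puts such elements into Y, forcing Y = G. So S is normal, and elements of coprime prime-power
  order commute.\<close>

lemma nilpotent_if_central:
  assumes q: "prime q" "card (carrier G) = q * card M" "\<forall>x\<in>carrier G. x [^] q \<in> M"
    and cen: "\<And>r x. prime r \<Longrightarrow> r \<noteq> q \<Longrightarrow> x \<in> M \<Longrightarrow> p_elem G r x \<Longrightarrow> x \<in> Z"
  shows "nilpotent_group G"
proof -
  obtain S where S: "sylow_subgroup G q S" using sylow_exists[OF q(1)] by blast
  have sS: "subgroup S G" "card S = q ^ multiplicity q (card (carrier G))" using S by (auto simp: sylow_subgroup_def)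
  have SG: "S \<subseteq> carrier G" using subgroup.subset[OF sS(1)] .
  have SN: "S \<lhd> G"
  proof (rule ccontr)
    assume "\<not> S \<lhd> G"
    then have "normalizing S \<noteq> carrier G" using normalizing_eq_carrier[OF sS(1)] by blast
    then obtain Y where Y: "maximal_subgroup Y G" "normalizing S \<subseteq> Y"
      using maximal_above[OF subgroup_normalizing[OF SG]] by blast
    have sY: "subgroup Y G" "Y \<noteq> carrier G" using Y(1) by (auto simp: maximal_subgroup_def)
    have SY: "S \<subseteq> Y" using sub_normalizing[OF sS(1)] Y(2) by blast
    have FY: "F \<subseteq> Y" using F_frattini frattini_maximal[OF Y(1)] by blast
    let ?K = "F <#> S"
    have sK: "subgroup ?K G" using mult_norm_subgroup[OF F_normal sS(1)] .
    have SK: "F \<subseteq> ?K" "S \<subseteq> ?K" using set_mult_contains[OF F_sub sS(1)] by blast+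
    have KY: "?K \<subseteq> Y" unfolding subset_iff set_mult_elem using FY SY subgroup.m_closed[OF sY(1)] by blast
    have inY: "x \<in> Y" if r: "prime r" "r \<noteq> q" and x: "p_elem G r x" for r x
    proof -
      have xM: "x \<in> M" using coprime_elem_in_M[OF q(1,3) r x] .
      have xG: "x \<in> carrier G" using M_carrier[OF xM] .
      have "x \<otimes> h \<otimes> inv x \<in> ?K" if h: "h \<in> S" for h
      proof -
        have hG: "h \<in> carrier G" using h SG by blast
        have "commu x h \<in> F" using cen[OF r xM x] hG unfolding Z_def by blast
        then have "commu x h \<otimes> h \<in> ?K" using subgroup.m_closed[OF sK] SK h by blast
        then show ?thesis using xG hG by (simp add: word_simps)
      qed
      then obtain k where k: "k \<in> ?K" "k \<otimes> x \<in> normalizing S"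
        using frattini_argument[OF q(1) S sK SK(2) xG] by blast
      have kG: "k \<in> carrier G" using subgroup.mem_carrier[OF sK k(1)] .
      have "inv k \<otimes> (k \<otimes> x) \<in> Y"
        using subgroup.m_closed[OF sY(1) subgroup.m_inv_closed[OF sY(1)]] k KY Y(2) by blast
      then show ?thesis using kG xG by (simp add: word_simps)
    qed
    have "Y = carrier G"
    proof (rule sylow_dvd_eq[OF sY(1)])
      fix r :: nat assume r: "prime r"
      show "\<exists>T. sylow_subgroup G r T \<and> T \<subseteq> Y"
      proof (cases "r = q")
        case True
        then show ?thesis using S SY by blast
      next
        case False
        obtain T where T: "sylow_subgroup G r T" using sylow_exists[OF r] by blast
        then have "subgroup T G" "card T = r ^ multiplicity r (card (carrier G))" by (auto simp: sylow_subgroup_def)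
        then have "T \<subseteq> Y" using inY[OF r False in_p_subgroup_p_elem] by blast
        then show ?thesis using T by blast
      qed
    qed
    then show False using sY(2) by blast
  qed
  have cop: "x \<otimes> y = y \<otimes> x" if r: "prime r" "r \<noteq> q" and x: "p_elem G r x" and y: "p_elem G q y" for r x y
  proof -
    obtain P n where P: "P \<lhd> G" "card P = r ^ n" "\<forall>x. x \<in> P \<longleftrightarrow> x \<in> M \<and> p_elem G r x"
      using normal_p_part[OF normM nilM r(1)] by blast
    have "x \<in> P" using P(3) coprime_elem_in_M[OF q(1,3) r x] x by blast
    moreover have "y \<in> S" using p_elem_in_normal_sylow[OF q(1) y S SN] .
    moreover have "coprime (card P) (card S)" using P(2) sS(2) primes_coprime[OF r(1) q(1) r(2)] by simp
    ultimately show ?thesis using normal_coprime_commute[OF P(1) SN] by blast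
  qed
  show ?thesis
  proof (rule commute_imp_nilpotent)
    fix p r x y assume pr: "prime p" "prime r" "p \<noteq> r" and x: "p_elem G p x" and y: "p_elem G r y"
    consider "p = q" | "r = q" | "p \<noteq> q" "r \<noteq> q" by blast
    then show "x \<otimes> y = y \<otimes> x"
    proof cases
      case 1
      then show ?thesis using cop[OF pr(2) _ y] x pr(3) by metis
    next
      case 2
      then show ?thesis using cop[OF pr(1) _ x] y pr(3) by metis
    next
      case 3
      have xM: "x \<in> M" and yM: "y \<in> M"
        using coprime_elem_in_M[OF q(1,3) pr(1) 3(1) x] coprime_elem_in_M[OF q(1,3) pr(2) 3(2) y] .
      have "p_elem (G\<lparr>carrier := M\<rparr>) p x" "p_elem (G\<lparr>carrier := M\<rparr>) r y"
        unfolding p_elem_sub[OF sM] using x y xM yM by blast+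
      from M.sylow_normal_imp_commute[OF M.nilpotent_sylow_normal[OF nilM] pr this]
      show ?thesis by simp
    qed
  qed
qed

text \<open>
  The subgroup \<open>R\<close> is minimal among the normal \<open>p\<close>-subgroups of \<open>G\<close> inside \<open>M\<close> that are not
  central modulo \<open>F\<close>. If \<open>x \<in> R - Z\<close> lies in an IC\<open>\<Phi>\<close>-subgroup \<open>H\<close> then \<open>[{x},G] = R\<close>
  by minimality, so \<open>x \<in> H \<inter> [H,G] \<le> \<Phi>(H) \<le> F \<le> Z\<close>.
\<close>

theorem noncentral_section:
  assumes nn: "\<not> nilpotent_group G"
  obtains p q R s where "prime p" "prime q" "p \<noteq> q" "card (carrier G) = q * card M"
    "p_elem G q s" "s \<notin> M" "R \<lhd> G" "R \<subseteq> M" "\<not> R \<subseteq> Z" "\<And>x. x \<in> R \<Longrightarrow> p_elem G p x"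
    "\<And>x H. x \<in> R \<Longrightarrow> x \<in> H \<Longrightarrow> H \<subseteq> M \<Longrightarrow> IC_Phi_subgroup H G \<Longrightarrow> x \<in> Z"
proof -
  obtain q where q: "prime q" "card (carrier G) = q * card M" "\<forall>x\<in>carrier G. x [^] q \<in> M"
    using normal_maximal_index[OF maxM normM] by blast
  obtain s where s: "p_elem G q s" "s \<notin> M" using outside_elem[OF q(1,2)] by blast
  have sG: "s \<in> carrier G" using s by (simp add: p_elem_def)
  \<comment> \<open>If all elements of M of prime power order prime to q were central modulo Phi(M),
    G would be nilpotent.\<close>
  obtain p x0 where p: "prime p" "p \<noteq> q" and x0: "x0 \<in> M" "p_elem G p x0" "x0 \<notin> Z"
    using nilpotent_if_central[OF q] nn by blast
  obtain P n where P: "P \<lhd> G" "P \<subseteq> M" "card P = p ^ n" "\<forall>x. x \<in> P \<longleftrightarrow> x \<in> M \<and> p_elem G p x"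
    using normal_p_part[OF normM nilM p(1)] by blast
  have sP: "subgroup P G" using P normal_imp_subgroup by blast
  let ?S = "{K. K \<lhd> G \<and> K \<subseteq> P \<and> \<not> K \<subseteq> Z}"
  have "?S \<subseteq> Pow P" by blast
  then have "finite ?S" using finite_sub[OF sP] finite_subset by blast
  moreover have "P \<in> ?S" using P(1,4) x0 by blast
  ultimately obtain R where R: "R \<in> ?S" "\<And>K. K \<in> ?S \<Longrightarrow> K \<subseteq> R \<Longrightarrow> R = K"
    using finite_has_minimal2[of ?S P] by meson
  have R1: "R \<lhd> G" "R \<subseteq> P" "\<not> R \<subseteq> Z" using R(1) by blast+
  have sR: "subgroup R G" using R1 normal_imp_subgroup by blast
  have key: "x \<in> Z" if x: "x \<in> R" "x \<in> H" and H: "H \<subseteq> M" "IC_Phi_subgroup H G" for x H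
  proof (rule ccontr)
    assume xZ: "x \<notin> Z"
    have xP: "x \<in> P" and xM: "x \<in> M" and xG: "x \<in> carrier G"
      using x R1 P(2) M_carrier by blast+
    have sH: "subgroup H G" using H(2) by (simp add: IC_Phi_subgroup_def)
    let ?K = "commutator_subgroup G {x} (carrier G)"
    have KN: "?K \<lhd> G" using commutator_subgroup_normal[of "{x}"] xG by simp
    have KR: "?K \<subseteq> R"
    proof (rule commutator_subgroup_subsetI[OF sR])
      fix a g assume a: "a \<in> {x}" and g: "g \<in> carrier G"
      then show "commu a g \<in> R" using normal_commu(1)[OF R1(1) x(1)] by blast
    qed
    \<comment> \<open>Minimality of R speaks only about subgroups outside \<open>Z\<close>. If K
      were inside \<open>Z\<close>, then [x,s] in K and the coprime action of s would put x into
      \<open>Z\<close>.\<close>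
    have "\<not> ?K \<subseteq> Z"
    proof
      assume KZ: "?K \<subseteq> Z"
      have sK: "subgroup ?K G" using KN normal_imp_subgroup by blast
      have "card ?K dvd p ^ n" using card_sub_dvd[OF sK sP] KR R1(2) P(3) by auto
      then obtain k where "card ?K = p ^ k" using divides_primepow_nat[OF p(1)] by blast
      moreover have "?K \<subseteq> M" using KR R1(2) P(2) by blast
      moreover have "commu x s \<in> ?K" using commu_in_commutator_subgroup[of x "{x}" s] sG by blast
      ultimately have "x \<in> Z" using coprime_Z[OF q(1) p(1) p(2)[symmetric] s KN _ KZ _ xM] by blast
      then show False using xZ by blast
    qed
    then have "R = ?K" using R(2)[of ?K] KN KR R1(2) by blast
    then have "x \<in> commutator_subgroup G H (carrier G)"
      using x commutator_subgroup_mono[of "{x}" H "carrier G" "carrier G"] by blast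
    then have "x \<in> frattini (G\<lparr>carrier := H\<rparr>)" using x(2) H(2) unfolding IC_Phi_subgroup_def by blast
    moreover have "subgroup H (G\<lparr>carrier := M\<rparr>)" using sH H(1) by (simp add: subgroup_sub_iff[OF sM])
    then have "frattini (G\<lparr>carrier := H\<rparr>) \<subseteq> F" using M.nilpotent_frattini_mono[OF nilM] by simp
    ultimately show False using F_Z xZ by blast
  qed
  have "R \<subseteq> M" using R1(2) P(2) by blast
  moreover have "p_elem G p x" if "x \<in> R" for x using that R1(2) P(4) by blast
  ultimately show thesis by (rule that[OF p(1) q(1) p(2) q(2) s R1(1) _ R1(3) _ key])
qed

end

subsection \<open>Cyclic subgroups\<close>

lemma prod_two_primes:
  fixes a b p q :: nat
  assumes "prime p" "prime q" "a * b = p * q" "a \<ge> 2" "b \<ge> 2"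
  shows "prime a" "prime b"
proof -
  have *: "prime a \<and> prime b" if "prime p" "prime q" "a * b = p * q" "a \<ge> 2" "b \<ge> 2" "p dvd a" for a b p q :: nat
  proof -
    obtain c where c: "a = p * c" using \<open>p dvd a\<close> by blast
    then have cb: "c * b = q" using that(1,3) by (simp add: prime_gt_0_nat)
    then have "b dvd q" by auto
    then have "b = q" using that(2,5) by (metis One_nat_def Suc_1 not_less_eq_eq order_refl prime_nat_iff)
    then have "c = 1" using cb that(2) by (simp add: prime_gt_0_nat)
    then show ?thesis using c \<open>b = q\<close> that(1,2) by simp
  qed
  have "p dvd a * b" using assms(3) by simp
  then have "p dvd a \<or> p dvd b" using prime_dvd_multD[OF assms(1)] by blast
  then have "prime a \<and> prime b"
    using *[OF assms(1,2,3,4,5)] *[OF assms(1,2) _ assms(5,4)] assms(3) by (metis mult.commute)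
  then show "prime a" "prime b" by blast+
qed

text \<open>\<open>size (prime_factorization n)\<close> is the number of prime factors with
  multiplicity; it bounds the length of subgroup chains.\<close>

lemma size_prime_factorization_pos:
  fixes n :: nat
  assumes "n \<ge> 2"
  shows "size (prime_factorization n) \<ge> 1"
proof -
  have "prime_factorization n \<noteq> {#}" using assms by (simp add: prime_factorization_empty_iff)
  then show ?thesis by (simp add: Suc_leI nonempty_has_size)
qed

text \<open>G is an arbitrary structure here, so the conjunct on \<open>carrier G\<close> carries
  the condition at the top index of the chain.\<close>

lemma three_maximal_chain:
  "n_maximal_subgroup 3 H G \<longleftrightarrow> (\<exists>H1 M. subgroup (carrier G) G \<and> subgroup H G \<and> subgroup H1 G \<and> subgroup M G \<and>
    maximal_subgroup M G \<and> maximal_subgroup H1 (G\<lparr>carrier := M\<rparr>) \<and> maximal_subgroup H (G\<lparr>carrier := H1\<rparr>))"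
  (is "?L \<longleftrightarrow> ?R")
proof
  assume ?L
  then obtain C where C: "C 0 = H" "C 3 = carrier G" "\<forall>i\<le>3. subgroup (C i) G"
    "\<forall>i<3. maximal_subgroup (C i) (G\<lparr>carrier := C (Suc i)\<rparr>)"
    unfolding n_maximal_subgroup_def by blast
  have "maximal_subgroup (C 2) (G\<lparr>carrier := C 3\<rparr>)" "maximal_subgroup (C 1) (G\<lparr>carrier := C 2\<rparr>)"
    "maximal_subgroup (C 0) (G\<lparr>carrier := C 1\<rparr>)"
    using C(4)[rule_format, of 2] C(4)[rule_format, of 1] C(4)[rule_format, of 0]
    by (simp_all add: numeral_2_eq_2 numeral_3_eq_3)
  moreover have "subgroup (C 0) G" "subgroup (C 1) G" "subgroup (C 2) G" "subgroup (C 3) G"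
    using C(3) by simp_all
  ultimately show ?R using C(1,2) by (intro exI[of _ "C 1"] exI[of _ "C 2"]) simp
next
  assume ?R
  then obtain H1 M where *: "subgroup (carrier G) G" "subgroup H G" "subgroup H1 G" "subgroup M G"
    "maximal_subgroup M G" "maximal_subgroup H1 (G\<lparr>carrier := M\<rparr>)" "maximal_subgroup H (G\<lparr>carrier := H1\<rparr>)"
    by blast
  let ?C = "\<lambda>i::nat. if i = 0 then H else if i = 1 then H1 else if i = 2 then M else carrier G"
  have "\<forall>i\<le>3. subgroup (?C i) G" using *(1-4) by simp
  moreover have "maximal_subgroup (?C i) (G\<lparr>carrier := ?C (Suc i)\<rparr>)" if "i < 3" for i
  proof -
    from that consider "i = 0" | "i = 1" | "i = 2" by linarith
    then show ?thesis using *(5-7) by cases simp_all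
  qed
  ultimately show ?L unfolding n_maximal_subgroup_def by (intro exI[of _ ?C]) simp
qed

context fgroup
begin

lemma prime_index_maximal:
  assumes H: "subgroup H G" and K: "subgroup K G" and HK: "H \<subseteq> K" and card: "card K = p * card H" and p: "prime p"
  shows "maximal_subgroup H (G\<lparr>carrier := K\<rparr>)"
  unfolding maximal_subgroup_iff[OF K]
proof (intro conjI allI impI)
  show "subgroup H G" by fact
  have "card H > 0" using card_sub_pos[OF H] .
  then have "card H < card K" unfolding card using prime_gt_1_nat[OF p] by simp
  then show "H \<subset> K" using HK by blast
  fix L assume L: "subgroup L G \<and> H \<subseteq> L \<and> L \<subseteq> K"
  obtain i where i: "card L = card H * i" using card_sub_dvd[OF H _, of L] L by blast
  have "card L dvd card K" using card_sub_dvd[OF _ K, of L] L by blast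
  then have "i dvd p" unfolding card i using \<open>card H > 0\<close> by (simp add: mult.commute)
  then have "i = 1 \<or> i = p" using p by (simp add: prime_nat_iff)
  then show "L = H \<or> L = K"
  proof
    assume "i = 1"
    then have "card H = card L" using i by simp
    then have "H = L" using card_subset_eq_sub[of L H] L by blast
    then show ?thesis by blast
  next
    assume "i = p"
    then have "card L = card K" using i card by simp
    then show ?thesis using card_subset_eq_sub[OF K, of L] L by blast
  qed
qed

lemma p_elem_ord:
  assumes p: "prime p" and x: "p_elem G p x"
  obtains a where "ord x = p ^ a" "card (generate G {x}) = p ^ a"
  using p_elem_generate_card[OF p x] generate_pow_card[of x] x by (auto simp: p_elem_def)

lemma p_elem_pow:
  assumes x: "p_elem G p x"
  shows "p_elem G p (x [^] (n::nat))"
proof -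
  obtain k where k: "x \<in> carrier G" "x [^] (p ^ k) = \<one>" using x by (auto simp: p_elem_def)
  have "(x [^] n) [^] (p ^ k) = (x [^] (p ^ k)) [^] n" using k(1) by (simp add: nat_pow_pow mult.commute)
  then show ?thesis using k by (auto simp: p_elem_def)
qed

lemma ord_pow_prime:
  assumes p: "prime p" and x: "x \<in> carrier G" "ord x = p ^ Suc a"
  shows "ord (x [^] p) = p ^ a"
  using ord_pow_gen[OF x(1), of p] x(2) p by (simp add: prime_gt_0_nat)

lemma maximal_p_pow:
  assumes p: "prime p" and x: "p_elem G p x" "x \<noteq> \<one>"
  shows "maximal_subgroup (generate G {x [^] p}) (G\<lparr>carrier := generate G {x}\<rparr>)"
proof -
  have xG: "x \<in> carrier G" using x(1) by (simp add: p_elem_def)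
  have xp: "x [^] p \<in> carrier G" using xG by simp
  obtain a where a: "ord x = p ^ a" "card (generate G {x}) = p ^ a" using p_elem_ord[OF p x(1)] by blast
  have "a \<noteq> 0" using a(1) x(2) ord_eq_1[OF xG] by (intro notI) simp
  then obtain b where b: "a = Suc b" using not0_implies_Suc by blast
  have "card (generate G {x [^] p}) = p ^ b"
    using generate_pow_card[OF xp] ord_pow_prime[OF p xG] a(1) b by simp
  then have "card (generate G {x}) = p * card (generate G {x [^] p})" using a(2) b by simp
  moreover have "generate G {x [^] p} \<subseteq> generate G {x}"
    using generate_subgroup_incl[OF _ generate_singleton(1)[OF xG]] subgroup_nat_pow[OF generate_singleton[OF xG]] by blast
  ultimately show ?thesis
    using prime_index_maximal[OF generate_singleton(1)[OF xp] generate_singleton(1)[OF xG] _ _ p] by blast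
qed

lemma conj_int_pow:
  assumes "g \<in> carrier G" "x \<in> carrier G"
  shows "g \<otimes> x [^] (n::int) \<otimes> inv g = (g \<otimes> x \<otimes> inv g) [^] n"
proof -
  have "(\<lambda>y. g \<otimes> y \<otimes> inv g) \<in> hom G G"
    by (rule homI) (use assms(1) in \<open>simp_all add: word_simps\<close>)
  then show ?thesis using hom_int_pow[OF _ assms(2) is_group is_group, of "\<lambda>y. g \<otimes> y \<otimes> inv g" n] by simp
qed

lemma prime_order_cyclic:
  assumes N: "subgroup N G" and card: "prime (card N)"
  shows "\<exists>x\<in>N. N = generate G {x}"
proof -
  have "N \<noteq> {\<one>}" using card by auto
  then obtain x where x: "x \<in> N" "x \<noteq> \<one>" using subgroup.one_closed[OF N] by blast
  have xG: "x \<in> carrier G" using subgroup.mem_carrier[OF N x(1)] .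
  have sub: "generate G {x} \<subseteq> N" using generate_subgroup_incl[OF _ N] x(1) by blast
  have "card (generate G {x}) dvd card N" using card_sub_dvd[OF generate_singleton(1)[OF xG] N sub] .
  moreover have "card (generate G {x}) \<noteq> 1"
    using subgroup_card_1[OF generate_singleton(1)[OF xG]] generate_singleton(2)[OF xG] x(2) by blast
  ultimately have "card (generate G {x}) = card N" using card by (metis prime_nat_iff)
  then have "generate G {x} = N" using card_subset_eq_sub[OF N sub] by blast
  then show ?thesis using x(1) by blast
qed

text \<open>Conjugation acts on a cyclic normal subgroup through an abelian group of power maps.\<close>

lemma perfect_cyclic_normal_central:
  assumes perf: "no_normal_maximal G" and x: "x \<in> carrier G" and N: "generate G {x} \<lhd> G" and g: "g \<in> carrier G"
  shows "x \<otimes> g = g \<otimes> x"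
proof -
  have pow: "\<exists>a::int. \<forall>n::int. h \<otimes> x [^] n \<otimes> inv h = x [^] (a * n)" if h: "h \<in> carrier G" for h
  proof -
    have "h \<otimes> x \<otimes> inv h \<in> generate G {x}" using normal_closed[OF N h generate_singleton(2)[OF x]] .
    then obtain a :: int where "h \<otimes> x \<otimes> inv h = x [^] a" unfolding generate_pow[OF x] by blast
    then show ?thesis using conj_int_pow[OF h x] x by (auto simp: int_pow_pow)
  qed
  have one: "{\<one>} \<lhd> G" by (rule one_is_normal)
  have "{h \<in> carrier G. commu x h \<in> {\<one>}} = carrier G" (is "?C = _")
  proof (rule perfect_commu_subgroup[OF perf commutes_mod_subgroup[OF one x]])
    fix h k assume h: "h \<in> carrier G" and k: "k \<in> carrier G"
    obtain a :: int where a: "\<And>n::int. h \<otimes> x [^] n \<otimes> inv h = x [^] (a * n)" using pow[OF h] by blast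
    obtain b :: int where b: "\<And>n::int. k \<otimes> x [^] n \<otimes> inv k = x [^] (b * n)" using pow[OF k] by blast
    \<comment> \<open>Write [h,k] = (hk)(kh)^-1. It fixes x once hk and kh act alike on y, the
      conjugate of x by (kh)^-1; they do, because exponents multiply commutatively.\<close>
    have ihk: "inv (k \<otimes> h) \<in> carrier G" using h k by simp
    obtain c :: int where c: "\<And>n::int. inv (k \<otimes> h) \<otimes> x [^] n \<otimes> inv (inv (k \<otimes> h)) = x [^] (c * n)"
      using pow[OF ihk] by blast
    let ?y = "x [^] c"
    have y: "?y \<in> carrier G" using x by simp
    have yeq: "inv (k \<otimes> h) \<otimes> x \<otimes> (k \<otimes> h) = ?y" using c[of 1] x h k by simp
    have hk: "(h \<otimes> k) \<otimes> ?y \<otimes> inv (h \<otimes> k) = x [^] (a * (b * c))"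
    proof -
      have "(h \<otimes> k) \<otimes> ?y \<otimes> inv (h \<otimes> k) = h \<otimes> (k \<otimes> ?y \<otimes> inv k) \<otimes> inv h"
        using h k y by (simp add: word_simps)
      then show ?thesis unfolding a b .
    qed
    have kh: "(k \<otimes> h) \<otimes> ?y \<otimes> inv (k \<otimes> h) = x [^] (b * (a * c))"
    proof -
      have "(k \<otimes> h) \<otimes> ?y \<otimes> inv (k \<otimes> h) = k \<otimes> (h \<otimes> ?y \<otimes> inv h) \<otimes> inv k"
        using h k y by (simp add: word_simps)
      then show ?thesis unfolding a b .
    qed
    have "commu h k \<otimes> x \<otimes> inv (commu h k) = (h \<otimes> k) \<otimes> (inv (k \<otimes> h) \<otimes> x \<otimes> (k \<otimes> h)) \<otimes> inv (h \<otimes> k)"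
      using h k x by (simp add: word_simps)
    also have "\<dots> = (k \<otimes> h) \<otimes> ?y \<otimes> inv (k \<otimes> h)" unfolding yeq hk kh by (simp add: mult.left_commute)
    also have "\<dots> = x" unfolding yeq[symmetric] using h k x by (simp add: word_simps)
    finally have e: "commu h k \<otimes> x \<otimes> inv (commu h k) = x" .
    define d where "d = commu h k"
    have dG: "d \<in> carrier G" using h k by (simp add: d_def)
    have "d \<otimes> x = x \<otimes> d" using e dG x unfolding d_def[symmetric] by (metis inv_closed inv_solve_right' m_closed)
    then have "commu x d = \<one>" using commu_one_iff[OF x dG] by simp
    then show "commu h k \<in> ?C" using dG unfolding d_def by blast
  qed
  then have "commu x g = \<one>" using g by blast
  then show ?thesis using commu_one_iff[OF x g] by blast
qed

end

context nilpotent_maximal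
begin

lemma pow_in_F:
  assumes "prime p" "x \<in> M" "p_elem G p x"
  shows "x [^] p \<in> F"
  using M.nilpotent_p_elem_pow_frattini[OF nilM assms(1), of x] assms(2,3)
  by (simp add: p_elem_sub[OF sM] nat_pow_consistent[symmetric])

text \<open>Let g x g^-1 = x^k and let h be the given power of x. Then [h,g] = h^(1-k) lies in
  Phi(<h>), hence in <h^p>. As h is not 1, p divides 1 - k, so that [x,g] = x^(1-k) is a power of
  x^p and lies in Phi(M). A single non-trivial power subgroup thus decides about x.\<close>

lemma cyclic_normal_central:
  assumes p: "prime p" and x: "x \<in> M" "p_elem G p x" and N: "generate G {x} \<lhd> G"
    and h: "x [^] (p ^ i) \<noteq> \<one>" and IC: "IC_Phi_subgroup (generate G {x [^] (p ^ i)}) G"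
  shows "x \<in> Z"
proof -
  have xG: "x \<in> carrier G" using M_carrier[OF x(1)] .
  let ?h = "x [^] (p ^ i)"
  have hG: "?h \<in> carrier G" using xG by simp
  have hp: "?h [^] p \<in> carrier G" using hG by simp
  obtain a where a: "ord x = p ^ a" using p_elem_ord[OF p x(2)] by blast
  have "\<not> a \<le> i"
  proof
    assume "a \<le> i"
    then have "ord x dvd p ^ i" unfolding a by (rule le_imp_power_dvd)
    then show False using h pow_eq_id[OF xG] by blast
  qed
  \<comment> \<open>Exponents of x are only determined modulo its order; this divisibility lets them
    be compared modulo p^(i+1).\<close>
  then have pai: "p ^ Suc i dvd p ^ a" by (intro le_imp_power_dvd) simp
  have comm: "commu x g \<in> F" if g: "g \<in> carrier G" for g
  proof -
    have "g \<otimes> x \<otimes> inv g \<in> generate G {x}" using normal_closed[OF N g generate_singleton(2)[OF xG]] .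
    then obtain k :: int where k: "g \<otimes> x \<otimes> inv g = x [^] k" unfolding generate_pow[OF xG] by blast
    have cx: "commu x g = x [^] (1 - k)"
    proof -
      have "commu x g = x \<otimes> inv (g \<otimes> x \<otimes> inv g)" using xG g by (simp add: word_simps)
      also have "\<dots> = x [^] (1 - k)" unfolding k using int_pow_diff[OF xG, of 1 k] xG by simp
      finally show ?thesis .
    qed
    have hx: "?h = x [^] (int p ^ i)" using int_pow_int[of G x "p ^ i"] by simp
    have "g \<otimes> ?h \<otimes> inv g = x [^] (k * int p ^ i)"
      unfolding hx conj_int_pow[OF g xG] k using xG by (simp add: int_pow_pow)
    then have ch: "commu ?h g = x [^] (int p ^ i - k * int p ^ i)"
    proof -
      assume e: "g \<otimes> ?h \<otimes> inv g = x [^] (k * int p ^ i)"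
      have "commu ?h g = ?h \<otimes> inv (g \<otimes> ?h \<otimes> inv g)" using hG g by (simp add: word_simps)
      also have "\<dots> = x [^] (int p ^ i - k * int p ^ i)" unfolding e unfolding hx using int_pow_diff[OF xG] by simp
      finally show ?thesis .
    qed
    have hgen: "?h \<in> generate G {?h}" using generate_singleton(2)[OF hG] .
    have "commu ?h g \<in> generate G {?h}"
    proof -
      have "commu ?h g = ?h [^] (1 - k)"
        unfolding ch unfolding hx using xG by (simp add: int_pow_pow algebra_simps)
      then show ?thesis unfolding generate_pow[OF hG] by blast
    qed
    moreover have "commu ?h g \<in> commutator_subgroup G (generate G {?h}) (carrier G)"
      using commu_in_commutator_subgroup[OF hgen g] .
    ultimately have "commu ?h g \<in> frattini (G\<lparr>carrier := generate G {?h}\<rparr>)"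
      using IC unfolding IC_Phi_subgroup_def by blast
    moreover have "maximal_subgroup (generate G {?h [^] p}) (G\<lparr>carrier := generate G {?h}\<rparr>)"
      using maximal_p_pow[OF p p_elem_pow[OF x(2)] h] .
    ultimately have "commu ?h g \<in> generate G {?h [^] p}" unfolding frattini_def by blast
    then obtain j :: int where "commu ?h g = (?h [^] p) [^] j" unfolding generate_pow[OF hp] by blast
    also have "\<dots> = x [^] (int p ^ Suc i * j)"
    proof -
      have "?h [^] p = x [^] (int p ^ Suc i)" using int_pow_int[of G x "p ^ Suc i"] xG by (simp add: nat_pow_pow mult.commute)
      then show ?thesis using xG by (simp add: int_pow_pow)
    qed
    finally have "x [^] (int p ^ i - k * int p ^ i) = x [^] (int p ^ Suc i * j)" unfolding ch .
    then have "int (ord x) dvd (int p ^ i - k * int p ^ i) - int p ^ Suc i * j"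
      using int_pow_eq[OF xG] by (simp add: dvd_diff_commute)
    moreover have "int p ^ Suc i dvd int (ord x)" using pai unfolding a by (metis of_nat_dvd_iff of_nat_power)
    ultimately have "int p ^ Suc i dvd (int p ^ i - k * int p ^ i) - int p ^ Suc i * j" by (rule dvd_trans[rotated])
    then have "int p ^ Suc i dvd int p ^ i - k * int p ^ i"
      using dvd_diff_left_iff[of "int p ^ Suc i"] by (metis dvd_triv_left)
    then have "int p ^ i * int p dvd int p ^ i * (1 - k)" by (simp add: algebra_simps)
    then have "int p dvd 1 - k" using p by (simp add: prime_gt_0_nat)
    then obtain l where "1 - k = int p * l" by blast
    then have "commu x g = (x [^] p) [^] l" unfolding cx using xG int_pow_int[of G x p] by (metis int_pow_pow)
    then show ?thesis using subgroup_int_pow_closed[OF F_sub pow_in_F[OF p x]] by simp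
  qed
  then show ?thesis unfolding Z_def using xG by blast
qed

end

subsection \<open>Groups with many IC\<open>\<Phi>\<close>-subgroups\<close>

context fgroup
begin

lemma abelian_nilpotent:
  assumes "\<And>x y. x \<in> carrier G \<Longrightarrow> y \<in> carrier G \<Longrightarrow> x \<otimes> y = y \<otimes> x"
  shows "nilpotent_group G"
  using commute_imp_nilpotent assms by (simp add: p_elem_def)

lemma trivial_nilpotent: "carrier G = {\<one>} \<Longrightarrow> nilpotent_group G"
  using abelian_nilpotent by simp

lemma nilpotent_maximal_exists:
  assumes nn: "\<not> nilpotent_group G" and nil: "\<And>M. maximal_subgroup M G \<Longrightarrow> nilpotent_group (G\<lparr>carrier := M\<rparr>)"
  shows "\<exists>M. nilpotent_maximal G M"
proof -
  have "carrier G \<noteq> {\<one>}" using nn trivial_nilpotent by blast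
  then obtain M where "maximal_subgroup M G" "M \<lhd> G"
    using maximal_nilpotent_imp_normal_maximal[OF _ nil] unfolding no_normal_maximal_def by blast
  then have "nilpotent_maximal G M"
    using nil by (intro nilpotent_maximal.intro fgroup_axioms nilpotent_maximal_axioms.intro)
  then show ?thesis by blast
qed

lemma maximal_IC_nilpotent:
  assumes IC: "\<And>M. maximal_subgroup M G \<Longrightarrow> IC_Phi_subgroup M G"
  shows "nilpotent_group G"
proof (rule ccontr)
  assume nn: "\<not> nilpotent_group G"
  obtain M where "nilpotent_maximal G M"
    using nilpotent_maximal_exists[OF nn IC_Phi_nilpotent[OF IC]] by blast
  then interpret nilpotent_maximal G M .
  obtain p q R s where R: "R \<subseteq> M" "\<not> R \<subseteq> Z"
    "\<And>x H. x \<in> R \<Longrightarrow> x \<in> H \<Longrightarrow> H \<subseteq> M \<Longrightarrow> IC_Phi_subgroup H G \<Longrightarrow> x \<in> Z"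
    using noncentral_section[OF nn] by metis
  then show False using IC[OF maxM] by blast
qed

lemma maximal_sub_carrier:
  assumes "maximal_subgroup M G"
  shows "subgroup M G" "M \<subset> carrier G"
  using assms subgroup.subset[of M G] by (auto simp: maximal_subgroup_def)

text \<open>A subgroup strictly between <x> and M, or <x> itself if proper in M, would yield an
  IC-subgroup containing x, so M = <x>. If x^p were not 1, the 2-maximal subgroup <x^p> would be IC
  and force x into \<open>Z\<close>; hence |M| = p.\<close>

lemma second_maximal_IC:
  assumes IC: "\<And>M H. maximal_subgroup M G \<Longrightarrow> maximal_subgroup H (G\<lparr>carrier := M\<rparr>) \<Longrightarrow> IC_Phi_subgroup H G"
  shows "nilpotent_group G \<or> (\<exists>M q. maximal_subgroup M G \<and> M \<lhd> G \<and> prime (card M) \<and> prime q \<and> card (carrier G) = q * card M)"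
proof (cases "nilpotent_group G")
  case True
  then show ?thesis ..
next
  assume nn: "\<not> nilpotent_group G"
  have nil: "nilpotent_group (G\<lparr>carrier := M\<rparr>)" if M: "maximal_subgroup M G" for M
  proof -
    have sM: "subgroup M G" using maximal_sub_carrier[OF M] by blast
    interpret M: fgroup "G\<lparr>carrier := M\<rparr>" using sub_fgroup[OF sM] .
    show ?thesis
    proof (rule M.maximal_IC_nilpotent)
      fix H assume H: "maximal_subgroup H (G\<lparr>carrier := M\<rparr>)"
      then have "H \<subseteq> M" unfolding maximal_subgroup_iff[OF sM] by blast
      then show "IC_Phi_subgroup H (G\<lparr>carrier := M\<rparr>)" using IC_Phi_subgroup_sub[OF IC[OF M H] sM] by blast
    qed
  qed
  obtain M where "nilpotent_maximal G M" using nilpotent_maximal_exists[OF nn nil] by blast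
  then interpret nilpotent_maximal G M .
  obtain p q R s where R: "prime p" "prime q" "card (carrier G) = q * card M" "R \<subseteq> M" "\<not> R \<subseteq> Z"
    "\<And>x. x \<in> R \<Longrightarrow> p_elem G p x"
    "\<And>x H. x \<in> R \<Longrightarrow> x \<in> H \<Longrightarrow> H \<subseteq> M \<Longrightarrow> IC_Phi_subgroup H G \<Longrightarrow> x \<in> Z"
    using noncentral_section[OF nn] by metis
  then obtain x where x: "x \<in> R" "x \<notin> Z" by blast
  have xM: "x \<in> M" and px: "p_elem G p x" using x(1) R(4,6) by blast+
  have xG: "x \<in> carrier G" using M_carrier[OF xM] .
  have sx: "subgroup (generate G {x}) G" "x \<in> generate G {x}" using generate_singleton[OF xG] by blast+
  have sub: "generate G {x} \<subseteq> M" using generate_subgroup_incl[OF _ sM] xM by blast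
  have eqM: "generate G {x} = M"
  proof (rule ccontr)
    assume ne: "generate G {x} \<noteq> M"
    have "subgroup (generate G {x}) (G\<lparr>carrier := M\<rparr>)" using sx(1) sub by (simp add: subgroup_sub_iff[OF sM])
    then obtain H where H: "maximal_subgroup H (G\<lparr>carrier := M\<rparr>)" "generate G {x} \<subseteq> H"
      using M.maximal_above[of "generate G {x}"] ne by auto
    have "H \<subseteq> M" using H(1) unfolding maximal_subgroup_iff[OF sM] by blast
    then have "x \<in> Z" using R(7)[OF x(1) _ _ IC[OF maxM H(1)]] H(2) sx(2) by blast
    then show False using x(2) by blast
  qed
  have x1: "x \<noteq> \<one>" using x(2) subgroup.one_closed[OF Z_sub] by blast
  have "x [^] p = \<one>"
  proof (rule ccontr)
    assume "x [^] p \<noteq> \<one>"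
    then have h: "x [^] (p ^ 1) \<noteq> \<one>" by simp
    have "maximal_subgroup (generate G {x [^] p}) (G\<lparr>carrier := M\<rparr>)"
      using maximal_p_pow[OF R(1) px x1] unfolding eqM .
    then have "IC_Phi_subgroup (generate G {x [^] (p ^ 1)}) G" using IC[OF maxM] by simp
    moreover have "generate G {x} \<lhd> G" using normM unfolding eqM .
    ultimately have "x \<in> Z" using cyclic_normal_central[OF R(1) xM px _ h] by blast
    then show False using x(2) by blast
  qed
  then have "ord x dvd p" using pow_eq_id[OF xG] by simp
  then have "ord x = p" using R(1) x1 ord_eq_1[OF xG] by (metis prime_nat_iff)
  then have "card M = p" using generate_pow_card[OF xG] eqM by simp
  then show ?thesis using maxM normM R(1-3) by metis
qed

text \<open>A group with a central maximal subgroup is abelian: the centralizer of an outside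
  element contains that subgroup and the element.\<close>

lemma central_prime_index_nilpotent:
  assumes N: "maximal_subgroup N G" and cen: "\<And>n g. n \<in> N \<Longrightarrow> g \<in> carrier G \<Longrightarrow> n \<otimes> g = g \<otimes> n"
  shows "nilpotent_group G"
proof (rule abelian_nilpotent)
  fix x y assume x: "x \<in> carrier G" and y: "y \<in> carrier G"
  have sN: "subgroup N G" using maximal_sub_carrier[OF N] by blast
  have NG: "n \<in> carrier G" if "n \<in> N" for n using subgroup.mem_carrier[OF sN that] .
  show "x \<otimes> y = y \<otimes> x"
  proof (cases "x \<in> N")
    case True
    then show ?thesis using cen y by blast
  next
    case False
    let ?C = "{g \<in> carrier G. commu x g \<in> {\<one>}}"
    have sC: "subgroup ?C G" using commutes_mod_subgroup[OF one_is_normal x] .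
    have "N \<subseteq> ?C"
    proof
      fix n assume n: "n \<in> N"
      have "commu x n = \<one>" using commu_one_iff[OF x NG[OF n]] cen[OF n x] by metis
      then show "n \<in> ?C" using NG[OF n] by simp
    qed
    moreover have "x \<in> ?C" using x commu_one_iff[OF x x] by simp
    ultimately have "?C = carrier G" using N sC False unfolding maximal_subgroup_def by blast
    then have "commu x y = \<one>" using y by blast
    then show ?thesis using commu_one_iff[OF x y] by blast
  qed
qed

text \<open>Otherwise G/N is a quotient of L by W = N \<inter> L. If W lies in Q, this quotient maps
  onto L/Q of prime order; if not, L = WQ and it is a quotient of the cyclic group Q. Either way G
  would have a non-trivial abelian quotient.\<close>

lemma perfect_normal_in_prime_pair:
  assumes perf: "no_normal_maximal G" and N: "N \<lhd> G" "N \<noteq> carrier G"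
    and L: "maximal_subgroup L G" and Q: "maximal_subgroup Q (G\<lparr>carrier := L\<rparr>)" "Q \<lhd> G\<lparr>carrier := L\<rparr>" "prime (card Q)"
  shows "N \<subseteq> L"
proof (rule ccontr)
  assume nNL: "\<not> N \<subseteq> L"
  have sL: "subgroup L G" using maximal_sub_carrier[OF L] by blast
  have sN: "subgroup N G" using N normal_imp_subgroup by blast
  have sQ: "subgroup Q G" "Q \<subset> L" using Q(1) unfolding maximal_subgroup_iff[OF sL] by blast+
  interpret L: fgroup "G\<lparr>carrier := L\<rparr>" using sub_fgroup[OF sL] .
  have NL: "N <#> L = carrier G" using maximal_set_mult[OF L N(1) nNL] .
  have W: "N \<inter> L \<lhd> G\<lparr>carrier := L\<rparr>" using normal_Int_subgroup[OF sL N(1)] .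
  have WL: "N \<inter> L \<noteq> L"
  proof
    assume "N \<inter> L = L"
    then have "L \<subseteq> N" by blast
    then have "N <#> L \<subseteq> N" using subgroup.m_closed[OF sN] unfolding set_mult_elem subset_iff by metis
    then show False using NL N(2) subgroup.subset[OF sN] by blast
  qed
  show False
  proof (cases "N \<inter> L \<subseteq> Q")
    case True
    have "commu x y \<in> Q" if "x \<in> L" "y \<in> L" for x y
      using L.normal_maximal_commu[OF Q(1,2), of x y] that m_inv_consistent[OF sL] by simp
    then show False using perfect_supplement[OF perf N(1) sL NL Q(2) _ True] sQ(2) by blast
  next
    case False
    obtain z where z: "z \<in> Q" "Q = generate G {z}" using prime_order_cyclic[OF sQ(1) Q(3)] by blast
    have zG: "z \<in> carrier G" using subgroup.mem_carrier[OF sQ(1) z(1)] .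
    have Qcomm: "commu a b \<in> N \<inter> L" if "a \<in> Q" "b \<in> Q" for a b
    proof -
      have "a \<in> generate G {z}" "b \<in> generate G {z}" using that z(2) by simp_all
      then obtain i j :: int where ij: "a = z [^] i" "b = z [^] j" unfolding generate_pow[OF zG] by blast
      have "a \<otimes> b = b \<otimes> a"
        unfolding ij using int_pow_mult[OF zG, of i j] int_pow_mult[OF zG, of j i] by (simp add: add.commute)
      then have "commu a b = \<one>" using commu_one_iff subgroup.mem_carrier[OF sQ(1)] that by blast
      then show ?thesis using subgroup.one_closed[OF sN] subgroup.one_closed[OF sL] by simp
    qed
    have prod: "(N \<inter> L) <#>\<^bsub>G\<lparr>carrier := L\<rparr>\<^esub> Q = L" using L.maximal_set_mult[OF Q(1) W False] by simp
    have "L.commu x y \<in> N \<inter> L" if xy: "x \<in> L" "y \<in> L" for x y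
    proof (rule L.commu_mod_supplement[OF W])
      show "subgroup Q (G\<lparr>carrier := L\<rparr>)" using Q(1) by (simp add: maximal_subgroup_def)
      show "\<exists>k\<in>N \<inter> L. \<exists>l\<in>Q. g = k \<otimes>\<^bsub>G\<lparr>carrier := L\<rparr>\<^esub> l" if "g \<in> carrier (G\<lparr>carrier := L\<rparr>)" for g
        using that prod L.set_mult_elem[of g "N \<inter> L" Q] by simp
      show "L.commu a b \<in> N \<inter> L" if ab: "a \<in> Q" "b \<in> Q" for a b
      proof -
        have "a \<in> L" "b \<in> L" using ab sQ(2) by blast+
        then show ?thesis using Qcomm[OF ab] m_inv_consistent[OF sL] by simp
      qed
    qed (use xy in simp_all)
    then have "commu x y \<in> N \<inter> L" if "x \<in> L" "y \<in> L" for x y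
      using that m_inv_consistent[OF sL] by simp
    then show False using perfect_supplement[OF perf N(1) sL NL W WL subset_refl] by blast
  qed
qed

end

section \<open>Non-nilpotent groups whose 3-maximal subgroups are IC\<close>

locale third_maximal_IC = fgroup +
  assumes IC: "\<And>H H1 M. maximal_subgroup M G \<Longrightarrow> maximal_subgroup H1 (G\<lparr>carrier := M\<rparr>) \<Longrightarrow>
      maximal_subgroup H (G\<lparr>carrier := H1\<rparr>) \<Longrightarrow> IC_Phi_subgroup H G"
    and nontrivial: "\<exists>H H1 M. maximal_subgroup M G \<and> maximal_subgroup H1 (G\<lparr>carrier := M\<rparr>) \<and>
      maximal_subgroup H (G\<lparr>carrier := H1\<rparr>) \<and> H \<noteq> {\<one>}"
    and nn: "\<not> nilpotent_group G"
begin

text \<open>The number 4 counts the three proper inclusions of the chain and one prime factor of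
  |H|.\<close>

lemma third_maximal:
  obtains H where "subgroup H G" "H \<noteq> {\<one>}" "H \<noteq> carrier G" "IC_Phi_subgroup H G"
    "size (prime_factorization (card (carrier G))) \<ge> 4"
proof -
  obtain H H1 M where *: "maximal_subgroup M G" "maximal_subgroup H1 (G\<lparr>carrier := M\<rparr>)"
    "maximal_subgroup H (G\<lparr>carrier := H1\<rparr>)" "H \<noteq> {\<one>}" using nontrivial by blast
  have M: "subgroup M G" "M \<subset> carrier G" using maximal_sub_carrier[OF *(1)] by blast+
  have H1: "subgroup H1 G" "H1 \<subset> M" using *(2) unfolding maximal_subgroup_iff[OF M(1)] by blast+
  have H: "subgroup H G" "H \<subset> H1" using *(3) unfolding maximal_subgroup_iff[OF H1(1)] by blast+
  obtain a where a: "a \<ge> 2" "card (carrier G) = a * card M" using card_sub_psubset[OF M(1) subgroup_self M(2)] by blast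
  obtain b where b: "b \<ge> 2" "card M = b * card H1" using card_sub_psubset[OF H1(1) M(1) H1(2)] by blast
  obtain c where c: "c \<ge> 2" "card H1 = c * card H" using card_sub_psubset[OF H(1) H1(1) H(2)] by blast
  have "card H \<noteq> 1" using subgroup_card_1[OF H(1)] *(4) by blast
  then have h: "card H \<ge> 2" using card_sub_pos[OF H(1)] by linarith
  have eq: "card (carrier G) = a * (b * (c * card H))" using a b c by simp
  have "size (prime_factorization (card (carrier G))) =
     size (prime_factorization a) + (size (prime_factorization b) + (size (prime_factorization c) + size (prime_factorization (card H))))"
    unfolding eq using a(1) b(1) c(1) h by (simp add: prime_factorization_mult)
  then have "size (prime_factorization (card (carrier G))) \<ge> 4"
    using size_prime_factorization_pos[OF a(1)] size_prime_factorization_pos[OF b(1)]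
      size_prime_factorization_pos[OF c(1)] size_prime_factorization_pos[OF h] by linarith
  moreover have "H \<noteq> carrier G" using H(2) H1(2) M(2) by blast
  ultimately show thesis using that[OF H(1) *(4) _ IC[OF *(1-3)]] by blast
qed

text \<open>Turns the bound on prime factors into a lower bound for the exponent of a prime power
  dividing |G|, and so into non-trivial powers of a p-element.\<close>

lemma prime_power_index_card:
  assumes "card (carrier G) = n * p ^ a" "prime p" "n > 0" "size (prime_factorization n) \<le> k"
  shows "k + a \<ge> 4"
proof -
  have "size (prime_factorization (card (carrier G))) = size (prime_factorization n) + a"
    unfolding assms(1) using assms(2,3) by (simp add: prime_factorization_mult prime_factorization_prime_power)
  then show ?thesis using third_maximal assms(4) by (metis add.commute add_le_cancel_left le_trans)
qed

lemma maximal_nilpotent_or_prime_pair: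
  assumes L: "maximal_subgroup L G" "\<not> nilpotent_group (G\<lparr>carrier := L\<rparr>)"
  obtains Q q where "maximal_subgroup Q (G\<lparr>carrier := L\<rparr>)" "Q \<lhd> G\<lparr>carrier := L\<rparr>"
    "prime (card Q)" "prime q" "card L = q * card Q"
proof -
  have sL: "subgroup L G" using maximal_sub_carrier[OF L(1)] by blast
  interpret L: fgroup "G\<lparr>carrier := L\<rparr>" using sub_fgroup[OF sL] .
  have "IC_Phi_subgroup H (G\<lparr>carrier := L\<rparr>)"
    if H: "maximal_subgroup M (G\<lparr>carrier := L\<rparr>)" "maximal_subgroup H (G\<lparr>carrier := L, carrier := M\<rparr>)" for H M
  proof -
    have M: "subgroup M G" "M \<subset> L" using H(1) unfolding maximal_subgroup_iff[OF sL] by blast+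
    have H': "maximal_subgroup H (G\<lparr>carrier := M\<rparr>)" using H(2) by simp
    then have "H \<subseteq> L" using M(2) unfolding maximal_subgroup_iff[OF M(1)] by blast
    then show ?thesis using IC_Phi_subgroup_sub[OF IC[OF L(1) H(1) H'] sL] by blast
  qed
  from L.second_maximal_IC[OF this] L(2)
  have "\<exists>Q q. maximal_subgroup Q (G\<lparr>carrier := L\<rparr>) \<and> Q \<lhd> G\<lparr>carrier := L\<rparr> \<and> prime (card Q) \<and> prime q \<and> card L = q * card Q"
    by simp
  then obtain Q q where "maximal_subgroup Q (G\<lparr>carrier := L\<rparr>)" "Q \<lhd> G\<lparr>carrier := L\<rparr>"
    "prime (card Q)" "prime q" "card L = q * card Q" by metis
  then show thesis by (rule that)
qed

lemma not_perfect: "\<not> no_normal_maximal G"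
proof
  assume perf: "no_normal_maximal G"
  have nt: "carrier G \<noteq> {\<one>}" using nn trivial_nilpotent by blast
  obtain L where L: "maximal_subgroup L G" "\<not> nilpotent_group (G\<lparr>carrier := L\<rparr>)"
    using maximal_nilpotent_imp_normal_maximal[OF nt] perf by blast
  obtain Q q where Q: "maximal_subgroup Q (G\<lparr>carrier := L\<rparr>)" "Q \<lhd> G\<lparr>carrier := L\<rparr>"
    "prime (card Q)" "prime q" "card L = q * card Q"
    using maximal_nilpotent_or_prime_pair[OF L] by blast
  have sL: "subgroup L G" using maximal_sub_carrier[OF L(1)] by blast
  interpret L: fgroup "G\<lparr>carrier := L\<rparr>" using sub_fgroup[OF sL] .
  \<comment> \<open>N lies in L, whose order is a product of two primes, so a non-trivial N has
    prime order. It is cyclic and normal, hence central in the perfect group G, and of prime index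
    in L; then L would be abelian.\<close>
  have simple: "N = {\<one>}" if N: "N \<lhd> G" "N \<noteq> carrier G" for N
  proof (rule ccontr)
    assume N1: "N \<noteq> {\<one>}"
    have sN: "subgroup N G" using N normal_imp_subgroup by blast
    have NL: "N \<subseteq> L" using perfect_normal_in_prime_pair[OF perf N L(1) Q(1-3)] .
    have "N \<noteq> L" using N(1) L(1) perf unfolding no_normal_maximal_def by blast
    then have "N \<subset> L" using NL by blast
    then obtain i where i: "i \<ge> 2" "card L = i * card N" using card_sub_psubset[OF sN sL] by blast
    have "card N \<noteq> 1" using subgroup_card_1[OF sN] N1 by blast
    then have "card N \<ge> 2" using card_sub_pos[OF sN] by linarith
    then have pr: "prime i" "prime (card N)"
      using prod_two_primes[OF Q(4,3) _ i(1)] i(2) Q(5) by metis+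
    obtain n where n: "n \<in> N" "N = generate G {n}" using prime_order_cyclic[OF sN pr(2)] by blast
    have nG: "n \<in> carrier G" using subgroup.mem_carrier[OF sN n(1)] .
    have cen: "n \<otimes> g = g \<otimes> n" if g: "g \<in> carrier G" for g
      using perfect_cyclic_normal_central[OF perf nG _ g] N(1) n(2) by simp
    have cenN: "m \<otimes> g = g \<otimes> m" if m: "m \<in> N" and g: "g \<in> carrier G" for m g
    proof -
      have mG: "m \<in> carrier G" using subgroup.mem_carrier[OF sN m] .
      let ?C = "{h \<in> carrier G. commu g h \<in> {\<one>}}"
      have sC: "subgroup ?C G" using commutes_mod_subgroup[OF one_is_normal g] .
      have "commu g n = \<one>" using commu_one_iff[OF g nG] cen[OF g] by simp
      then have "n \<in> ?C" using nG by simp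
      then have "N \<subseteq> ?C" unfolding n(2) using generate_subgroup_incl[OF _ sC] by blast
      then have "commu g m = \<one>" using m by blast
      then show ?thesis using commu_one_iff[OF g mG] by simp
    qed
    have "maximal_subgroup N (G\<lparr>carrier := L\<rparr>)" using prime_index_maximal[OF sN sL NL i(2) pr(1)] .
    then have "nilpotent_group (G\<lparr>carrier := L\<rparr>)"
    proof (rule L.central_prime_index_nilpotent)
      fix m g assume "m \<in> N" "g \<in> carrier (G\<lparr>carrier := L\<rparr>)"
      then have "m \<otimes> g = g \<otimes> m" using cenN subgroup.mem_carrier[OF sL, of g] by simp
      then show "m \<otimes>\<^bsub>G\<lparr>carrier := L\<rparr>\<^esub> g = g \<otimes>\<^bsub>G\<lparr>carrier := L\<rparr>\<^esub> m"
        by simp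
    qed
    then show False using L(2) by blast
  qed
  obtain H where H: "subgroup H G" "H \<noteq> {\<one>}" "H \<noteq> carrier G" "IC_Phi_subgroup H G"
    using third_maximal by blast
  have HG: "H \<subseteq> carrier G" using subgroup.subset[OF H(1)] .
  let ?C = "commutator_subgroup G H (carrier G)"
  have CN: "?C \<lhd> G" using commutator_subgroup_normal[OF HG] .
  show False
  proof (cases "?C = carrier G")
    case True
    then have "H \<subseteq> frattini (G\<lparr>carrier := H\<rparr>)" using H(4) HG unfolding IC_Phi_subgroup_def by blast
    then have "frattini (G\<lparr>carrier := H\<rparr>) = H" using frattini_sub_subset by blast
    moreover interpret H: fgroup "G\<lparr>carrier := H\<rparr>" using sub_fgroup[OF H(1)] .
    have "frattini (G\<lparr>carrier := H\<rparr>) \<noteq> H" using H.frattini_proper H(2) by simp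
    ultimately show False by blast
  next
    case False
    then have C1: "?C = {\<one>}" using simple[OF CN] by blast
    have "H \<lhd> G"
    proof (rule normal_commuI[OF H(1)])
      fix x g assume "x \<in> H" "g \<in> carrier G"
      then have "commu x g \<in> ?C" using commu_in_commutator_subgroup by blast
      then show "commu x g \<in> H" using C1 subgroup.one_closed[OF H(1)] by simp
    qed
    then show False using simple H(2,3) by blast
  qed
qed

text \<open>A normal maximal subgroup that is not nilpotent has order a product of two primes, which
  leaves only three prime factors for |G| where four are needed.\<close>

lemma normal_nilpotent_maximal: "\<exists>M. nilpotent_maximal G M"
proof -
  obtain M where M: "maximal_subgroup M G" "M \<lhd> G" using not_perfect unfolding no_normal_maximal_def by blast
  have "nilpotent_group (G\<lparr>carrier := M\<rparr>)"
  proof (rule ccontr)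
    assume nM: "\<not> nilpotent_group (G\<lparr>carrier := M\<rparr>)"
    obtain Q q where "maximal_subgroup Q (G\<lparr>carrier := M\<rparr>)" "Q \<lhd> G\<lparr>carrier := M\<rparr>"
      and Q: "prime (card Q)" "prime q" "card M = q * card Q"
      by (rule maximal_nilpotent_or_prime_pair[OF M(1) nM])
    obtain r where r: "prime r" "card (carrier G) = r * card M" using normal_maximal_index[OF M] by blast
    have "card (carrier G) = (r * q) * card Q ^ 1" using r Q by simp
    moreover have "size (prime_factorization (r * q)) \<le> 2"
      using r(1) Q(2) by (simp add: prime_factorization_mult prime_factorization_prime prime_gt_0_nat)
    moreover have "r * q > 0" using r(1) Q(2) by (simp add: prime_gt_0_nat)
    ultimately have "2 + 1 \<ge> (4::nat)" using prime_power_index_card[OF _ Q(1)] by blast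
    then show False by simp
  qed
  then have "nilpotent_maximal G M"
    using M by (intro nilpotent_maximal.intro fgroup_axioms nilpotent_maximal_axioms.intro)
  then show ?thesis by blast
qed

text \<open>Ruled out in turn are <x> = M, <x> not maximal in M, and <x> normal in G. The minimal
  normal section R contains the maximal but non-normal <x>, so R = M and M is a p-group.\<close>

theorem cyclic_maximal_structure:
  obtains M p q s n where "nilpotent_maximal G M" "prime p" "prime q" "p \<noteq> q"
    "card (carrier G) = q * card M" "card M = p ^ Suc n" "n \<ge> 2" "p_elem G q s" "s \<notin> M"
    "\<not> M \<subseteq> nilpotent_maximal.Z G M"
    "\<And>x. x \<in> M \<Longrightarrow> x \<notin> nilpotent_maximal.Z G M \<Longrightarrow>
       maximal_subgroup (generate G {x}) (G\<lparr>carrier := M\<rparr>) \<and> \<not> generate G {x} \<lhd> G \<and> card (generate G {x}) = p ^ n"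
proof -
  obtain M where M: "nilpotent_maximal G M" using normal_nilpotent_maximal by blast
  then interpret nilpotent_maximal G M .
  obtain p q R s where R: "prime p" "prime q" "p \<noteq> q" "card (carrier G) = q * card M"
    "p_elem G q s" "s \<notin> M" "R \<lhd> G" "R \<subseteq> M" "\<not> R \<subseteq> Z" "\<And>x. x \<in> R \<Longrightarrow> p_elem G p x"
    "\<And>x H. x \<in> R \<Longrightarrow> x \<in> H \<Longrightarrow> H \<subseteq> M \<Longrightarrow> IC_Phi_subgroup H G \<Longrightarrow> x \<in> Z"
    using noncentral_section[OF nn] by metis
  have sR: "subgroup R G" using R(7) normal_imp_subgroup by blast
  have q1: "size (prime_factorization q) \<le> 1" "q > 0" using R(2) by (simp_all add: prime_factorization_prime prime_gt_0_nat)
  have main: "maximal_subgroup (generate G {x}) (G\<lparr>carrier := M\<rparr>) \<and> \<not> generate G {x} \<lhd> G \<and>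
      card M = p * card (generate G {x}) \<and> R = M" if x: "x \<in> R" "x \<notin> Z" for x
  proof -
    have xM: "x \<in> M" and px: "p_elem G p x" using x(1) R(8,10) by blast+
    have xG: "x \<in> carrier G" using M_carrier[OF xM] .
    let ?X = "generate G {x}"
    have sx: "subgroup ?X G" "x \<in> ?X" using generate_singleton[OF xG] by blast+
    have sub: "?X \<subseteq> M" using generate_subgroup_incl[OF _ sM] xM by blast
    have x1: "x \<noteq> \<one>" using x(2) subgroup.one_closed[OF Z_sub] by blast
    obtain a where a: "ord x = p ^ a" "card ?X = p ^ a" using p_elem_ord[OF R(1) px] by blast
    have xpow: "x [^] (p ^ i) \<noteq> \<one>" if "i < a" for i
    proof
      assume "x [^] (p ^ i) = \<one>"
      then have "p ^ a dvd p ^ i" using pow_eq_id[OF xG] a(1) by metis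
      then have "a \<le> i" using R(1) power_dvd_imp_le prime_gt_1_nat by blast
      then show False using that by simp
    qed
    have maxp: "maximal_subgroup (generate G {x [^] p}) (G\<lparr>carrier := ?X\<rparr>)" using maximal_p_pow[OF R(1) px x1] .
    have "?X \<noteq> M"
    proof
      assume eqM: "?X = M"
      \<comment> \<open>The order of G is q p^a, so a is at least 3, and <x^(p^2)> is a non-trivial
        3-maximal subgroup.\<close>
      have "1 + a \<ge> 4" using prime_power_index_card[OF _ R(1) q1(2,1), of a] R(4) a(2) eqM by simp
      then have h1: "x [^] (p ^ 1) \<noteq> \<one>" and h2: "x [^] (p ^ 2) \<noteq> \<one>" using xpow[of 1] xpow[of 2] by simp_all
      have "maximal_subgroup (generate G {(x [^] p) [^] p}) (G\<lparr>carrier := generate G {x [^] p}\<rparr>)"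
        using maximal_p_pow[OF R(1) p_elem_pow[OF px], of p] h1 by simp
      then have "IC_Phi_subgroup (generate G {x [^] (p ^ 2)}) G"
        using IC[OF maxM maxp[unfolded eqM]] xG by (simp add: nat_pow_pow power2_eq_square)
      moreover have "?X \<lhd> G" using normM unfolding eqM .
      ultimately have "x \<in> Z" using cyclic_normal_central[OF R(1) xM px _ h2] by blast
      then show False using x(2) by blast
    qed
    moreover have "subgroup ?X (G\<lparr>carrier := M\<rparr>)" using sx(1) sub by (simp add: subgroup_sub_iff[OF sM])
    ultimately obtain Y where Y: "maximal_subgroup Y (G\<lparr>carrier := M\<rparr>)" "?X \<subseteq> Y"
      using M.maximal_above[of ?X] by auto
    have Y': "subgroup Y G" "Y \<subset> M" using Y(1) unfolding maximal_subgroup_iff[OF sM] by blast+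
    interpret Y: fgroup "G\<lparr>carrier := Y\<rparr>" using sub_fgroup[OF Y'(1)] .
    have eqY: "?X = Y"
    proof (rule ccontr)
      assume ne: "?X \<noteq> Y"
      have "subgroup ?X (G\<lparr>carrier := Y\<rparr>)" using sx(1) Y(2) by (simp add: subgroup_sub_iff[OF Y'(1)])
      then obtain H where H: "maximal_subgroup H (G\<lparr>carrier := Y\<rparr>)" "?X \<subseteq> H"
        using Y.maximal_above[of ?X] ne by auto
      have "H \<subseteq> M" using H(1) Y'(2) unfolding maximal_subgroup_iff[OF Y'(1)] by blast
      then have "x \<in> Z" using R(11)[OF x(1) _ _ IC[OF maxM Y(1) H(1)]] H(2) sx(2) by blast
      then show False using x(2) by blast
    qed
    have maxX: "maximal_subgroup ?X (G\<lparr>carrier := M\<rparr>)" using Y(1) eqY by simp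
    have XN: "?X \<lhd> G\<lparr>carrier := M\<rparr>" using M.nilpotent_maximal_normal[OF nilM maxX] .
    obtain k where k: "prime k" "card M = k * card ?X" using M.normal_maximal_index[OF maxX XN] by auto
    have nX: "\<not> ?X \<lhd> G"
    proof
      assume XG: "?X \<lhd> G"
      have "card (carrier G) = (q * k) * p ^ a" using R(4) k(2) a(2) by simp
      moreover have "size (prime_factorization (q * k)) \<le> 2"
        using R(2) k(1) by (simp add: prime_factorization_mult prime_factorization_prime prime_gt_0_nat)
      moreover have "q * k > 0" using R(2) k(1) by (simp add: prime_gt_0_nat)
      \<comment> \<open>With <x> maximal in M one level is already used: a is at least 2, and <x^p>
        is the non-trivial 3-maximal subgroup.\<close>
      ultimately have "2 + a \<ge> 4" using prime_power_index_card[OF _ R(1)] by blast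
      then have h: "x [^] (p ^ 1) \<noteq> \<one>" using xpow[of 1] by simp
      have "IC_Phi_subgroup (generate G {x [^] (p ^ 1)}) G" using IC[OF maxM maxX maxp] by simp
      then have "x \<in> Z" using cyclic_normal_central[OF R(1) xM px XG h] by blast
      then show False using x(2) by blast
    qed
    \<comment> \<open>For k different from p, <x> would have the full p-part of |M| as its order and
      equal the p-part P, which is normal in G.\<close>
    have "k = p"
    proof (rule ccontr)
      assume kp: "k \<noteq> p"
      obtain P m where P: "P \<lhd> G" "sylow_subgroup (G\<lparr>carrier := M\<rparr>) p P" "\<forall>x. x \<in> P \<longleftrightarrow> x \<in> M \<and> p_elem G p x"
        using normal_p_part[OF normM nilM R(1)] by blast
      have sP: "subgroup P G" using P(1) normal_imp_subgroup by blast
      have "x \<in> P" using P(3) xM px by blast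
      then have XP: "?X \<subseteq> P" using generate_subgroup_incl[OF _ sP] by blast
      have "multiplicity p (k * p ^ a) = multiplicity p k + multiplicity p (p ^ a)"
        using R(1) k(1) by (intro prime_elem_multiplicity_mult_distrib) (auto simp: prime_gt_0_nat)
      also have "multiplicity p k = 0" using primes_dvd_imp_eq[OF R(1) k(1)] kp by (intro not_dvd_imp_multiplicity_0) metis
      finally have "multiplicity p (card M) = a" using k(2) a(2) R(1) by (simp add: multiplicity_prime_power)
      then have "card P = card ?X" using P(2) a(2) by (simp add: sylow_subgroup_def)
      then have "?X = P" using card_subset_eq_sub[OF sP XP] by simp
      then show False using nX P(1) by simp
    qed
    moreover have "?X \<subseteq> R" using generate_subgroup_incl[OF _ sR] x(1) by blast
    then have "R = ?X \<or> R = M" using maxX sR R(8) unfolding maximal_subgroup_iff[OF sM] by blast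
    then have "R = M" using nX R(7) by blast
    ultimately show ?thesis using maxX nX k(2) by blast
  qed
  obtain x0 where x0: "x0 \<in> R" "x0 \<notin> Z" using R(9) by blast
  have RM: "R = M" and cM: "card M = p * card (generate G {x0})" using main[OF x0] by blast+
  obtain n where n: "card (generate G {x0}) = p ^ n" using p_elem_ord[OF R(1) R(10)[OF x0(1)]] by blast
  have cM': "card M = p ^ Suc n" using cM n by simp
  then have "1 + Suc n \<ge> 4" using prime_power_index_card[OF _ R(1) q1(2,1), of "Suc n"] R(4) by simp
  then have "n \<ge> 2" by simp
  moreover have "maximal_subgroup (generate G {x}) (G\<lparr>carrier := M\<rparr>) \<and> \<not> generate G {x} \<lhd> G \<and> card (generate G {x}) = p ^ n"
    if "x \<in> M" "x \<notin> Z" for x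
    using main[of x] that RM cM' R(1) by (auto simp: prime_gt_0_nat)
  moreover have "\<not> M \<subseteq> Z" using R(9) RM by simp
  ultimately show thesis by (intro that[OF M R(1-4) cM' _ R(5,6)])
qed

end

subsection \<open>Structure of the normal maximal subgroup\<close>

text \<open>Collection in nilpotency class two: moving the letters y to the left across the letters
  u creates one central factor c per crossing, m(m-1)/2 in all.\<close>

lemma (in monoid) class_two_power:
  assumes y: "y \<in> carrier G" and u: "u \<in> carrier G" and c: "c \<in> carrier G"
    and uy: "u \<otimes> y = c \<otimes> (y \<otimes> u)" and cy: "c \<otimes> y = y \<otimes> c" and cu: "c \<otimes> u = u \<otimes> c"
  shows "u [^] (m::nat) \<otimes> y = c [^] m \<otimes> (y \<otimes> u [^] m)"
    and "(y \<otimes> u) [^] (m::nat) = c [^] (m * (m - 1) div 2) \<otimes> (y [^] m \<otimes> u [^] m)"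
proof -
  have cyp: "c [^] (i::nat) \<otimes> y [^] (j::nat) = y [^] j \<otimes> c [^] i" for i j
    using group_commutes_pow[OF group_commutes_pow[OF cy c y, symmetric] y, symmetric] c by simp
  have cup: "c [^] (i::nat) \<otimes> u [^] (j::nat) = u [^] j \<otimes> c [^] i" for i j
    using group_commutes_pow[OF group_commutes_pow[OF cu c u, symmetric] u, symmetric] c by simp
  show pow: "u [^] (m::nat) \<otimes> y = c [^] m \<otimes> (y \<otimes> u [^] m)" for m
  proof (induction m)
    case 0
    then show ?case using y by simp
  next
    case (Suc m)
    have "u [^] Suc m \<otimes> y = u [^] m \<otimes> (u \<otimes> y)" using u y by (simp add: m_assoc)
    also have "\<dots> = (u [^] m \<otimes> c) \<otimes> (y \<otimes> u)" unfolding uy using u y c by (simp add: m_assoc)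
    also have "u [^] m \<otimes> c = c \<otimes> u [^] m" using cup[of 1 m] c by simp
    also have "c \<otimes> u [^] m \<otimes> (y \<otimes> u) = c \<otimes> ((u [^] m \<otimes> y) \<otimes> u)" using u y c by (simp add: m_assoc)
    also have "\<dots> = c \<otimes> c [^] m \<otimes> (y \<otimes> (u [^] m \<otimes> u))" unfolding Suc using u y c by (simp add: m_assoc)
    also have "c \<otimes> c [^] m = c [^] Suc m" using nat_pow_Suc2[OF c] by simp
    finally show ?case by simp
  qed
  show "(y \<otimes> u) [^] m = c [^] (m * (m - 1) div 2) \<otimes> (y [^] m \<otimes> u [^] m)"
  proof (induction m)
    case 0
    then show ?case by simp
  next
    case (Suc m)
    let ?t = "m * (m - 1) div 2"
    \<comment> \<open>Truncated subtraction in m - 1 makes m = 0 a separate case.\<close>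
    have t: "Suc m * (Suc m - 1) div 2 = ?t + m"
    proof (cases m)
      case (Suc k)
      have "Suc m * (Suc m - 1) = m * (m - 1) + m * 2" unfolding Suc by (simp add: algebra_simps)
      then show ?thesis by simp
    qed simp
    have "(y \<otimes> u) [^] Suc m = c [^] ?t \<otimes> (y [^] m \<otimes> ((u [^] m \<otimes> y) \<otimes> u))"
      using Suc u y c by (simp add: m_assoc)
    also have "\<dots> = c [^] ?t \<otimes> ((y [^] m \<otimes> c [^] m) \<otimes> (y \<otimes> (u [^] m \<otimes> u)))"
      unfolding pow using u y c by (simp add: m_assoc)
    also have "y [^] m \<otimes> c [^] m = c [^] m \<otimes> y [^] m" using cyp[of m m] by simp
    also have "c [^] ?t \<otimes> (c [^] m \<otimes> y [^] m \<otimes> (y \<otimes> (u [^] m \<otimes> u))) =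
        (c [^] ?t \<otimes> c [^] m) \<otimes> ((y [^] m \<otimes> y) \<otimes> (u [^] m \<otimes> u))" using u y c by (simp add: m_assoc)
    also have "c [^] ?t \<otimes> c [^] m = c [^] (Suc m * (Suc m - 1) div 2)" unfolding t using nat_pow_mult[OF c] .
    finally show ?case by simp
  qed
qed

text \<open>Collects what \<open>cyclic_maximal_structure\<close> provides, together with the IC
  property of the 3-maximal subgroups below M. Elements of M outside \<open>Z\<close> have order
  p^n, one factor p short of |M|.\<close>

locale cyclic_maximal_group = nilpotent_maximal +
  fixes p q s n
  assumes p: "prime p" and q: "prime q" and pq: "p \<noteq> q"
    and cardG: "card (carrier G) = q * card M" and cardM: "card M = p ^ Suc n" and n: "n \<ge> 2"
    and s: "p_elem G q s" "s \<notin> M" and MZ: "\<not> M \<subseteq> Z"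
    and cyc: "\<And>x. x \<in> M \<Longrightarrow> x \<notin> Z \<Longrightarrow> maximal_subgroup (generate G {x}) (G\<lparr>carrier := M\<rparr>)"
    and cyc_nn: "\<And>x. x \<in> M \<Longrightarrow> x \<notin> Z \<Longrightarrow> \<not> generate G {x} \<lhd> G"
    and cyc_card: "\<And>x. x \<in> M \<Longrightarrow> x \<notin> Z \<Longrightarrow> card (generate G {x}) = p ^ n"
    and IC3: "\<And>H H1. maximal_subgroup H1 (G\<lparr>carrier := M\<rparr>) \<Longrightarrow>
      maximal_subgroup H (G\<lparr>carrier := H1\<rparr>) \<Longrightarrow> IC_Phi_subgroup H G"
begin

lemma sG: "s \<in> carrier G" using s by (simp add: p_elem_def)

lemma M_p_elem: "x \<in> M \<Longrightarrow> p_elem G p x" using in_p_subgroup_p_elem[OF sM cardM] .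

lemma outside:
  assumes x: "x \<in> M" "x \<notin> Z"
  shows "x \<in> carrier G" "subgroup (generate G {x}) G" "x \<in> generate G {x}"
    "generate G {x} \<lhd> G\<lparr>carrier := M\<rparr>" "generate G {x} \<subseteq> M" "ord x = p ^ n" "x \<noteq> \<one>"
proof -
  show xG: "x \<in> carrier G" using M_carrier[OF x(1)] .
  show "subgroup (generate G {x}) G" "x \<in> generate G {x}" using generate_singleton[OF xG] by blast+
  show "generate G {x} \<lhd> G\<lparr>carrier := M\<rparr>" using M.nilpotent_maximal_normal[OF nilM cyc[OF x]] .
  show "generate G {x} \<subseteq> M" using generate_subgroup_incl[OF _ sM] x(1) by blast
  show "ord x = p ^ n" using generate_pow_card[OF xG] cyc_card[OF x] by simp
  show "x \<noteq> \<one>" using x(2) subgroup.one_closed[OF Z_sub] by blast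
qed

text \<open><x^p> is contained in Phi(M), which is contained in <x>, and Phi(M) is normal in G while
  <x> is not; so Phi(M) = <x^p>. This makes Phi(M) itself 3-maximal and hence IC.\<close>

lemma F_cyclic:
  assumes x: "x \<in> M" "x \<notin> Z"
  shows "F = generate G {x [^] p}" "maximal_subgroup F (G\<lparr>carrier := generate G {x}\<rparr>)"
    "F \<subseteq> generate G {x}" "IC_Phi_subgroup F G" "x [^] p \<noteq> \<one>"
proof -
  note o = outside[OF x]
  have m: "maximal_subgroup (generate G {x [^] p}) (G\<lparr>carrier := generate G {x}\<rparr>)"
    using maximal_p_pow[OF p M_p_elem[OF x(1)] o(7)] .
  have "generate G {x [^] p} \<subseteq> F"
    using generate_subgroup_incl[OF _ F_sub] pow_in_F[OF p x(1) M_p_elem[OF x(1)]] by blast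
  moreover show Fx: "F \<subseteq> generate G {x}" using M.frattini_maximal[OF cyc[OF x]] .
  moreover have "F \<noteq> generate G {x}" using F_normal cyc_nn[OF x] by metis
  ultimately show F: "F = generate G {x [^] p}"
    using m F_sub unfolding maximal_subgroup_iff[OF o(2)] by blast
  show "maximal_subgroup F (G\<lparr>carrier := generate G {x}\<rparr>)" using m F by simp
  then show "IC_Phi_subgroup F G" by (rule IC3[OF cyc[OF x]])
  show "x [^] p \<noteq> \<one>"
  proof
    assume "x [^] p = \<one>"
    then have "p ^ n dvd p ^ 1" using pow_eq_id[OF o(1), of p] o(6) by simp
    then have "n \<le> 1" using power_dvd_imp_le[of p n 1] prime_gt_1_nat[OF p] by blast
    then show False using n by simp
  qed
qed

text \<open>As Phi(M) is IC, s acts trivially on its generator modulo Phi(Phi(M)). The coprime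
  action gives a fixed element z in the same coset, and z still generates Phi(M).\<close>

lemma s_centralizes_F:
  assumes f: "f \<in> F"
  shows "s \<otimes> f = f \<otimes> s"
proof -
  obtain x where x: "x \<in> M" "x \<notin> Z" using MZ by blast
  let ?f = "x [^] p"
  let ?D = "frattini (G\<lparr>carrier := F\<rparr>)"
  have fG: "?f \<in> carrier G" using outside(1)[OF x] by simp
  have Fgen: "F = generate G {?f}" using F_cyclic(1)[OF x] .
  have fF: "?f \<in> F" using generate_singleton(2)[OF fG] Fgen by simp
  have DN: "?D \<lhd> G" using frattini_normal[OF F_normal] .
  have sD: "subgroup ?D G" using DN normal_imp_subgroup by blast
  have DF: "?D \<subseteq> F" by (rule frattini_sub_subset)
  interpret F: fgroup "G\<lparr>carrier := F\<rparr>" using sub_fgroup[OF F_sub] .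
  have "card ?D dvd p ^ Suc n" using card_sub_dvd[OF sD sM] DF F_M cardM by auto
  then obtain k where k: "card ?D = p ^ k" using divides_primepow_nat[OF p] by blast
  have "commu ?f s \<in> commutator_subgroup G F (carrier G)" using commu_in_commutator_subgroup[OF fF sG] .
  moreover have "commu ?f s \<in> F" using F_Z fF sG unfolding Z_def by blast
  ultimately have D1: "commu ?f s \<in> ?D" using F_cyclic(4)[OF x] unfolding IC_Phi_subgroup_def by blast
  have "inv ?f \<otimes> inv (commu ?f s) \<otimes> inv (inv ?f) \<in> ?D"
    using normal_closed[OF DN inv_closed[OF fG] subgroup.m_inv_closed[OF sD D1]] .
  then have "inv ?f \<otimes> (s \<otimes> ?f \<otimes> inv s) \<in> ?D" using fG sG by (simp add: word_simps)
  then obtain m where m: "m \<in> ?D" "s \<otimes> (?f \<otimes> m) = (?f \<otimes> m) \<otimes> s"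
    using coprime_fixed_point[OF q p pq[symmetric] s(1) sD k normal_closed[OF DN sG] fG] by blast
  define z where "z = ?f \<otimes> m"
  have mF: "m \<in> F" using m(1) DF by blast
  have mG: "m \<in> carrier G" using subgroup.mem_carrier[OF F_sub mF] .
  have zF: "z \<in> F" unfolding z_def using subgroup.m_closed[OF F_sub fF mF] .
  have zG: "z \<in> carrier G" using subgroup.mem_carrier[OF F_sub zF] .
  have sz: "subgroup (generate G {z}) G" "z \<in> generate G {z}" using generate_singleton[OF zG] by blast+
  have zsub: "generate G {z} \<subseteq> F" using generate_subgroup_incl[OF _ F_sub] zF by blast
  \<comment> \<open>z differs from the generator x^p only by a factor in the Frattini subgroup of F,
    which consists of non-generators.\<close>
  have "generate G {z} = carrier (G\<lparr>carrier := F\<rparr>)"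
  proof (rule F.frattini_nongenerator)
    show "subgroup (generate G {z}) (G\<lparr>carrier := F\<rparr>)" using sz(1) zsub by (simp add: subgroup_sub_iff[OF F_sub])
    fix g assume "g \<in> carrier (G\<lparr>carrier := F\<rparr>)"
    then have g: "g \<in> F" by simp
    let ?K = "?D <#> generate G {z}"
    have sK: "subgroup ?K G" using mult_norm_subgroup[OF DN sz(1)] .
    have "?D \<subseteq> ?K" "generate G {z} \<subseteq> ?K" using set_mult_contains[OF sD sz(1)] by blast+
    then have "z \<otimes> inv m \<in> ?K" using subgroup.m_closed[OF sK] subgroup.m_inv_closed[OF sD m(1)] sz(2) by blast
    moreover have "z \<otimes> inv m = ?f" unfolding z_def using fG mG by (simp add: word_simps)
    ultimately have "?f \<in> ?K" by simp
    then have "generate G {?f} \<subseteq> ?K" using generate_subgroup_incl[OF _ sK] by blast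
    then have "g \<in> ?K" using g Fgen by blast
    then show "\<exists>f\<in>?D. \<exists>a\<in>generate G {z}. g = f \<otimes>\<^bsub>G\<lparr>carrier := F\<rparr>\<^esub> a" unfolding set_mult_elem by simp
  qed
  then have genz: "generate G {z} = F" by simp
  let ?C = "{g \<in> carrier G. commu s g \<in> {\<one>}}"
  have sC: "subgroup ?C G" using commutes_mod_subgroup[OF one_is_normal sG] .
  have "commu s z = \<one>" using commu_one_iff[OF sG zG] m(2) z_def by metis
  then have "z \<in> ?C" using zG by simp
  then have "generate G {z} \<subseteq> ?C" using generate_subgroup_incl[OF _ sC] by blast
  then have "f \<in> ?C" using f genz by blast
  then show ?thesis using commu_one_iff[OF sG] by blast
qed

text \<open>Each x in M - \<open>Z\<close> commutes with Phi(M), which is contained in <x>; these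
  elements generate M, and s centralizes Phi(M) as well.\<close>

lemma F_central:
  assumes f: "f \<in> F" and g: "g \<in> carrier G"
  shows "f \<otimes> g = g \<otimes> f"
proof -
  have fG: "f \<in> carrier G" using subgroup.mem_carrier[OF F_sub f] .
  let ?C = "{g \<in> carrier G. commu f g \<in> {\<one>}}"
  have sC: "subgroup ?C G" using commutes_mod_subgroup[OF one_is_normal fG] .
  have out: "x \<in> ?C" if x: "x \<in> M" "x \<notin> Z" for x
  proof -
    have xG: "x \<in> carrier G" using outside(1)[OF x] .
    have "f \<in> generate G {x}" using f F_cyclic(3)[OF x] by blast
    then obtain i :: int where i: "f = x [^] i" unfolding generate_pow[OF xG] by blast
    have "f \<otimes> x = x \<otimes> f"
      using int_pow_mult[OF xG, of i 1] int_pow_mult[OF xG, of 1 i] xG unfolding i by (simp add: add.commute)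
    then have "commu f x = \<one>" using commu_one_iff[OF fG xG] by blast
    then show ?thesis using xG by simp
  qed
  have "?C = carrier G"
  proof (rule generated_by_M[OF sG s(2) sC])
    obtain x where x: "x \<in> M" "x \<notin> Z" using MZ by blast
    have xG: "x \<in> carrier G" using outside(1)[OF x] .
    show "M \<subseteq> ?C"
    proof
      fix m assume m: "m \<in> M"
      have mG: "m \<in> carrier G" using M_carrier[OF m] .
      show "m \<in> ?C"
      proof (cases "m \<in> Z")
        case True
        \<comment> \<open>An element of \<open>Z\<close> is a quotient of two elements outside
          \<open>Z\<close>, so M - \<open>Z\<close> generates M.\<close>
        have "m \<otimes> x \<notin> Z"
        proof
          assume "m \<otimes> x \<in> Z"
          then have "inv m \<otimes> (m \<otimes> x) \<in> Z"
            using subgroup.m_closed[OF Z_sub subgroup.m_inv_closed[OF Z_sub True]] by blast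
          then show False using x(2) mG xG by (simp add: word_simps)
        qed
        then have "m \<otimes> x \<in> ?C" using out subgroup.m_closed[OF sM m x(1)] by blast
        then have "(m \<otimes> x) \<otimes> inv x \<in> ?C"
          using subgroup.m_closed[OF sC _ subgroup.m_inv_closed[OF sC out[OF x]]] by blast
        then show ?thesis using mG xG by (simp add: word_simps)
      qed (use out m in blast)
    qed
    have "commu f s = \<one>" using commu_one_iff[OF fG sG] s_centralizes_F[OF f] by simp
    then show "s \<in> ?C" using sG by simp
  qed
  then have "commu f g = \<one>" using g by blast
  then show ?thesis using commu_one_iff[OF fG g] by blast
qed

lemma M_normal_closed: "m \<in> M \<Longrightarrow> g \<in> carrier G \<Longrightarrow> g \<otimes> m \<otimes> inv g \<in> M"
  using normal_closed[OF normM] by blast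

lemma normal_in_G:
  assumes H: "H \<lhd> G\<lparr>carrier := M\<rparr>" and conj: "\<And>h. h \<in> H \<Longrightarrow> s \<otimes> h \<otimes> inv s \<in> H"
  shows "H \<lhd> G"
proof -
  have H': "subgroup H G" "\<And>x h. x \<in> M \<Longrightarrow> h \<in> H \<Longrightarrow> x \<otimes> h \<otimes> inv x \<in> H"
    using H unfolding normal_sub_iff[OF sM] by blast+
  have HG: "H \<subseteq> carrier G" using subgroup.subset[OF H'(1)] .
  have "normalizing H = carrier G"
  proof (rule generated_by_M[OF sG s(2) subgroup_normalizing[OF HG]])
    show "M \<subseteq> normalizing H"
      using normalizing_finiteI[OF finite_sub[OF H'(1)] HG M_carrier H'(2)] by blast
    show "s \<in> normalizing H" using normalizing_finiteI[OF finite_sub[OF H'(1)] HG sG conj] .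
  qed
  then show ?thesis by (rule normalizing_eq_carrier[OF H'(1)])
qed

text \<open>
  If \<open>M \<inter> Z\<close> exceeded \<open>F\<close>, then for \<open>x \<in> M - Z\<close> the commutator \<open>d = [s,x]\<close> would generate a
  normal subgroup: modulo \<open>\<langle>d\<rangle>\<close> the element \<open>s\<close> centralizes both \<open>x\<close> and \<open>M \<inter> Z\<close>, hence \<open>M\<close>.
\<close>

lemma M_Z_eq_F: "M \<inter> Z = F"
proof (rule ccontr)
  assume "M \<inter> Z \<noteq> F"
  then obtain c where c: "c \<in> M" "c \<in> Z" "c \<notin> F" using F_M F_Z by blast
  obtain x where x: "x \<in> M" "x \<notin> Z" using MZ by blast
  note o = outside[OF x]
  have cG: "c \<in> carrier G" using M_carrier[OF c(1)] .
  have sMZ: "subgroup (M \<inter> Z) G" using subgroups_Inter_pair[OF sM Z_sub] .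
  have MZN: "M \<inter> Z \<lhd> G"
    by (rule normal_invI[OF sMZ]) (use normal_closed[OF normM] normal_closed[OF Z_normal] in blast)
  define d where "d = commu s x"
  have dM: "d \<in> M" unfolding d_def
    using subgroup.m_closed[OF sM M_normal_closed[OF x(1) sG] subgroup.m_inv_closed[OF sM x(1)]] .
  have dG: "d \<in> carrier G" using M_carrier[OF dM] .
  \<comment> \<open>If d were in \<open>Z\<close>, then [x,s] would lie in the normal p-subgroup M
    \<inter> Z, and coprime action would give x in \<open>Z\<close>.\<close>
  have dZ: "d \<notin> Z"
  proof
    assume "d \<in> Z"
    then have "inv d \<in> M \<inter> Z" using subgroup.m_inv_closed[OF sMZ] dM by blast
    moreover have "inv d = commu x s" unfolding d_def using o(1) sG by (simp add: word_simps)
    ultimately have "commu x s \<in> M \<inter> Z" by simp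
    moreover have "card (M \<inter> Z) dvd p ^ Suc n" using card_sub_dvd[OF sMZ sM] cardM by simp
    then obtain k where "card (M \<inter> Z) = p ^ k" using divides_primepow_nat[OF p] by blast
    ultimately have "x \<in> Z" using coprime_Z[OF q p pq[symmetric] s MZN _ _ _ x(1)] by blast
    then show False using x(2) by blast
  qed
  note od = outside[OF dM dZ]
  let ?X = "generate G {d}"
  have Xconj: "m \<otimes> h \<otimes> inv m \<in> ?X" if "m \<in> M" "h \<in> ?X" for m h
    using od(4) that unfolding normal_sub_iff[OF sM] by blast
  \<comment> \<open>The elements of M that s centralizes modulo <d>. This is a subgroup because M
    normalizes <d>, even before <d> is known to be normal in G.\<close>
  let ?V = "{v \<in> M. commu s v \<in> ?X}"
  have sV: "subgroup ?V G"
  proof (rule subgroupI)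
    show "?V \<subseteq> carrier G" using M_carrier by blast
    have "\<one> \<in> ?V" using subgroup.one_closed[OF sM] subgroup.one_closed[OF od(2)] sG by simp
    then show "?V \<noteq> {}" by blast
    fix a assume "a \<in> ?V"
    then have a: "a \<in> M" "commu s a \<in> ?X" by blast+
    have aG: "a \<in> carrier G" and ia: "inv a \<in> M" using M_carrier[OF a(1)] subgroup.m_inv_closed[OF sM a(1)] by blast+
    have "inv a \<otimes> inv (commu s a) \<otimes> inv (inv a) \<in> ?X"
      using Xconj[OF ia subgroup.m_inv_closed[OF od(2) a(2)]] .
    moreover have "inv a \<otimes> inv (commu s a) \<otimes> inv (inv a) = commu s (inv a)"
      using aG sG by (simp add: word_simps)
    ultimately show "inv a \<in> ?V" using ia by simp
    fix b assume "b \<in> ?V"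
    then have b: "b \<in> M" "commu s b \<in> ?X" by blast+
    have bG: "b \<in> carrier G" using M_carrier[OF b(1)] .
    have "commu s a \<otimes> (a \<otimes> commu s b \<otimes> inv a) \<in> ?X"
      using subgroup.m_closed[OF od(2) a(2) Xconj[OF a(1) b(2)]] .
    moreover have "commu s a \<otimes> (a \<otimes> commu s b \<otimes> inv a) = commu s (a \<otimes> b)"
      using aG bG sG by (simp add: word_simps)
    ultimately show "a \<otimes> b \<in> ?V" using subgroup.m_closed[OF sM a(1) b(1)] by simp
  qed
  have "x \<in> ?V" using x(1) od(3) unfolding d_def by blast
  then have XV: "generate G {x} \<subseteq> ?V" using generate_subgroup_incl[OF _ sV] by blast
  have cV: "c \<in> ?V"
  proof -
    have "commu c s \<in> F" using c(2) sG unfolding Z_def by blast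
    then have "inv (commu c s) \<in> ?X" using subgroup.m_inv_closed[OF F_sub] F_cyclic(3)[OF dM dZ] by blast
    moreover have "inv (commu c s) = commu s c" using cG sG by (simp add: word_simps)
    ultimately show ?thesis using c(1) by simp
  qed
  \<comment> \<open>Phi(M) is maximal in <x> and x is outside \<open>Z\<close>, so <x> meets
    \<open>Z\<close> exactly in Phi(M).\<close>
  have cX: "c \<notin> generate G {x}"
  proof
    assume cx: "c \<in> generate G {x}"
    let ?K = "generate G {x} \<inter> Z"
    have "subgroup ?K G" using subgroups_Inter_pair[OF o(2) Z_sub] .
    moreover have "F \<subseteq> ?K" using F_cyclic(3)[OF x] F_Z by blast
    ultimately have "?K = F \<or> ?K = generate G {x}"
      using F_cyclic(2)[OF x] unfolding maximal_subgroup_iff[OF o(2)] by blast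
    then show False using cx c(2,3) x(2) o(3) by blast
  qed
  have "?V = M"
    using cyc[OF x] sV XV cV cX unfolding maximal_subgroup_iff[OF sM] by blast
  then have sxV: "s \<otimes> x \<otimes> inv s \<in> ?V" using M_normal_closed[OF x(1) sG] by blast
  \<comment> \<open>Membership of s x s^-1 in V is precisely the statement that s maps d into
    <d>.\<close>
  have "commu s (s \<otimes> x \<otimes> inv s) = s \<otimes> d \<otimes> inv s"
    unfolding d_def using sG o(1) by (simp add: word_simps)
  then have sd: "s \<otimes> d \<otimes> inv s \<in> ?X" using sxV by simp
  have "?X \<lhd> G"
  proof (rule normal_in_G[OF od(4)])
    fix h assume "h \<in> ?X"
    then obtain i :: int where i: "h = d [^] i" unfolding generate_pow[OF dG] by blast
    show "s \<otimes> h \<otimes> inv s \<in> ?X"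
      unfolding i conj_int_pow[OF sG dG] using subgroup_int_pow_closed[OF od(2) sd] .
  qed
  then show False using cyc_nn[OF dM dZ] by blast
qed

lemma in_Z_iff: "x \<in> M \<Longrightarrow> x \<in> Z \<longleftrightarrow> x \<in> F"
  using M_Z_eq_F by blast

text \<open>Otherwise <x>, being normal in M, would be invariant under s too and thus normal in
  G.\<close>

lemma conj_not_in_cyclic:
  assumes x: "x \<in> M" "x \<notin> F"
  shows "s \<otimes> x \<otimes> inv s \<notin> generate G {x}"
proof
  assume sx: "s \<otimes> x \<otimes> inv s \<in> generate G {x}"
  have xZ: "x \<notin> Z" using x in_Z_iff by blast
  note o = outside[OF x(1) xZ]
  have "generate G {x} \<lhd> G"
  proof (rule normal_in_G[OF o(4)])
    fix h assume "h \<in> generate G {x}"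
    then obtain i :: int where i: "h = x [^] i" unfolding generate_pow[OF o(1)] by blast
    show "s \<otimes> h \<otimes> inv s \<in> generate G {x}"
      unfolding i conj_int_pow[OF sG o(1)] using subgroup_int_pow_closed[OF o(2) sx] .
  qed
  then show False using cyc_nn[OF x(1) xZ] by blast
qed

text \<open>The conjugate y of x is multiplied by some u in <x> with u^p = y^-p. The product w still
  lies outside Phi(M), hence has order p^n, but the collection formula shows w^(2p) = 1.\<close>

lemma p_n_eq_2: "p = 2 \<and> n = 2"
proof -
  obtain x where x: "x \<in> M" "x \<notin> Z" using MZ by blast
  note o = outside[OF x]
  have xG: "x \<in> carrier G" using o(1) .
  have xF: "x \<notin> F" using x F_Z by blast
  define y where "y = s \<otimes> x \<otimes> inv s"
  have yM: "y \<in> M" unfolding y_def using M_normal_closed[OF x(1) sG] .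
  have yG: "y \<in> carrier G" using M_carrier[OF yM] .
  have yx: "y \<notin> generate G {x}" unfolding y_def using conj_not_in_cyclic[OF x(1) xF] .
  have xpG: "x [^] p \<in> carrier G" using xG by simp
  have "y [^] p \<in> generate G {x [^] p}" using pow_in_F[OF p yM M_p_elem[OF yM]] F_cyclic(1)[OF x] by simp
  then obtain j :: int where j: "y [^] p = (x [^] p) [^] j" unfolding generate_pow[OF xpG] by blast
  \<comment> \<open>y^p lies in Phi(M) = <x^p>, so it equals x^(pj), and x^(-j) cancels it after
    taking p-th powers.\<close>
  define u where "u = x [^] (- j)"
  have uX: "u \<in> generate G {x}" unfolding u_def using subgroup_int_pow_closed[OF o(2,3)] .
  have uM: "u \<in> M" using uX o(5) by blast
  have uG: "u \<in> carrier G" using M_carrier[OF uM] .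
  have xpj: "u [^] p = inv (y [^] p)"
  proof -
    have "u [^] p = x [^] (- j * int p)"
      unfolding u_def using int_pow_pow[OF xG, of "- j" "int p"] by (simp add: int_pow_int)
    also have "- j * int p = - (int p * j)" by simp
    also have "x [^] \<dots> = inv (x [^] (int p * j))" using int_pow_neg[OF xG] .
    also have "x [^] (int p * j) = (x [^] p) [^] j" using int_pow_pow[OF xG, of "int p" j] by (simp add: int_pow_int)
    finally show ?thesis unfolding j .
  qed
  define w where "w = y \<otimes> u"
  have wM: "w \<in> M" unfolding w_def using subgroup.m_closed[OF sM yM uM] .
  have wF: "w \<notin> F"
  proof
    assume "w \<in> F"
    then have "w \<in> generate G {x}" using F_cyclic(3)[OF x] by blast
    then have "w \<otimes> inv u \<in> generate G {x}" using subgroup.m_closed[OF o(2) _ subgroup.m_inv_closed[OF o(2) uX]] by blast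
    then show False using yx unfolding w_def using yG uG by (simp add: word_simps)
  qed
  define c where "c = commu u y"
  have cF: "c \<in> F" unfolding c_def using M_commu[OF uM yM] .
  have cG: "c \<in> carrier G" using subgroup.mem_carrier[OF F_sub cF] .
  have uy: "u \<otimes> y = c \<otimes> (y \<otimes> u)" unfolding c_def using uG yG by (simp add: word_simps)
  note pow = class_two_power[OF yG uG cG uy F_central[OF cF yG] F_central[OF cF uG]]
  have upF: "u [^] p \<in> F" using pow_in_F[OF p uM M_p_elem[OF uM]] .
  have upG: "u [^] p \<in> carrier G" using uG by simp
  \<comment> \<open>u^p lies in the central subgroup Phi(M), so c^p = [u,y]^p = [u^p,y] = 1.\<close>
  have "c [^] p \<otimes> (y \<otimes> u [^] p) = y \<otimes> u [^] p" using pow(1)[of p] F_central[OF upF yG] by simp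
  then have cp: "c [^] p = \<one>" using cG yG upG by (metis l_cancel_one' m_closed nat_pow_closed r_cancel_one)
  have "w [^] p = c [^] (p * (p - 1) div 2) \<otimes> (y [^] p \<otimes> u [^] p)" unfolding w_def using pow(2)[of p] .
  also have "y [^] p \<otimes> u [^] p = \<one>" unfolding xpj using yG by simp
  finally have "w [^] p = c [^] (p * (p - 1) div 2)" using cG by simp
  \<comment> \<open>Squaring removes the division by 2, which leaves a multiple of p in the exponent
    also for p = 2.\<close>
  then have "(w [^] p) [^] (2::nat) = c [^] (p * (p - 1) div 2 * 2)" using cG by (simp add: nat_pow_pow)
  also have "p * (p - 1) div 2 * 2 = p * (p - 1)"
    by (rule dvd_div_mult_self) (cases "even p", simp_all)
  also have "c [^] (p * (p - 1)) = \<one>" using cp cG by (simp flip: nat_pow_pow)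
  finally have "w [^] (p * 2) = \<one>" using M_carrier[OF wM] by (simp add: nat_pow_pow)
  then have "p ^ n dvd p * 2"
    using pow_eq_id[OF M_carrier[OF wM]] outside(6)[OF wM] wF in_Z_iff[OF wM] by metis
  moreover obtain k where "n = 2 + k" using le_Suc_ex[OF n] by blast
  then have k: "n = Suc (Suc k)" by simp
  ultimately have "p * p ^ k dvd 2" using prime_gt_0_nat[OF p] by (simp add: k)
  then have "p * p ^ k \<le> 2" by (simp add: dvd_imp_le)
  moreover have "p \<ge> 2" using prime_ge_2_nat[OF p] .
  moreover have "k = 0"
  proof (rule ccontr)
    assume "k \<noteq> 0"
    then obtain l where "k = Suc l" using not0_implies_Suc by blast
    moreover have "p ^ l \<ge> 1" using prime_gt_0_nat[OF p] by simp
    ultimately have "p * (p * 1) \<le> p * p ^ k" by (intro mult_le_mono2) (simp add: prime_gt_0_nat[OF p])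
    moreover have "2 * (2 * 1) \<le> p * (p * 1)" using \<open>p \<ge> 2\<close> by (intro mult_le_mono) simp_all
    ultimately show False using \<open>p * p ^ k \<le> 2\<close> by linarith
  qed
  ultimately show ?thesis using k by simp
qed

end

subsection \<open>A presentation of \<open>SL\<^sub>2(3)\<close>\<close>

text \<open>A presentation of \<open>SL\<^sub>2(3) = Q\<^sub>8 \<rtimes> C\<^sub>3\<close>: here \<open>Q\<^sub>8 = \<langle>x,y\<rangle>\<close> and \<open>s\<close> acts by \<open>x \<mapsto> y \<mapsto> xy\<close>.\<close>

locale binary_tetrahedral = group +
  fixes x y s
  assumes gens_carrier [simp]: "x \<in> carrier G" "y \<in> carrier G" "s \<in> carrier G"
    and x4: "x [^] (4::nat) = \<one>" and yy: "y \<otimes> y = x \<otimes> x" and yx: "y \<otimes> x = x [^] (3::nat) \<otimes> y"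
    and s3: "s [^] (3::nat) = \<one>" and sx: "s \<otimes> x = y \<otimes> s" and sy: "s \<otimes> y = x \<otimes> y \<otimes> s"
begin

text \<open>Normal forms with x on the left, then y, then s; every product of generators can be
  brought into this shape by the relations.\<close>

definition nf :: "nat \<times> nat \<times> nat \<Rightarrow> 'a" where
  "nf t = (case t of (a, b, c) \<Rightarrow> x [^] a \<otimes> y [^] b \<otimes> s [^] c)"

lemma nf_carrier [simp]: "nf t \<in> carrier G"
  by (cases t) (simp add: nf_def)

end

text \<open>There are 4 * 2 * 3 = 24 triples, the order of SL2(3).\<close>

definition nf_dom :: "(nat \<times> nat \<times> nat) set" where
  "nf_dom = {..<4} \<times> {..<2} \<times> {..<3}"

text \<open>Together with \<open>nf_y\<close> and \<open>nf_s\<close> this describes left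
  multiplication by the generators on exponent triples, independently of any group.\<close>

fun nf_x :: "nat \<times> nat \<times> nat \<Rightarrow> nat \<times> nat \<times> nat" where
  "nf_x (a, b, c) = ((a + 1) mod 4, b, c)"

text \<open>From y x^a = x^(3a) y; when a second y meets the first, y^2 = x^2 adds 2 to the exponent
  of x.\<close>

fun nf_y :: "nat \<times> nat \<times> nat \<Rightarrow> nat \<times> nat \<times> nat" where
  "nf_y (a, b, c) = (if b = 0 then (3 * a mod 4, 1, c) else ((3 * a + 2) mod 4, 0, c))"

text \<open>Since s x = y s and s y = x y s, the product s x^a y^b s^c equals y^a (xy)^b s^(c+1).
  The lists tabulate y^a, respectively y^a x y, in the form x^i y^j for a = 0, 1, 2, 3.\<close>

fun nf_s :: "nat \<times> nat \<times> nat \<Rightarrow> nat \<times> nat \<times> nat" where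
  "nf_s (a, b, c) = (if b = 0 then ([0, 0, 2, 2] ! a, [0, 1, 0, 1] ! a, (c + 1) mod 3)
     else ([1, 1, 3, 3] ! a, [1, 0, 1, 0] ! a, (c + 1) mod 3))"

lemma less_4_disj: "(a::nat) < 4 \<Longrightarrow> a = 0 \<or> a = 1 \<or> a = 2 \<or> a = 3" by linarith
lemma less_2_disj: "(a::nat) < 2 \<Longrightarrow> a = 0 \<or> a = 1" by linarith

lemma nf_dom_closed:
  assumes "t \<in> nf_dom"
  shows "nf_x t \<in> nf_dom" "nf_y t \<in> nf_dom" "nf_s t \<in> nf_dom"
proof -
  obtain a b c where t: "t = (a, b, c)" by (cases t) auto
  have bc: "b < 2" "c < 3" and "a < 4" using assms by (simp_all add: t nf_dom_def)
  from less_4_disj[OF \<open>a < 4\<close>] show "nf_x t \<in> nf_dom" "nf_y t \<in> nf_dom" "nf_s t \<in> nf_dom"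
    unfolding t by (elim disjE; simp add: nf_dom_def bc)+
qed

context binary_tetrahedral
begin

lemma pow_mod:
  assumes "z \<in> carrier G" "z [^] (m::nat) = \<one>"
  shows "z [^] (a mod m) = z [^] a"
proof -
  have "z [^] (m * (a div m)) = \<one>"
    using nat_pow_pow[OF assms(1), of m "a div m"] unfolding assms(2) nat_pow_one by (rule sym)
  then have "z [^] (m * (a div m) + a mod m) = z [^] (a mod m)"
    using nat_pow_mult[OF assms(1), of "m * (a div m)" "a mod m"] assms(1) by (metis l_one nat_pow_closed)
  then show ?thesis by simp
qed

lemma nf_x: "x \<otimes> nf t = nf (nf_x t)"
proof -
  obtain a b c where t: "t = (a, b, c)" by (cases t) auto
  have "x [^] ((a + 1) mod 4) = x \<otimes> x [^] a" using pow_mod[OF _ x4, of "a + 1"] nat_pow_Suc2 by simp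
  then show ?thesis unfolding t by (simp add: nf_def m_assoc)
qed

lemma y_xpow: "y \<otimes> x [^] (a::nat) = x [^] (3 * a) \<otimes> y"
proof (induction a)
  case (Suc a)
  have "y \<otimes> x [^] Suc a = (y \<otimes> x [^] a) \<otimes> x" by (simp add: m_assoc)
  also have "\<dots> = x [^] (3 * a) \<otimes> (y \<otimes> x)" unfolding Suc by (simp add: m_assoc)
  also have "\<dots> = (x [^] (3 * a) \<otimes> x [^] (3::nat)) \<otimes> y" unfolding yx by (simp add: m_assoc)
  also have "x [^] (3 * a) \<otimes> x [^] (3::nat) = x [^] (3 * Suc a)" by (simp add: nat_pow_mult add.commute)
  finally show ?case .
qed simp

lemma nf_y:
  assumes "t \<in> nf_dom"
  shows "y \<otimes> nf t = nf (nf_y t)"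
proof -
  obtain a b c where t: "t = (a, b, c)" by (cases t) auto
  have "b = 0 \<or> b = 1" using assms less_2_disj[of b] by (auto simp: t nf_dom_def)
  then show ?thesis
  proof
    assume b: "b = 0"
    have "y \<otimes> nf t = (y \<otimes> x [^] a) \<otimes> s [^] c" unfolding t nf_def b by (simp add: m_assoc)
    also have "\<dots> = nf (nf_y t)" unfolding y_xpow t b by (simp add: nf_def pow_mod[OF _ x4])
    finally show ?thesis .
  next
    assume b: "b = 1"
    have "y \<otimes> nf t = (y \<otimes> x [^] a) \<otimes> (y \<otimes> s [^] c)" unfolding t nf_def b by (simp add: m_assoc)
    also have "\<dots> = x [^] (3 * a) \<otimes> ((y \<otimes> y) \<otimes> s [^] c)" unfolding y_xpow by (simp add: m_assoc)
    also have "\<dots> = (x [^] (3 * a) \<otimes> x [^] (2::nat)) \<otimes> s [^] c" unfolding yy by (simp add: m_assoc numeral_2_eq_2)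
    also have "x [^] (3 * a) \<otimes> x [^] (2::nat) = x [^] (3 * a + 2)" by (simp add: nat_pow_mult)
    also have "x [^] (3 * a + 2) \<otimes> s [^] c = x [^] ((3 * a + 2) mod 4) \<otimes> y [^] (0::nat) \<otimes> s [^] c"
      unfolding pow_mod[OF gens_carrier(1) x4] by (simp only: nat_pow_0 r_one nat_pow_closed gens_carrier)
    also have "\<dots> = nf (nf_y t)"
      unfolding t b by (simp only: nf_y.simps nf_def prod.case one_neq_zero if_False)
    finally show ?thesis .
  qed
qed

lemma yxy: "y \<otimes> (x \<otimes> y) = x"
proof -
  have "y \<otimes> (x \<otimes> y) = (y \<otimes> x) \<otimes> y" by (simp add: m_assoc)
  also have "\<dots> = x [^] (3::nat) \<otimes> (y \<otimes> y)" unfolding yx by (simp add: m_assoc)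
  also have "\<dots> = x [^] (4::nat) \<otimes> x" unfolding yy by (simp add: m_assoc numeral_eq_Suc)
  finally show ?thesis unfolding x4 by simp
qed

lemma s_xpow: "s \<otimes> x [^] (a::nat) = y [^] a \<otimes> s"
proof (induction a)
  case (Suc a)
  have "s \<otimes> x [^] Suc a = (s \<otimes> x [^] a) \<otimes> x" by (simp add: m_assoc)
  also have "\<dots> = y [^] a \<otimes> (s \<otimes> x)" unfolding Suc by (simp add: m_assoc)
  also have "\<dots> = y [^] Suc a \<otimes> s" unfolding sx by (simp add: m_assoc)
  finally show ?case .
qed simp

lemma nf_s:
  assumes "t \<in> nf_dom"
  shows "s \<otimes> nf t = nf (nf_s t)"
proof -
  obtain a b c where t: "t = (a, b, c)" by (cases t) auto
  have a: "a = 0 \<or> a = 1 \<or> a = 2 \<or> a = 3" and b: "b = 0 \<or> b = 1"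
    using assms less_2_disj[of b] less_4_disj[of a] by (auto simp: t nf_dom_def)
  have sc: "s [^] ((c + 1) mod 3) = s \<otimes> s [^] c" using pow_mod[OF _ s3, of "c + 1"] nat_pow_Suc2 by simp
  have y2: "y [^] (2::nat) = x [^] (2::nat)" and y3: "y [^] (3::nat) = x [^] (2::nat) \<otimes> y"
    using yy by (simp_all add: numeral_2_eq_2 numeral_3_eq_3)
  have x3: "x [^] (2::nat) \<otimes> x = x [^] (3::nat)" by (simp add: numeral_2_eq_2 numeral_3_eq_3)
  from b show ?thesis
  proof
    assume b: "b = 0"
    have "s \<otimes> nf t = (s \<otimes> x [^] a) \<otimes> s [^] c" unfolding t nf_def b by (simp add: m_assoc)
    also have "\<dots> = y [^] a \<otimes> s [^] ((c + 1) mod 3)" unfolding s_xpow sc by (simp add: m_assoc)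
    also have "\<dots> = nf (nf_s t)" unfolding t b using a y2 y3 by (auto simp: nf_def)
    finally show ?thesis .
  next
    assume b: "b = 1"
    have "s \<otimes> nf t = (s \<otimes> x [^] a) \<otimes> (y \<otimes> s [^] c)" unfolding t nf_def b by (simp add: m_assoc)
    also have "\<dots> = y [^] a \<otimes> ((s \<otimes> y) \<otimes> s [^] c)" unfolding s_xpow by (simp add: m_assoc)
    also have "\<dots> = (y [^] a \<otimes> (x \<otimes> y)) \<otimes> s [^] ((c + 1) mod 3)" unfolding sy sc by (simp add: m_assoc)
    also have "y [^] a \<otimes> (x \<otimes> y) = x [^] ([1, 1, 3, 3::nat] ! a) \<otimes> y [^] ([1, 0, 1, 0::nat] ! a)"
    proof -
      have 2: "x [^] (2::nat) \<otimes> (x \<otimes> y) = x [^] (3::nat) \<otimes> y" using x3 by (simp flip: m_assoc)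
      have 3: "x [^] (2::nat) \<otimes> y \<otimes> (x \<otimes> y) = x [^] (3::nat)" using yxy x3 by (simp add: m_assoc)
      have e: "y [^] (0::nat) \<otimes> (x \<otimes> y) = x [^] (1::nat) \<otimes> y [^] (1::nat)"
        "y [^] (1::nat) \<otimes> (x \<otimes> y) = x [^] (1::nat) \<otimes> y [^] (0::nat)"
        "y [^] (2::nat) \<otimes> (x \<otimes> y) = x [^] (3::nat) \<otimes> y [^] (1::nat)"
        "y [^] (3::nat) \<otimes> (x \<otimes> y) = x [^] (3::nat) \<otimes> y [^] (0::nat)"
        unfolding y2 y3 2 3 using yxy by simp_all
      have l: "[1, 1, 3, 3::nat] ! 0 = 1" "[1, 1, 3, 3::nat] ! 1 = 1" "[1, 1, 3, 3::nat] ! 2 = 3" "[1, 1, 3, 3::nat] ! 3 = 3"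
        "[1, 0, 1, 0::nat] ! 0 = 1" "[1, 0, 1, 0::nat] ! 1 = 0" "[1, 0, 1, 0::nat] ! 2 = 1" "[1, 0, 1, 0::nat] ! 3 = 0"
        by simp_all
      from a show ?thesis
      proof (elim disjE)
        assume a: "a = 0"
        show ?thesis unfolding a l by (rule e)
      next
        assume a: "a = 1"
        show ?thesis unfolding a l by (rule e)
      next
        assume a: "a = 2"
        show ?thesis unfolding a l by (rule e)
      next
        assume a: "a = 3"
        show ?thesis unfolding a l by (rule e)
      qed
    qed
    also have "\<dots> \<otimes> s [^] ((c + 1) mod 3) = nf (nf_s t)" unfolding t b by (simp add: nf_def)
    finally show ?thesis .
  qed
qed

lemma nf_one: "nf (0, 0, 0) = \<one>"
  by (simp add: nf_def)

lemma nf_gens: "nf (1, 0, 0) = x" "nf (0, 1, 0) = y" "nf (0, 0, 1) = s"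
  by (simp_all add: nf_def)

text \<open>In a finite group inverses are powers, so closure under products is enough to apply a
  generation hypothesis.\<close>

lemma finite_closed_subgroup:
  assumes fin: "finite (carrier G)" and A: "A \<subseteq> carrier G" "\<one> \<in> A"
    and mul: "\<And>a b. a \<in> A \<Longrightarrow> b \<in> A \<Longrightarrow> a \<otimes> b \<in> A"
  shows "subgroup A G"
proof (rule subgroupI)
  show "A \<subseteq> carrier G" by fact
  show "A \<noteq> {}" using A(2) by blast
  fix a assume a: "a \<in> A"
  have aG: "a \<in> carrier G" using a A(1) by blast
  have pow: "a [^] (k::nat) \<in> A" for k using A(2) mul a by (induction k) auto
  have "inv a = a [^] (order G - 1)"
  proof -
    have "a [^] (order G - 1) \<otimes> a = a [^] (order G)"
      using fin order_gt_0_iff_finite by (simp flip: nat_pow_Suc)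
    also have "\<dots> = \<one>" using pow_order_eq_1[OF aG] .
    finally show ?thesis using aG inv_equality by auto
  qed
  then show "inv a \<in> A" using pow by simp
qed (rule mul)

end

text \<open>Both groups multiply normal forms by generators through the same tables. Matching normal
  forms therefore commutes with left multiplication by x, y and s, and the homomorphism law spreads
  from these generators to all of G.\<close>

lemma binary_tetrahedral_iso:
  assumes G: "binary_tetrahedral G x y s" and H: "binary_tetrahedral H x' y' s'"
    and finG: "finite (carrier G)"
    and gen: "\<And>K. subgroup K G \<Longrightarrow> x \<in> K \<Longrightarrow> y \<in> K \<Longrightarrow> s \<in> K \<Longrightarrow> K = carrier G"
    and card: "card (carrier G) = 24"
    and bij: "bij_betw (binary_tetrahedral.nf H x' y' s') nf_dom (carrier H)"
  shows "G \<cong> H"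
proof -
  interpret G: binary_tetrahedral G x y s by fact
  interpret H: binary_tetrahedral H x' y' s' by fact
  have zero: "(0, 0, 0) \<in> nf_dom" by (simp add: nf_dom_def)
  \<comment> \<open>Elements whose left multiplication preserves the set of normal forms; applied to
    the form of the identity, this makes every element a normal form.\<close>
  have "{g \<in> carrier G. \<forall>t\<in>nf_dom. \<exists>u\<in>nf_dom. g \<otimes>\<^bsub>G\<^esub> G.nf t = G.nf u} = carrier G" (is "?K = _")
  proof (rule gen)
    show "subgroup ?K G"
    proof (rule G.finite_closed_subgroup[OF finG])
      show "\<one>\<^bsub>G\<^esub> \<in> ?K" by auto
      fix a b assume a: "a \<in> ?K" and b: "b \<in> ?K"
      have "\<exists>u\<in>nf_dom. a \<otimes>\<^bsub>G\<^esub> b \<otimes>\<^bsub>G\<^esub> G.nf t = G.nf u" if t: "t \<in> nf_dom" for t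
      proof -
        obtain u where u: "u \<in> nf_dom" "b \<otimes>\<^bsub>G\<^esub> G.nf t = G.nf u" using b t by blast
        obtain v where v: "v \<in> nf_dom" "a \<otimes>\<^bsub>G\<^esub> G.nf u = G.nf v" using a u(1) by blast
        have "a \<otimes>\<^bsub>G\<^esub> b \<otimes>\<^bsub>G\<^esub> G.nf t = a \<otimes>\<^bsub>G\<^esub> (b \<otimes>\<^bsub>G\<^esub> G.nf t)"
          using a b by (intro G.m_assoc) auto
        then show ?thesis using u v by auto
      qed
      then show "a \<otimes>\<^bsub>G\<^esub> b \<in> ?K" using a b by blast
    qed blast
    show "x \<in> ?K" using G.nf_x nf_dom_closed(1) G.gens_carrier(1) by blast
    show "y \<in> ?K" using G.nf_y nf_dom_closed(2) G.gens_carrier(2) by blast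
    show "s \<in> ?K" using G.nf_s nf_dom_closed(3) G.gens_carrier(3) by blast
  qed
  then have "\<exists>u\<in>nf_dom. g = G.nf u" if g: "g \<in> carrier G" for g
  proof -
    have "g \<in> ?K" using g \<open>?K = carrier G\<close> by simp
    then obtain u where "u \<in> nf_dom" "g \<otimes>\<^bsub>G\<^esub> G.nf (0, 0, 0) = G.nf u" using zero by blast
    then show ?thesis unfolding G.nf_one using g by auto
  qed
  then have img: "G.nf ` nf_dom = carrier G" by auto
  have fin_dom: "finite nf_dom" "card nf_dom = 24" by (simp_all add: nf_dom_def)
  then have bijG: "bij_betw G.nf nf_dom (carrier G)"
    using eq_card_imp_inj_on[of nf_dom G.nf] img card by (simp add: bij_betw_def)
  \<comment> \<open>Read off the exponents in G and evaluate them in H.\<close>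
  define f where "f = H.nf \<circ> the_inv_into nf_dom G.nf"
  have f_bij: "bij_betw f (carrier G) (carrier H)"
    unfolding f_def using bij_betw_the_inv_into[OF bijG] bij by (rule bij_betw_trans)
  have f_nf: "f (G.nf t) = H.nf t" if "t \<in> nf_dom" for t
    using the_inv_into_f_f[OF bij_betw_imp_inj_on[OF bijG] that] by (simp add: f_def)
  have fH: "f g \<in> carrier H" if "g \<in> carrier G" for g using bij_betwE[OF f_bij] that by blast
  have nfE: "\<exists>t\<in>nf_dom. g = G.nf t" if "g \<in> carrier G" for g using img that by blast
  have fx: "f (x \<otimes>\<^bsub>G\<^esub> h) = x' \<otimes>\<^bsub>H\<^esub> f h" if h: "h \<in> carrier G" for h
  proof -
    obtain t where t: "t \<in> nf_dom" "h = G.nf t" using nfE[OF h] by blast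
    show ?thesis
      unfolding t(2) G.nf_x f_nf[OF nf_dom_closed(1)[OF t(1)]] f_nf[OF t(1)] H.nf_x ..
  qed
  have fy: "f (y \<otimes>\<^bsub>G\<^esub> h) = y' \<otimes>\<^bsub>H\<^esub> f h" if h: "h \<in> carrier G" for h
  proof -
    obtain t where t: "t \<in> nf_dom" "h = G.nf t" using nfE[OF h] by blast
    show ?thesis
      unfolding t(2) G.nf_y[OF t(1)] f_nf[OF nf_dom_closed(2)[OF t(1)]] f_nf[OF t(1)] H.nf_y[OF t(1)] ..
  qed
  have fs: "f (s \<otimes>\<^bsub>G\<^esub> h) = s' \<otimes>\<^bsub>H\<^esub> f h" if h: "h \<in> carrier G" for h
  proof -
    obtain t where t: "t \<in> nf_dom" "h = G.nf t" using nfE[OF h] by blast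
    show ?thesis
      unfolding t(2) G.nf_s[OF t(1)] f_nf[OF nf_dom_closed(3)[OF t(1)]] f_nf[OF t(1)] H.nf_s[OF t(1)] ..
  qed
  have dom: "(1, 0, 0) \<in> nf_dom" "(0, 1, 0) \<in> nf_dom" "(0, 0, 1) \<in> nf_dom" by (simp_all add: nf_dom_def)
  have fg: "f x = x'" "f y = y'" "f s = s'"
    using f_nf[OF dom(1)] f_nf[OF dom(2)] f_nf[OF dom(3)] by (simp_all only: G.nf_gens H.nf_gens)
  have f1: "f \<one>\<^bsub>G\<^esub> = \<one>\<^bsub>H\<^esub>" using f_nf[OF zero] by (simp only: G.nf_one H.nf_one)
  \<comment> \<open>Left factors for which f is multiplicative are closed under products, and the
    generators are among them.\<close>
  have "{g \<in> carrier G. \<forall>h\<in>carrier G. f (g \<otimes>\<^bsub>G\<^esub> h) = f g \<otimes>\<^bsub>H\<^esub> f h} = carrier G" (is "?K = _")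
  proof (rule gen)
    show "subgroup ?K G"
    proof (rule G.finite_closed_subgroup[OF finG])
      show "\<one>\<^bsub>G\<^esub> \<in> ?K" using f1 fH by auto
      fix a b assume a: "a \<in> ?K" and b: "b \<in> ?K"
      then have aG: "a \<in> carrier G" and bG: "b \<in> carrier G" by blast+
      have "f (a \<otimes>\<^bsub>G\<^esub> b \<otimes>\<^bsub>G\<^esub> h) = f (a \<otimes>\<^bsub>G\<^esub> b) \<otimes>\<^bsub>H\<^esub> f h" if h: "h \<in> carrier G" for h
      proof -
        have "f (a \<otimes>\<^bsub>G\<^esub> b \<otimes>\<^bsub>G\<^esub> h) = f (a \<otimes>\<^bsub>G\<^esub> (b \<otimes>\<^bsub>G\<^esub> h))" using G.m_assoc[OF aG bG h] by simp
        also have "\<dots> = f a \<otimes>\<^bsub>H\<^esub> f (b \<otimes>\<^bsub>G\<^esub> h)" using a G.m_closed[OF bG h] by blast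
        also have "f (b \<otimes>\<^bsub>G\<^esub> h) = f b \<otimes>\<^bsub>H\<^esub> f h" using b h by blast
        also have "f a \<otimes>\<^bsub>H\<^esub> (f b \<otimes>\<^bsub>H\<^esub> f h) = (f a \<otimes>\<^bsub>H\<^esub> f b) \<otimes>\<^bsub>H\<^esub> f h"
          using H.m_assoc[OF fH[OF aG] fH[OF bG] fH[OF h]] by simp
        also have "f a \<otimes>\<^bsub>H\<^esub> f b = f (a \<otimes>\<^bsub>G\<^esub> b)" using a bG by simp
        finally show ?thesis .
      qed
      then show "a \<otimes>\<^bsub>G\<^esub> b \<in> ?K" using aG bG by simp
    qed blast
    show "x \<in> ?K" "y \<in> ?K" "s \<in> ?K" using fx fy fs fg by simp_all
  qed
  then have "f \<in> hom G H" using fH by (intro homI) blast+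
  then show ?thesis using f_bij by (intro is_isoI isoI)
qed

section \<open>Explicit matrices over the field with three elements\<close>

definition mk22 :: "3 \<Rightarrow> 3 \<Rightarrow> 3 \<Rightarrow> 3 \<Rightarrow> 3 ^ 2 ^ 2" where
  "mk22 a b c d = vector [vector [a, b], vector [c, d]]"

lemma mk22_nth [simp]:
  "mk22 a b c d $ 1 $ 1 = a" "mk22 a b c d $ 1 $ 2 = b" "mk22 a b c d $ 2 $ 1 = c" "mk22 a b c d $ 2 $ 2 = d"
  by (simp_all add: mk22_def)

lemma mk22_eq_iff [simp]: "mk22 a b c d = mk22 a' b' c' d' \<longleftrightarrow> a = a' \<and> b = b' \<and> c = c' \<and> d = d'"
  by (auto simp: vec_eq_iff forall_2)

lemma mk22_mult [simp]:
  "mk22 a b c d ** mk22 a' b' c' d' = mk22 (a * a' + b * c') (a * b' + b * d') (c * a' + d * c') (c * b' + d * d')"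
  by (simp add: vec_eq_iff forall_2 matrix_matrix_mult_def sum_2)

lemma mk22_one: "mat 1 = mk22 1 0 0 1"
  by (simp add: vec_eq_iff forall_2 mat_def)

lemma mk22_eta: "A = mk22 (A $ 1 $ 1) (A $ 1 $ 2) (A $ 2 $ 1) (A $ 2 $ 2)"
  by (simp add: vec_eq_iff forall_2)

lemma det_mk22: "det (mk22 a b c d) = a * d - b * c"
  by (simp add: det_2)

lemma exhaust_Z3: "(a::3) = 0 \<or> a = 1 \<or> a = 2"
  using exhaust_3[of a] by auto

text \<open>Here 2 = -1. The first two matrices have square -1 and anticommute, so they generate a
  quaternion group; the third is a transvection of order 3.\<close>

lemma SL2_3_presentation: "binary_tetrahedral SL2_3 (mk22 0 2 1 0) (mk22 1 1 1 2) (mk22 1 1 0 1)"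
proof -
  interpret group SL2_3 by (rule group_SL2_3)
  show ?thesis
    by unfold_locales
      (simp_all add: SL2_3_def det_mk22 mk22_one numeral_eq_Suc nat_pow_def)
qed

lemma SL2_3_normal_forms:
  "bij_betw (binary_tetrahedral.nf SL2_3 (mk22 0 2 1 0) (mk22 1 1 1 2) (mk22 1 1 0 1)) nf_dom (carrier SL2_3)"
proof -
  interpret B: binary_tetrahedral SL2_3 "mk22 0 2 1 0" "mk22 1 1 1 2" "mk22 1 1 0 1"
    by (rule SL2_3_presentation)
  have pow:
    "mk22 0 2 1 0 [^]\<^bsub>SL2_3\<^esub> (0::nat) = mk22 1 0 0 1" "mk22 0 2 1 0 [^]\<^bsub>SL2_3\<^esub> (1::nat) = mk22 0 2 1 0"
    "mk22 0 2 1 0 [^]\<^bsub>SL2_3\<^esub> (2::nat) = mk22 2 0 0 2" "mk22 0 2 1 0 [^]\<^bsub>SL2_3\<^esub> (3::nat) = mk22 0 1 2 0"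
    "mk22 1 1 1 2 [^]\<^bsub>SL2_3\<^esub> (0::nat) = mk22 1 0 0 1" "mk22 1 1 1 2 [^]\<^bsub>SL2_3\<^esub> (1::nat) = mk22 1 1 1 2"
    "mk22 1 1 0 1 [^]\<^bsub>SL2_3\<^esub> (0::nat) = mk22 1 0 0 1" "mk22 1 1 0 1 [^]\<^bsub>SL2_3\<^esub> (1::nat) = mk22 1 1 0 1"
    "mk22 1 1 0 1 [^]\<^bsub>SL2_3\<^esub> (2::nat) = mk22 1 2 0 1"
    by (simp_all add: SL2_3_def mk22_one numeral_eq_Suc nat_pow_def)
  have mult: "A \<otimes>\<^bsub>SL2_3\<^esub> C = A ** C" for A C by (simp add: SL2_3_def)
  have dom: "nf_dom = {0, 1, 2, 3} \<times> {0, 1} \<times> {0, 1, 2}"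
  proof -
    have "{..<4::nat} = {0, 1, 2, 3}" "{..<2::nat} = {0, 1}" "{..<3::nat} = {0, 1, 2}"
      unfolding set_eq_iff lessThan_iff insert_iff empty_iff by presburger+
    then show ?thesis unfolding nf_dom_def by simp
  qed
  \<comment> \<open>The values of the normal forms in lexicographic order of (a, b, c), three
    consecutive entries for each pair (a, b).\<close>
  let ?L = "{mk22 1 0 0 1, mk22 1 1 0 1, mk22 1 2 0 1, mk22 1 1 1 2, mk22 1 2 1 0, mk22 1 0 1 1,
    mk22 0 2 1 0, mk22 0 2 1 1, mk22 0 2 1 2, mk22 2 1 1 1, mk22 2 0 1 2, mk22 2 2 1 0,
    mk22 2 0 0 2, mk22 2 2 0 2, mk22 2 1 0 2, mk22 2 2 2 1, mk22 2 1 2 0, mk22 2 0 2 2,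
    mk22 0 1 2 0, mk22 0 1 2 2, mk22 0 1 2 1, mk22 1 2 2 2, mk22 1 0 2 1, mk22 1 1 2 0}"
  have "B.nf ` nf_dom = (\<Union>a\<in>{0, 1, 2, 3}. \<Union>b\<in>{0, 1}. \<Union>c\<in>{0, 1, 2}. {B.nf (a, b, c)})"
    unfolding dom by blast
  also have "\<dots> = ?L"
    unfolding UN_insert UN_empty Un_empty_right insert_is_Un[symmetric] B.nf_def prod.case mult pow mk22_mult
    by (intro equalityI) simp_all
  finally have img: "B.nf ` nf_dom = ?L" .
  \<comment> \<open>All 81 matrices are tried; those of determinant 1 are in the list.\<close>
  have "carrier SL2_3 \<subseteq> ?L"
  proof
    fix A assume A: "A \<in> carrier SL2_3"
    obtain a b c d where m: "A = mk22 a b c d" using mk22_eta by blast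
    have "a * d - b * c = 1" using A unfolding m by (simp add: SL2_3_def det_mk22)
    then show "A \<in> ?L" unfolding m
      using exhaust_Z3[of a] exhaust_Z3[of b] exhaust_Z3[of c] exhaust_Z3[of d]
      by (elim disjE) simp_all
  qed
  moreover have "B.nf ` nf_dom \<subseteq> carrier SL2_3" by (rule image_subsetI) (rule B.nf_carrier)
  ultimately have surj: "B.nf ` nf_dom = carrier SL2_3" unfolding img by blast
  have "card ?L = 24" by simp
  then have "inj_on B.nf nf_dom" using img by (intro eq_card_imp_inj_on) (simp_all add: nf_dom_def)
  then show ?thesis using surj by (simp add: bij_betw_def)
qed

subsection \<open>The quaternion case\<close>

context cyclic_maximal_group
begin

lemma p2: "p = 2" and n2: "n = 2"
  using p_n_eq_2 by blast+

lemma ord_outside: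
  assumes w: "w \<in> M" "w \<notin> F"
  shows "ord w = 4" "card (generate G {w}) = 4"
proof -
  have "w \<notin> Z" using w in_Z_iff by blast
  then show "ord w = 4" "card (generate G {w}) = 4"
    using outside(6)[OF w(1)] cyc_card[OF w(1)] p2 n2 by simp_all
qed

text \<open>Phi(M) is generated by x^2 with x of order 4. Squares of elements outside it lie in it
  and are not 1, so they all equal the same involution.\<close>

lemma F_two:
  obtains z where "F = {\<one>, z}" "z \<noteq> \<one>" "\<And>w. w \<in> M \<Longrightarrow> w \<notin> F \<Longrightarrow> w \<otimes> w = z"
proof -
  obtain x where x: "x \<in> M" "x \<notin> Z" using MZ by blast
  have xG: "x \<in> carrier G" using M_carrier[OF x(1)] .
  have "ord x = 2 ^ Suc 1" using outside(6)[OF x] p2 n2 by simp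
  then have "ord (x [^] (2::nat)) = 2 ^ 1" using ord_pow_prime[OF two_is_prime_nat xG] by blast
  then have "card F = 2"
    using F_cyclic(1)[OF x] generate_pow_card[of "x [^] (2::nat)"] xG p2 by simp
  then obtain a b where ab: "F = {a, b}" "a \<noteq> b" unfolding card_2_iff by metis
  have "\<one> \<in> {a, b}" using subgroup.one_closed[OF F_sub] ab(1) by simp
  then obtain z where z: "F = {\<one>, z}" "z \<noteq> \<one>" using ab by (metis insert_commute insert_iff singletonD)
  have "w \<otimes> w = z" if w: "w \<in> M" "w \<notin> F" for w
  proof -
    have wG: "w \<in> carrier G" using M_carrier[OF w(1)] .
    have wZ: "w \<notin> Z" using w in_Z_iff by blast
    have "w [^] (2::nat) = w \<otimes> w" using wG by (simp add: numeral_2_eq_2)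
    moreover have "w [^] (2::nat) \<in> F" "w [^] (2::nat) \<noteq> \<one>"
      using pow_in_F[OF p w(1) M_p_elem[OF w(1)]] F_cyclic(5)[OF w(1) wZ] p2 by simp_all
    ultimately show ?thesis using z(1) by auto
  qed
  then show thesis using that z by blast
qed

text \<open>Otherwise [w,s] would lie in Phi(M) and w in \<open>Z\<close>. So s moves every
  non-trivial element of M/Phi(M), which settles the case distinctions below.\<close>

lemma conj_not_mod_F:
  assumes w: "w \<in> M" "w \<notin> F" and f: "f \<in> F"
  shows "s \<otimes> w \<otimes> inv s \<noteq> f \<otimes> w"
proof
  assume eq: "s \<otimes> w \<otimes> inv s = f \<otimes> w"
  have wG: "w \<in> carrier G" and fG: "f \<in> carrier G"
    using M_carrier[OF w(1)] subgroup.mem_carrier[OF F_sub f] .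
  have "commu w s = w \<otimes> inv (s \<otimes> w \<otimes> inv s)" using wG sG by (simp add: word_simps)
  also have "\<dots> = inv f" unfolding eq using wG fG by (simp add: word_simps)
  finally have "commu w s \<in> F" using subgroup.m_inv_closed[OF F_sub f] by simp
  then have "w \<in> Z" using Z_I[OF w(1) sG s(2)] by blast
  then show False using w in_Z_iff by blast
qed

lemma conj_outside:
  assumes x: "x \<in> M" "x \<notin> F"
  shows "s \<otimes> x \<otimes> inv s \<in> M" "s \<otimes> x \<otimes> inv s \<notin> F"
proof -
  have xG: "x \<in> carrier G" using M_carrier[OF x(1)] .
  show "s \<otimes> x \<otimes> inv s \<in> M" using M_normal_closed[OF x(1) sG] .
  show "s \<otimes> x \<otimes> inv s \<notin> F"
  proof
    assume "s \<otimes> x \<otimes> inv s \<in> F"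
    then have "inv s \<otimes> (s \<otimes> x \<otimes> inv s) \<otimes> inv (inv s) \<in> F" using normal_closed[OF F_normal inv_closed[OF sG]] by blast
    then show False using x(2) xG sG by (simp add: word_simps)
  qed
qed

lemma cyclic_elements:
  assumes z: "F = {\<one>, z}" "z \<noteq> \<one>" and x: "x \<in> M" "x \<notin> F"
  shows "generate G {x} = {\<one>, z, x, z \<otimes> x}"
proof -
  have xG: "x \<in> carrier G" using M_carrier[OF x(1)] .
  have zG: "z \<in> carrier G" using z(1) subgroup.mem_carrier[OF F_sub] by blast
  have xZ: "x \<notin> Z" using x in_Z_iff by blast
  have sX: "subgroup (generate G {x}) G" "x \<in> generate G {x}" using generate_singleton[OF xG] by blast+
  have zX: "z \<in> generate G {x}" using F_cyclic(3)[OF x(1) xZ] z(1) by blast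
  have ne: "x \<noteq> \<one>" "x \<noteq> z" using x(2) z(1) by blast+
  have "z \<otimes> x \<noteq> \<one>"
  proof
    assume "z \<otimes> x = \<one>"
    then have "x = inv z" using inv_equality[of x z] inv_comm xG zG by metis
    then have "x \<in> F" using subgroup.m_inv_closed[OF F_sub] z(1) by blast
    then show False using x(2) by blast
  qed
  moreover have "z \<otimes> x \<noteq> z" using ne(1) xG zG by simp
  moreover have "z \<otimes> x \<noteq> x" using z(2) xG zG by simp
  ultimately have "card {\<one>, z, x, z \<otimes> x} = 4" using ne z(2) by auto
  moreover have "{\<one>, z, x, z \<otimes> x} \<subseteq> generate G {x}"
    using subgroup.one_closed[OF sX(1)] zX sX(2) subgroup.m_closed[OF sX(1) zX sX(2)] by simp
  ultimately show ?thesis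
    using card_subset_eq_sub[OF sX(1)] ord_outside(2)[OF x] by metis
qed

text \<open><x> has index 2 in M, as the orders are 4 and 8.\<close>

lemma M_cosets:
  assumes x: "x \<in> M" "x \<notin> F" and y: "y \<in> M" "y \<notin> generate G {x}" and m: "m \<in> M" "m \<notin> generate G {x}"
  shows "\<exists>h\<in>generate G {x}. m = h \<otimes> y"
proof -
  let ?X = "generate G {x}"
  have xG: "x \<in> carrier G" and yG: "y \<in> carrier G" using M_carrier x(1) y(1) by blast+
  have sX: "subgroup ?X G" using generate_singleton[OF xG] by blast
  have XM: "?X \<subseteq> M" using generate_subgroup_incl[OF _ sM] x(1) by blast
  have XG: "h \<in> carrier G" if "h \<in> ?X" for h using subgroup.mem_carrier[OF sX that] .
  have "inj_on (\<lambda>h. h \<otimes> y) ?X"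
  proof (rule inj_onI)
    fix a b assume "a \<in> ?X" "b \<in> ?X" "a \<otimes> y = b \<otimes> y"
    with XG[of a] XG[of b] yG show "a = b" by simp
  qed
  then have c: "card ((\<lambda>h. h \<otimes> y) ` ?X) = 4" using ord_outside(2)[OF x] by (simp add: card_image)
  have disj: "?X \<inter> (\<lambda>h. h \<otimes> y) ` ?X = {}"
  proof (rule ccontr)
    assume "?X \<inter> (\<lambda>h. h \<otimes> y) ` ?X \<noteq> {}"
    then obtain h where h: "h \<in> ?X" "h \<otimes> y \<in> ?X" by blast
    have "inv h \<otimes> (h \<otimes> y) \<in> ?X" using subgroup.m_closed[OF sX subgroup.m_inv_closed[OF sX h(1)] h(2)] .
    then show False using y(2) XG[OF h(1)] yG by (simp add: word_simps)
  qed
  have finX: "finite ?X" using finite_sub[OF sX] .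
  have "card (?X \<union> (\<lambda>h. h \<otimes> y) ` ?X) = card M"
    using card_Un_disjoint[OF finX _ disj] finX c ord_outside(2)[OF x] cardM p2 n2 by simp
  moreover have "?X \<union> (\<lambda>h. h \<otimes> y) ` ?X \<subseteq> M" using XM subgroup.m_closed[OF sM] y(1) by blast
  ultimately have "?X \<union> (\<lambda>h. h \<otimes> y) ` ?X = M" using card_subset_eq[OF finite_sub[OF sM]] by blast
  then show ?thesis using m by blast
qed

text \<open>M/Phi(M) has order 4, and s acts on it without non-trivial fixed points, cycling the
  classes of x, y and xy. The relations thus hold up to the central involution z, and a change of x
  removes the remaining sign.\<close>

theorem binary_tetrahedral_generators:
  obtains x y where "binary_tetrahedral G x y s" "card (carrier G) = 24"
    "\<And>K. subgroup K G \<Longrightarrow> x \<in> K \<Longrightarrow> y \<in> K \<Longrightarrow> s \<in> K \<Longrightarrow> K = carrier G"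
proof -
  obtain z where z: "F = {\<one>, z}" "z \<noteq> \<one>" "\<And>w. w \<in> M \<Longrightarrow> w \<notin> F \<Longrightarrow> w \<otimes> w = z" by (rule F_two) blast
  have zF: "z \<in> F" using z(1) by blast
  have zG: "z \<in> carrier G" using subgroup.mem_carrier[OF F_sub zF] .
  have zM: "z \<in> M" using zF F_M by blast
  have zc: "z \<otimes> g = g \<otimes> z" if "g \<in> carrier G" for g using F_central[OF zF that] .
  have zz: "z \<otimes> z = \<one>"
  proof -
    have "z \<otimes> z \<in> F" using subgroup.m_closed[OF F_sub zF zF] .
    moreover have "z \<otimes> z \<noteq> z" using z(2) zG by simp
    ultimately show ?thesis using z(1) by blast
  qed
  have zz': "z \<otimes> (z \<otimes> g) = g" if "g \<in> carrier G" for g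
    using zz that zG by (simp flip: m_assoc)
  \<comment> \<open>If x and y commuted, then (xy)^2 = x^2 y^2 = z^2 = 1, although xy is outside F
    and squares to z. So [y,x] = z.\<close>
  have pair: "y \<in> M \<and> y \<notin> F \<and> y \<notin> generate G {x} \<and> y \<otimes> x = z \<otimes> (x \<otimes> y) \<and>
      (s \<otimes> y \<otimes> inv s = x \<otimes> y \<or> s \<otimes> y \<otimes> inv s = z \<otimes> (x \<otimes> y))"
    if x: "x \<in> M" "x \<notin> F" and y: "y = s \<otimes> x \<otimes> inv s" for x y
  proof -
    have yM: "y \<in> M" and yF: "y \<notin> F" unfolding y using conj_outside[OF x] by blast+
    have xG: "x \<in> carrier G" and yG: "y \<in> carrier G" using M_carrier x(1) yM by blast+
    let ?X = "generate G {x}"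
    have X: "?X = {\<one>, z, x, z \<otimes> x}" using cyclic_elements[OF z(1,2) x] .
    have sX: "subgroup ?X G" "x \<in> ?X" using generate_singleton[OF xG] by blast+
    have yX: "y \<notin> ?X" unfolding y using conj_not_in_cyclic[OF x] .
    have xyM: "x \<otimes> y \<in> M" using subgroup.m_closed[OF sM x(1) yM] .
    have xyF: "x \<otimes> y \<notin> F"
    proof
      assume "x \<otimes> y \<in> F"
      then have "x \<otimes> y \<in> ?X" using X z(1) by blast
      then have "inv x \<otimes> (x \<otimes> y) \<in> ?X" using subgroup.m_closed[OF sX(1) subgroup.m_inv_closed[OF sX]] by blast
      then show False using yX xG yG by (simp add: word_simps)
    qed
    have yx: "y \<otimes> x = z \<otimes> (x \<otimes> y)"
    proof -
      have yx_c: "y \<otimes> x = commu y x \<otimes> (x \<otimes> y)" using xG yG by (simp add: word_simps)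
      have "commu y x \<noteq> \<one>"
      proof
        assume "commu y x = \<one>"
        then have c: "y \<otimes> x = x \<otimes> y" using commu_one_iff[OF yG xG] by blast
        have "z = (x \<otimes> y) \<otimes> (x \<otimes> y)" using z(3)[OF xyM xyF] by simp
        also have "\<dots> = x \<otimes> ((y \<otimes> x) \<otimes> y)" using xG yG by (simp add: m_assoc)
        also have "\<dots> = (x \<otimes> x) \<otimes> (y \<otimes> y)" unfolding c using xG yG by (simp add: m_assoc)
        also have "\<dots> = \<one>" using z(3)[OF x] z(3)[OF yM yF] zz by simp
        finally show False using z(2) by blast
      qed
      moreover have "commu y x \<in> F" using M_commu[OF yM x(1)] .
      ultimately have "commu y x = z" using z(1) by blast
      then show ?thesis using yx_c by simp
    qed
    let ?y = "s \<otimes> y \<otimes> inv s"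
    have y': "?y \<in> M" "?y \<notin> F" using conj_outside[OF yM yF] by blast+
    have sxy: "s \<otimes> (x \<otimes> y) \<otimes> inv s = y \<otimes> ?y" unfolding y using sG xG by (simp add: word_simps)
    \<comment> \<open>Either possible value would make s send xy to xy or to z xy, contrary to
      \<open>conj_not_mod_F\<close>.\<close>
    have "?y \<notin> ?X"
    proof
      assume "?y \<in> ?X"
      then consider "?y = x" | "?y = z \<otimes> x" using X y'(2) z(1) by blast
      then show False
      proof cases
        case 1
        then have "s \<otimes> (x \<otimes> y) \<otimes> inv s = z \<otimes> (x \<otimes> y)" unfolding sxy using yx by simp
        then show False using conj_not_mod_F[OF xyM xyF zF] by blast
      next
        case 2
        have "y \<otimes> (z \<otimes> x) = (y \<otimes> z) \<otimes> x" using xG yG zG by (simp add: m_assoc)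
        also have "\<dots> = z \<otimes> (y \<otimes> x)" unfolding zc[OF yG, symmetric] using xG yG zG by (simp add: m_assoc)
        also have "\<dots> = x \<otimes> y" unfolding yx using zz'[of "x \<otimes> y"] xG yG by simp
        finally have "s \<otimes> (x \<otimes> y) \<otimes> inv s = \<one> \<otimes> (x \<otimes> y)" unfolding sxy 2 using xG yG by simp
        then show False using conj_not_mod_F[OF xyM xyF subgroup.one_closed[OF F_sub]] by blast
      qed
    qed
    then obtain h where h: "h \<in> ?X" "?y = h \<otimes> y" using M_cosets[OF x yM yX y'(1)] by blast
    have "h \<notin> F" using conj_not_mod_F[OF yM yF] h(2) by blast
    then consider "h = x" | "h = z \<otimes> x" using h(1) X z(1) by blast
    then have "?y = x \<otimes> y \<or> ?y = z \<otimes> (x \<otimes> y)"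
      using h(2) xG yG zG by cases (simp_all add: m_assoc)
    then show ?thesis using yM yF yX yx by blast
  qed
  \<comment> \<open>Choice of x for which s maps y exactly to xy and not to z xy.\<close>
  have "\<exists>x. x \<in> M \<and> x \<notin> F \<and> s \<otimes> (s \<otimes> x \<otimes> inv s) \<otimes> inv s = x \<otimes> (s \<otimes> x \<otimes> inv s)"
  proof -
    obtain x where x: "x \<in> M" "x \<notin> F" using MZ F_Z by blast
    define y where "y = s \<otimes> x \<otimes> inv s"
    have pr: "y \<in> M" "s \<otimes> y \<otimes> inv s = x \<otimes> y \<or> s \<otimes> y \<otimes> inv s = z \<otimes> (x \<otimes> y)"
      using pair[OF x y_def] by blast+
    have xG: "x \<in> carrier G" and yG: "y \<in> carrier G" using M_carrier x(1) pr(1) by blast+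
    from pr(2) show ?thesis
    proof
      assume "s \<otimes> y \<otimes> inv s = x \<otimes> y"
      then show ?thesis using x unfolding y_def by blast
    next
      assume sy: "s \<otimes> y \<otimes> inv s = z \<otimes> (x \<otimes> y)"
      \<comment> \<open>Replacing x by zx turns y into zy but leaves xy unchanged, since z^2 = 1;
        this absorbs the factor z.\<close>
      have zx: "z \<otimes> x \<in> M" using subgroup.m_closed[OF sM zM x(1)] .
      have zxF: "z \<otimes> x \<notin> F"
      proof
        assume "z \<otimes> x \<in> F"
        then have "z \<otimes> (z \<otimes> x) \<in> F" using subgroup.m_closed[OF F_sub zF] by blast
        then show False using zz'[OF xG] x(2) by simp
      qed
      have szx: "s \<otimes> (z \<otimes> w) \<otimes> inv s = z \<otimes> (s \<otimes> w \<otimes> inv s)" if w: "w \<in> carrier G" for w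
      proof -
        have "s \<otimes> (z \<otimes> w) \<otimes> inv s = (s \<otimes> z) \<otimes> (w \<otimes> inv s)" using w sG zG by (simp add: m_assoc)
        also have "\<dots> = z \<otimes> (s \<otimes> w \<otimes> inv s)" unfolding zc[OF sG, symmetric] using w sG zG by (simp add: m_assoc)
        finally show ?thesis .
      qed
      have e1: "s \<otimes> (z \<otimes> x) \<otimes> inv s = z \<otimes> y" unfolding y_def using szx[OF xG] .
      have e2: "s \<otimes> (z \<otimes> y) \<otimes> inv s = x \<otimes> y" unfolding szx[OF yG] sy using zz'[of "x \<otimes> y"] xG yG by simp
      have "(z \<otimes> x) \<otimes> (z \<otimes> y) = z \<otimes> ((x \<otimes> z) \<otimes> y)" using xG yG zG by (simp add: m_assoc)
      also have "\<dots> = z \<otimes> (z \<otimes> (x \<otimes> y))" unfolding zc[OF xG, symmetric] using xG yG zG by (simp add: m_assoc)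
      also have "\<dots> = x \<otimes> y" using zz'[of "x \<otimes> y"] xG yG by simp
      finally show ?thesis using zx zxF e1 e2 by metis
    qed
  qed
  then obtain x where x: "x \<in> M" "x \<notin> F" and x': "s \<otimes> (s \<otimes> x \<otimes> inv s) \<otimes> inv s = x \<otimes> (s \<otimes> x \<otimes> inv s)" by blast
  define y where "y = s \<otimes> x \<otimes> inv s"
  have sys: "s \<otimes> y \<otimes> inv s = x \<otimes> y" using x' unfolding y_def .
  have pr: "y \<in> M" "y \<notin> F" "y \<notin> generate G {x}" "y \<otimes> x = z \<otimes> (x \<otimes> y)" using pair[OF x y_def] by blast+
  have xG: "x \<in> carrier G" and yG: "y \<in> carrier G" using M_carrier x(1) pr(1) by blast+
  have xx: "x \<otimes> x = z" and yy: "y \<otimes> y = z" using z(3) x pr(1,2) by blast+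
  have sx: "s \<otimes> x = y \<otimes> s" unfolding y_def using sG xG by (simp add: word_simps)
  have sy: "s \<otimes> y = x \<otimes> y \<otimes> s"
  proof -
    have "s \<otimes> y = (s \<otimes> y \<otimes> inv s) \<otimes> s" using sG yG by (simp add: word_simps)
    then show ?thesis unfolding sys .
  qed
  have yxy: "y \<otimes> (x \<otimes> y) = x"
  proof -
    have "y \<otimes> (x \<otimes> y) = (y \<otimes> x) \<otimes> y" using xG yG by (simp add: m_assoc)
    also have "\<dots> = z \<otimes> (x \<otimes> (y \<otimes> y))" unfolding pr(4) using xG yG zG by (simp add: m_assoc)
    also have "\<dots> = x" unfolding yy zc[OF xG, symmetric] using zz'[OF xG] .
    finally show ?thesis .
  qed
  \<comment> \<open>Conjugation by s carries x to y, y to xy, and xy to y(xy) = x.\<close>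
  have s3x: "s [^] (3::nat) \<otimes> x = x \<otimes> s [^] (3::nat)"
  proof -
    have s3: "s [^] (3::nat) = s \<otimes> (s \<otimes> s)" using sG by (simp add: numeral_3_eq_3 m_assoc)
    have "s [^] (3::nat) \<otimes> x = s \<otimes> (s \<otimes> (s \<otimes> x))" unfolding s3 using sG xG by (simp add: m_assoc)
    also have "\<dots> = s \<otimes> ((s \<otimes> y) \<otimes> s)" unfolding sx using sG yG by (simp add: m_assoc)
    also have "\<dots> = (s \<otimes> x) \<otimes> (y \<otimes> (s \<otimes> s))" unfolding sy using sG xG yG by (simp add: m_assoc)
    also have "\<dots> = y \<otimes> ((s \<otimes> y) \<otimes> (s \<otimes> s))" unfolding sx using sG yG by (simp add: m_assoc)
    also have "\<dots> = (y \<otimes> (x \<otimes> y)) \<otimes> (s \<otimes> (s \<otimes> s))" unfolding sy using sG xG yG by (simp add: m_assoc)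
    also have "\<dots> = x \<otimes> s [^] (3::nat)" unfolding yxy s3 ..
    finally show ?thesis .
  qed
  obtain k where k: "s [^] (q ^ k) = \<one>" using s(1) by (auto simp: p_elem_def)
  \<comment> \<open>If q were not 3, s would be a power of s^3 and commute with x, whereas y = s x
    s^-1 lies outside <x>.\<close>
  have q3: "q = 3"
  proof (rule ccontr)
    assume q3: "q \<noteq> 3"
    let ?C = "{g \<in> carrier G. commu x g \<in> {\<one>}}"
    have sC: "subgroup ?C G" using commutes_mod_subgroup[OF one_is_normal xG] .
    have "s [^] (3::nat) \<in> carrier G" using sG by simp
    then have "s [^] (3::nat) \<in> ?C" using commu_one_iff[OF xG] s3x by simp
    moreover have "s [^] (q ^ k) \<in> ?C" unfolding k using subgroup.one_closed[OF sC] .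
    moreover have "prime (3::nat)" by simp
    then have "coprime 3 (q ^ k)" using primes_coprime[of 3 q] q q3 by simp
    ultimately have "s \<in> ?C" using pow_coprime_mem[OF sC sG] by blast
    then have "x \<otimes> s = s \<otimes> x" using commu_one_iff[OF xG sG] by blast
    then have "y = x" unfolding y_def using sG xG by (metis inv_solve_right' m_closed)
    then show False using pr(3) generate_singleton(2)[OF xG] by blast
  qed
  have card24: "card (carrier G) = 24" using cardG cardM q3 p2 n2 by simp
  \<comment> \<open>The order of s is a power of 3 dividing 24, and 9 does not divide 24.\<close>
  have s3: "s [^] (3::nat) = \<one>"
  proof -
    have "ord s dvd 3 ^ k" using k pow_eq_id[OF sG] q3 by simp
    then obtain i where i: "ord s = 3 ^ i" using divides_primepow_nat[of 3] by auto
    have "3 ^ i dvd (24::nat)" using ord_dvd_group_order[OF sG] i card24 by (simp add: order_def)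
    have "\<not> 2 \<le> i"
    proof
      assume "2 \<le> i"
      then have "3 ^ 2 dvd (3::nat) ^ i" by (rule le_imp_power_dvd)
      then have "3 ^ 2 dvd (24::nat)" using \<open>3 ^ i dvd 24\<close> dvd_trans by blast
      then show False by simp
    qed
    then have "ord s dvd 3 ^ 1" unfolding i by (intro le_imp_power_dvd) simp
    then show ?thesis using pow_eq_id[OF sG, of 3] by simp
  qed
  have "binary_tetrahedral G x y s"
  proof (unfold_locales)
    show "x \<in> carrier G" "y \<in> carrier G" "s \<in> carrier G" using xG yG sG .
    have "x [^] (4::nat) = (x \<otimes> x) \<otimes> (x \<otimes> x)" using xG by (simp add: numeral_eq_Suc m_assoc)
    then show "x [^] (4::nat) = \<one>" unfolding xx zz .
    show "y \<otimes> y = x \<otimes> x" using xx yy by simp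
    have "x [^] (3::nat) \<otimes> y = (x \<otimes> x) \<otimes> (x \<otimes> y)" using xG yG by (simp add: numeral_eq_Suc m_assoc)
    then show "y \<otimes> x = x [^] (3::nat) \<otimes> y" unfolding xx pr(4) by simp
    show "s [^] (3::nat) = \<one>" by (rule s3)
    show "s \<otimes> x = y \<otimes> s" by (rule sx)
    show "s \<otimes> y = x \<otimes> y \<otimes> s" by (rule sy)
  qed
  \<comment> \<open>K \<inter> M contains the maximal subgroup <x> of M and also y outside it, so K
    contains M, and then s completes G.\<close>
  moreover have "K = carrier G" if K: "subgroup K G" "x \<in> K" "y \<in> K" "s \<in> K" for K
  proof (rule generated_by_M[OF sG s(2) K(1) _ K(4)])
    have "subgroup (K \<inter> M) G" using subgroups_Inter_pair[OF K(1) sM] .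
    moreover have "generate G {x} \<subseteq> K \<inter> M"
      using generate_subgroup_incl[OF _ \<open>subgroup (K \<inter> M) G\<close>] K(2) x(1) by blast
    moreover have "x \<notin> Z" using x in_Z_iff by blast
    ultimately have "K \<inter> M = generate G {x} \<or> K \<inter> M = M"
      using cyc[OF x(1)] unfolding maximal_subgroup_iff[OF sM] by blast
    then show "M \<subseteq> K" using pr(1,3) K(3) by blast
  qed
  ultimately show thesis using that card24 by blast
qed

lemma iso_SL2_3: "G \<cong> SL2_3"
proof -
  obtain x y where "binary_tetrahedral G x y s" "card (carrier G) = 24"
    "\<And>K. subgroup K G \<Longrightarrow> x \<in> K \<Longrightarrow> y \<in> K \<Longrightarrow> s \<in> K \<Longrightarrow> K = carrier G"
    using binary_tetrahedral_generators by metis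
  then show ?thesis
    using binary_tetrahedral_iso[OF _ SL2_3_presentation fin _ _ SL2_3_normal_forms] by blast
qed

end

section \<open>From chains of maximal subgroups to the structural locales\<close>

theorem theorem1p9:
  fixes G :: "('a, 'b) monoid_scheme"
  assumes "group G"
    and "finite (carrier G)"
    and "\<exists>H. n_maximal_subgroup 3 H G \<and> H \<noteq> {\<one>\<^bsub>G\<^esub>}"
    and "\<And>H. n_maximal_subgroup 3 H G \<Longrightarrow> IC_Phi_subgroup H G"
  shows "nilpotent_group G \<or> G \<cong> SL2_3"
proof (cases "nilpotent_group G")
  case False
  interpret fgroup G using assms(1,2) by (simp add: fgroup_def fgroup_axioms_def)
  have chain: "n_maximal_subgroup 3 H G"
    if "maximal_subgroup M G" "maximal_subgroup H1 (G\<lparr>carrier := M\<rparr>)" "maximal_subgroup H (G\<lparr>carrier := H1\<rparr>)" for H H1 M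
  proof -
    have M: "subgroup M G" using maximal_sub_carrier[OF that(1)] by blast
    have H1: "subgroup H1 G" using that(2) unfolding maximal_subgroup_iff[OF M] by blast
    have H: "subgroup H G" using that(3) unfolding maximal_subgroup_iff[OF H1] by blast
    show ?thesis unfolding three_maximal_chain using that M H1 H subgroup_self by blast
  qed
  interpret third_maximal_IC G
  proof unfold_locales
    show "IC_Phi_subgroup H G"
      if "maximal_subgroup M G" "maximal_subgroup H1 (G\<lparr>carrier := M\<rparr>)" "maximal_subgroup H (G\<lparr>carrier := H1\<rparr>)" for H H1 M
      using assms(4)[OF chain[OF that]] .
    show "\<exists>H H1 M. maximal_subgroup M G \<and> maximal_subgroup H1 (G\<lparr>carrier := M\<rparr>) \<and>
      maximal_subgroup H (G\<lparr>carrier := H1\<rparr>) \<and> H \<noteq> {\<one>\<^bsub>G\<^esub>}"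
      using assms(3) unfolding three_maximal_chain by blast
  qed (rule False)
  obtain M p q s n where *: "nilpotent_maximal G M" "prime p" "prime q" "p \<noteq> q"
    "card (carrier G) = q * card M" "card M = p ^ Suc n" "n \<ge> 2" "p_elem G q s" "s \<notin> M"
    "\<not> M \<subseteq> nilpotent_maximal.Z G M"
    "\<And>x. x \<in> M \<Longrightarrow> x \<notin> nilpotent_maximal.Z G M \<Longrightarrow>
       maximal_subgroup (generate G {x}) (G\<lparr>carrier := M\<rparr>) \<and> \<not> generate G {x} \<lhd> G \<and> card (generate G {x}) = p ^ n"
    by (rule cyclic_maximal_structure) blast
  interpret M: nilpotent_maximal G M by fact
  interpret C: cyclic_maximal_group G M p q s n
  proof unfold_locales
    show "IC_Phi_subgroup H G"
      if "maximal_subgroup H1 (G\<lparr>carrier := M\<rparr>)" "maximal_subgroup H (G\<lparr>carrier := H1\<rparr>)" for H H1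
      using IC[OF M.maxM that] .
  qed (use * in blast)+
  show ?thesis using C.iso_SL2_3 by blast
qed simp

end
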